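(* Let $\{u^\varepsilon\}$ be a bounded sequence in $L^2(\Omega)$. Then there exist a subsequence of $\{u^\varepsilon\}$, denoted again by $\{u^\varepsilon\}$, and a function $u\in L^2(\Omega;L^2(Y_x))$ such that $u^\varepsilon\to u$ in the locally-periodic two-scale sense as $\varepsilon\to 0$.
   Context: Setting. $\Omega\subset\mathbb R^d$ is a bounded Lipschitz domain; $Y=[0,1]^d$; $r\in(0,1)$ is fixed; $\varepsilon>0$ runs through a sequence tending to $0$. For each $x\in\mathbb R^d$ an invertible matrix $D_x:=D(x)\in\mathbb R^{d\times d}$ with inverse $D_x^{-1}:=D^{-1}(x)$ is given, with $D,D^{-1}\in \mathrm{Lip}(\mathbb R^d;\mathbb R^{d\times d})$ and $0<D_1\le|\det D(x)|\le D_2<\infty$ for all $x\in\overline\Omega$. Put $Y_x=D_xY$. Function spaces. The subscript "per" means $Y$-periodic (functions are extended periodically to $\mathbb R^d$). $\psi\in L^2(\Omega;C_{\mathrm{per}}(Y_x))$ means $\psi(x,y)=\tilde\psi(x,D_x^{-1}y)$ with $\tilde\psi\in L^2(\Omega;C_{\mathrm{per}}(Y))$; $\tilde\psi$ is called the function corresponding to $\psi$. Likewise, $u\in L^2(\Omega;L^2(Y_x))$ means $u(x,y)=\tilde u(x,D_x^{-1}y)$ with $\tilde u\in L^2(\Omega;L^2(Y))$. Covering. For each $\varepsilon$, $\{\Omega_n^\varepsilon\}_{1\le n\le N_\varepsilon}$ is a family of open non-intersecting cubes of side $\varepsilon^r$ with $\Omega\subset\bigcup_{n=1}^{N_\varepsilon}\overline{\Omega_n^\varepsilon}$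 and $\Omega_n^\varepsilon\cap\Omega\neq\emptyset$. Points $x_n^\varepsilon\in\Omega_n^\varepsilon\cap\Omega$ are arbitrarily chosen and fixed, and $\tilde x_n^\varepsilon$ is either an arbitrarily chosen fixed point of $\Omega_n^\varepsilon\cap\Omega$ or $\tilde x_n^\varepsilon=D_{x_n^\varepsilon}\varepsilon k$ with some $k\in\mathbb Z^d$ (in which case, by periodicity, $\tilde x_n^\varepsilon$ may be omitted from the formula below). Locally-periodic approximation. For $x\in\Omega$, $$(\mathcal L^\varepsilon\psi)(x)=\sum_{n=1}^{N_\varepsilon}\tilde\psi\Big(x,\frac{D_{x_n^\varepsilon}^{-1}(x-\tilde x_n^\varepsilon)}{\varepsilon}\Big)\chi_{\Omega_n^\varepsilon}(x),$$ where $\chi_A$ is the characteristic function of $A$. Locally-periodic two-scale (l-t-s) convergence. A sequence $\{u^\varepsilon\}\subset L^2(\Omega)$ converges locally-periodic two-scale to $u\in L^2(\Omega;L^2(Y_x))$ as $\varepsilon\to0$ if for every $\psi\in L^2(\Omega;C_{\mathrm{per}}(Y_x))$ $$\lim_{\varepsilon\to0}\int_\Omega u^\varepsilon(x)\,\mathcal L^\varepsilon\psi(x)\,dx=\int_\Omega\frac1{|Y_x|}\int_{Y_x}u(x,y)\psi(x,y)\,dy\,dx.$$ *)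

theory Defs
  imports "HOL-Analysis.Analysis"
begin

section \<open>Bounded Lipschitz domains\<close>

text \<open>Near each boundary point, \<open>\<Omega>\<close> is the strict epigraph, in some direction \<open>e\<close>, of a Lipschitz
  function on the hyperplane orthogonal to \<open>e\<close>; the hyperplane plays the role of
  \<open>d - 1\<close> dimensional space.\<close>

definition bounded_lipschitz_domain :: "(real ^ 'd) set \<Rightarrow> bool" where
  "bounded_lipschitz_domain \<Omega> \<longleftrightarrow>
     open \<Omega> \<and> connected \<Omega> \<and> \<Omega> \<noteq> {} \<and> bounded \<Omega> \<and>
     (\<forall>p\<in>frontier \<Omega>. \<exists>\<rho>>0. \<exists>e \<gamma> L. norm e = 1 \<and> L-lipschitz_on {z. z \<bullet> e = 0} \<gamma> \<and>
        \<Omega> \<inter> ball p \<rho> = {x \<in> ball p \<rho>. x \<bullet> e > \<gamma> (x - (x \<bullet> e) *\<^sub>R e)})"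

section \<open>Function spaces\<close>

text \<open>Elements of \<open>L\<^sup>2\<close> spaces are represented by functions rather than by classes of functions
  that agree almost everywhere.\<close>

definition L2_space :: "'a measure \<Rightarrow> ('a \<Rightarrow> real) set" where
  "L2_space M = {f \<in> borel_measurable M. integrable M (\<lambda>x. (f x)\<^sup>2)}"

definition L2_norm :: "'a measure \<Rightarrow> ('a \<Rightarrow> real) \<Rightarrow> real" where
  "L2_norm M f = sqrt (LINT x|M. (f x)\<^sup>2)"

text \<open>The Bochner space \<open>L\<^sup>2(M; V)\<close> for a space \<open>V\<close> of functions with (semi)norm \<open>N\<close>: strongly
  measurable maps, i.e. almost everywhere limits of \<open>V\<close>-valued simple functions, whose norm is
  square integrable. Allowing a seminorm covers \<open>V = L\<^sup>2(Y)\<close> without passing to a quotient.\<close>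

definition strongly_measurable ::
    "'a measure \<Rightarrow> ('b \<Rightarrow> real) set \<Rightarrow> (('b \<Rightarrow> real) \<Rightarrow> real) \<Rightarrow> ('a \<Rightarrow> 'b \<Rightarrow> real) \<Rightarrow> bool" where
  "strongly_measurable M V N f \<longleftrightarrow>
     (\<exists>s :: nat \<Rightarrow> 'a \<Rightarrow> 'b \<Rightarrow> real.
        (\<forall>i. simple_function M (s i) \<and> (\<forall>x\<in>space M. s i x \<in> V)) \<and>
        (AE x in M. (\<lambda>i. N (\<lambda>y. s i x y - f x y)) \<longlonglongrightarrow> 0))"

definition bochner_L2 ::
    "'a measure \<Rightarrow> ('b \<Rightarrow> real) set \<Rightarrow> (('b \<Rightarrow> real) \<Rightarrow> real) \<Rightarrow> ('a \<Rightarrow> 'b \<Rightarrow> real) set" where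
  "bochner_L2 M V N =
     {f. (\<forall>x\<in>space M. f x \<in> V) \<and> strongly_measurable M V N f \<and>
         integrable M (\<lambda>x. (N (f x))\<^sup>2)}"

definition unit_cell :: "(real ^ 'd) set" where
  "unit_cell = cbox 0 1"

text \<open>\<open>Y\<close>-periodic continuous functions, regarded as extended to the whole space.\<close>

definition C_per :: "(real ^ 'd \<Rightarrow> real) set" where
  "C_per = {f. continuous_on UNIV f \<and> (\<forall>y i. f (y + axis i 1) = f y)}"

definition sup_norm :: "(real ^ 'd \<Rightarrow> real) \<Rightarrow> real" where
  "sup_norm f = (SUP y\<in>unit_cell. \<bar>f y\<bar>)"

definition L2_C_per :: "(real ^ 'd) set \<Rightarrow> (real ^ 'd \<Rightarrow> real ^ 'd \<Rightarrow> real) set" where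
  "L2_C_per \<Omega> = bochner_L2 (lebesgue_on \<Omega>) C_per sup_norm"

definition L2_L2 :: "(real ^ 'd) set \<Rightarrow> (real ^ 'd \<Rightarrow> real ^ 'd \<Rightarrow> real) set" where
  "L2_L2 \<Omega> = bochner_L2 (lebesgue_on \<Omega>)
     (L2_space (lebesgue_on unit_cell)) (L2_norm (lebesgue_on unit_cell))"

text \<open>The cell \<open>Y\<^sub>x = D\<^sub>x Y\<close>, and the passage from \<open>\<psi>'\<close> to the function
  \<open>\<psi>(x,y) = \<psi>'(x, D\<^sub>x\<^sup>-\<^sup>1 y)\<close> to which it corresponds.\<close>

definition cell :: "(real ^ 'd \<Rightarrow> real ^ 'd ^ 'd) \<Rightarrow> real ^ 'd \<Rightarrow> (real ^ 'd) set" where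
  "cell D x = (\<lambda>y. D x *v y) ` unit_cell"

definition to_cell ::
    "(real ^ 'd \<Rightarrow> real ^ 'd ^ 'd) \<Rightarrow> (real ^ 'd \<Rightarrow> real ^ 'd \<Rightarrow> real)
      \<Rightarrow> (real ^ 'd \<Rightarrow> real ^ 'd \<Rightarrow> real)" where
  "to_cell D f = (\<lambda>x y. f x (matrix_inv (D x) *v y))"

definition L2_L2_cell ::
    "(real ^ 'd \<Rightarrow> real ^ 'd ^ 'd) \<Rightarrow> (real ^ 'd) set \<Rightarrow> (real ^ 'd \<Rightarrow> real ^ 'd \<Rightarrow> real) set" where
  "L2_L2_cell D \<Omega> = to_cell D ` L2_L2 \<Omega>"

section \<open>Coverings by cubes\<close>

text \<open>Cubes may have any position and orientation.\<close>

definition open_cube :: "real \<Rightarrow> (real ^ 'd) set \<Rightarrow> bool" where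
  "open_cube s C \<longleftrightarrow>
     (\<exists>(a :: real ^ 'd) (f :: real ^ 'd \<Rightarrow> real ^ 'd). orthogonal_transformation f \<and>
        C = (\<lambda>x. a + f x) ` box 0 (s *\<^sub>R 1))"

definition cube_covering ::
    "(real ^ 'd) set \<Rightarrow> real \<Rightarrow> nat \<Rightarrow> (nat \<Rightarrow> (real ^ 'd) set) \<Rightarrow> bool" where
  "cube_covering \<Omega> s N Q \<longleftrightarrow>
     (\<forall>n\<in>{1..N}. open_cube s (Q n) \<and> Q n \<inter> \<Omega> \<noteq> {}) \<and>
     disjoint_family_on Q {1..N} \<and>
     \<Omega> \<subseteq> (\<Union>n\<in>{1..N}. closure (Q n))"

text \<open>\<open>p n\<close> is the point at which the cell is frozen on \<open>Q n\<close>, and \<open>q n\<close> the origin of the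
  oscillations there. Either kind of choice for \<open>q n\<close> may be made separately on each cube.\<close>

definition admissible_points ::
    "(real ^ 'd) set \<Rightarrow> (real ^ 'd \<Rightarrow> real ^ 'd ^ 'd) \<Rightarrow> real \<Rightarrow> nat \<Rightarrow> (nat \<Rightarrow> (real ^ 'd) set)
      \<Rightarrow> (nat \<Rightarrow> real ^ 'd) \<Rightarrow> (nat \<Rightarrow> real ^ 'd) \<Rightarrow> bool" where
  "admissible_points \<Omega> D \<epsilon> N Q p q \<longleftrightarrow>
     (\<forall>n\<in>{1..N}. p n \<in> Q n \<inter> \<Omega> \<and>
        (q n \<in> Q n \<inter> \<Omega> \<or>
         (\<exists>k :: real ^ 'd. (\<forall>i. k $ i \<in> \<int>) \<and> q n = D (p n) *v (\<epsilon> *\<^sub>R k))))"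

section \<open>Locally-periodic two-scale convergence\<close>

text \<open>The argument \<open>f\<close> is the function corresponding to the one that is approximated.\<close>

definition lp_approx ::
    "(real ^ 'd \<Rightarrow> real ^ 'd ^ 'd) \<Rightarrow> real \<Rightarrow> nat \<Rightarrow> (nat \<Rightarrow> (real ^ 'd) set)
      \<Rightarrow> (nat \<Rightarrow> real ^ 'd) \<Rightarrow> (nat \<Rightarrow> real ^ 'd)
      \<Rightarrow> (real ^ 'd \<Rightarrow> real ^ 'd \<Rightarrow> real) \<Rightarrow> real ^ 'd \<Rightarrow> real" where
  "lp_approx D \<epsilon> N Q p q f x =
     (\<Sum>n=1..N. f x ((1 / \<epsilon>) *\<^sub>R (matrix_inv (D (p n)) *v (x - q n))) * indicator (Q n) x)"

definition lts_converges ::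
    "(real ^ 'd) set \<Rightarrow> (real ^ 'd \<Rightarrow> real ^ 'd ^ 'd) \<Rightarrow> (nat \<Rightarrow> real) \<Rightarrow> (nat \<Rightarrow> nat)
      \<Rightarrow> (nat \<Rightarrow> nat \<Rightarrow> (real ^ 'd) set) \<Rightarrow> (nat \<Rightarrow> nat \<Rightarrow> real ^ 'd) \<Rightarrow> (nat \<Rightarrow> nat \<Rightarrow> real ^ 'd)
      \<Rightarrow> (nat \<Rightarrow> real ^ 'd \<Rightarrow> real) \<Rightarrow> (real ^ 'd \<Rightarrow> real ^ 'd \<Rightarrow> real) \<Rightarrow> bool" where
  "lts_converges \<Omega> D \<epsilon> N Q p q us u \<longleftrightarrow>
     (\<forall>j. us j \<in> L2_space (lebesgue_on \<Omega>)) \<and> u \<in> L2_L2_cell D \<Omega> \<and>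
     (\<forall>\<psi> \<psi>'. \<psi>' \<in> L2_C_per \<Omega> \<and> \<psi> = to_cell D \<psi>' \<longrightarrow>
        (\<lambda>j. LINT x|lebesgue_on \<Omega>. us j x * lp_approx D (\<epsilon> j) (N j) (Q j) (p j) (q j) \<psi>' x)
        \<longlonglongrightarrow> (LINT x|lebesgue_on \<Omega>. (1 / measure lebesgue (cell D x)) *
                 (LINT y|lebesgue_on (cell D x). u x y * \<psi> x y)))"

end

theory Submission
  imports Defs "HOL-Complex_Analysis.Great_Picard"
begin

text \<open>Write \<open>\<tau>\<^sub>j x\<close> for the rescaled position of \<open>x\<close> in the cube that contains it, so that
  the approximation of a test function \<open>f\<close> is \<open>f x (\<tau>\<^sub>j x)\<close>. Since the cells are much
  smaller than the cubes, the cells meeting a set fill little more than the set itself; hence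
  \<open>limsup \<integral>\<^sub>A g (\<tau>\<^sub>j x) dx \<le> |A| \<integral>\<^sub>Y g\<close> for \<open>g \<ge> 0\<close>, and only this upper half of the mean value
  property is needed. Testing with indicators of a countable family of open sets, multiplied by
  indicators of the cells of a grid in the oscillating variable, a diagonal argument gives a
  subsequence along which \<open>F f = lim \<integral> u\<^sub>j f x (\<tau>\<^sub>j x) dx\<close> exists for all simple functions \<open>f\<close>
  with periodic continuous values. The upper bound makes \<open>F\<close> bounded for the norm of
  \<open>L\<^sup>2(\<Omega>; L\<^sup>2(Y))\<close>, so approximate Riesz representatives, themselves simple functions, form a
  Cauchy sequence. Its limit \<open>u\<close> is strongly measurable by construction and represents \<open>F\<close>; density
  of the simple functions extends this to all test functions.\<close>

section \<open>Square integrable functions\<close>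

text \<open>The cubes carry different lattices, so a cell crossing a face of its cube is cut, and
  the excess is paid for by a shell of width of order \<epsilon> around each cube of side
  \<epsilon>^r. There are at most about \<epsilon>^(-rd) cubes and each shell has volume about
  \<epsilon>^(1+r(d-1)), in total \<epsilon>^(1-r), which tends to 0 because r < 1. The one-sided
  mean value estimate is enough because it is applied to squares: it bounds the L^2 norm of the
  oscillating test function, which is what Cauchy-Schwarz asks for. The convention of working with
  functions instead of classes shapes the construction of u. Its value has to lie in L^2(Y) at every
  point of \<Omega>, and u has to be a limit of simple functions almost everywhere. The approximate
  representatives are therefore chosen with errors 2^(-n): their increments are summable, so the
  limit can be taken on each fibre, by one explicit formula and without further
  subsequences.\<close>

lemma quadratic_nonneg_imp_discriminant_le:
  fixes a b c :: real
  assumes nn: "\<And>t. 0 \<le> a + 2 * t * b + t\<^sup>2 * c"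
  shows "b\<^sup>2 \<le> a * c"
proof -
  have a: "0 \<le> a" using nn[of 0] by simp
  consider "c = 0" | "c > 0" | "c < 0" by linarith
  then show ?thesis
  proof cases
    case 1
    have "b = 0"
    proof (rule ccontr)
      assume "b \<noteq> 0"
      \<comment> \<open>At this \<open>t\<close> the affine function \<open>a + 2 * t * b\<close>
        takes the value -1.\<close>
      then have "2 * (- (a + 1) / (2 * b)) * b = - (a + 1)" by simp
      moreover have "0 \<le> a + 2 * (- (a + 1) / (2 * b)) * b"
        using nn[of "- (a + 1) / (2 * b)"] 1 by simp
      ultimately show False by linarith
    qed
    then show ?thesis using 1 by simp
  next
    case 2
    have "2 * (- b / c) * b = - 2 * (b\<^sup>2 / c)" "(- b / c)\<^sup>2 * c = b\<^sup>2 / c"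
      using 2 by (simp_all add: power2_eq_square)
    then have "b\<^sup>2 / c \<le> a" using nn[of "- b / c"] by linarith
    then show ?thesis using 2 by (simp add: pos_divide_le_eq)
  next
    case 3
    \<comment> \<open>Adding the hypothesis at \<open>t\<close> and at \<open>- t\<close> cancels
      the linear term and leaves \<open>2 * a - 2 * (a + 1)\<close>, which is -2.\<close>
    define t where "t = sqrt ((a + 1) / - c)"
    have "t\<^sup>2 = (a + 1) / - c"
      unfolding t_def by (rule real_sqrt_pow2) (use 3 a in \<open>auto intro!: divide_nonneg_neg\<close>)
    then have "t\<^sup>2 * c = - (a + 1)" using 3 by simp
    moreover have "2 * (- t) * b = - (2 * t * b)" "(- t)\<^sup>2 = t\<^sup>2" by simp_all
    ultimately have False using nn[of t] nn[of "- t"] by simp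
    then show ?thesis ..
  qed
qed

lemma L2_spaceD:
  assumes "f \<in> L2_space M"
  shows "f \<in> borel_measurable M" "integrable M (\<lambda>x. (f x)\<^sup>2)"
  using assms by (auto simp: L2_space_def)

lemma L2_norm_nonneg [simp]: "0 \<le> L2_norm M f"
  by (simp add: L2_norm_def)

lemma L2_norm_power2: "(L2_norm M f)\<^sup>2 = (LINT x|M. (f x)\<^sup>2)"
  by (simp add: L2_norm_def)

lemma L2_norm_minus_commute: "L2_norm M (\<lambda>x. f x - g x) = L2_norm M (\<lambda>x. g x - f x)"
  by (simp add: L2_norm_def power2_commute)

lemma L2_norm_cmult: "L2_norm M (\<lambda>x. c * f x) = \<bar>c\<bar> * L2_norm M f"
  by (simp add: L2_norm_def power_mult_distrib real_sqrt_mult)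

lemma L2_mult_integrable:
  assumes "f \<in> L2_space M" "g \<in> L2_space M"
  shows "integrable M (\<lambda>x. f x * g x)"
proof (rule Bochner_Integration.integrable_bound)
  note [measurable] = L2_spaceD(1)[OF assms(1)] L2_spaceD(1)[OF assms(2)]
  show "integrable M (\<lambda>x. (f x)\<^sup>2 + (g x)\<^sup>2)"
    using assms by (auto dest: L2_spaceD)
  show "(\<lambda>x. f x * g x) \<in> borel_measurable M" by measurable
  have "\<bar>a * b\<bar> \<le> a\<^sup>2 + b\<^sup>2" for a b :: real
  proof -
    have "2 * (\<bar>a\<bar> * \<bar>b\<bar>) \<le> \<bar>a\<bar>\<^sup>2 + \<bar>b\<bar>\<^sup>2"
      using sum_squares_bound[of "\<bar>a\<bar>" "\<bar>b\<bar>"] by (simp add: mult.assoc)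
    moreover have "0 \<le> \<bar>a\<bar> * \<bar>b\<bar>" by simp
    ultimately have "\<bar>a\<bar> * \<bar>b\<bar> \<le> \<bar>a\<bar>\<^sup>2 + \<bar>b\<bar>\<^sup>2" by linarith
    then show ?thesis by (simp add: abs_mult)
  qed
  then show "AE x in M. norm (f x * g x) \<le> norm ((f x)\<^sup>2 + (g x)\<^sup>2)" by auto
qed

lemma L2_space_add:
  assumes "f \<in> L2_space M" "g \<in> L2_space M"
  shows "(\<lambda>x. f x + g x) \<in> L2_space M"
proof -
  note [measurable] = L2_spaceD(1)[OF assms(1)] L2_spaceD(1)[OF assms(2)]
  have "integrable M (\<lambda>x. (f x)\<^sup>2 + (g x)\<^sup>2 + 2 * (f x * g x))"
    using L2_spaceD(2)[OF assms(1)] L2_spaceD(2)[OF assms(2)] L2_mult_integrable[OF assms] by simp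
  then show ?thesis
    unfolding L2_space_def by (auto simp: power2_sum mult.assoc)
qed

lemma L2_space_cmult:
  assumes "f \<in> L2_space M"
  shows "(\<lambda>x. c * f x) \<in> L2_space M"
  using assms unfolding L2_space_def by (auto simp: power_mult_distrib)

lemma L2_space_diff:
  assumes "f \<in> L2_space M" "g \<in> L2_space M"
  shows "(\<lambda>x. f x - g x) \<in> L2_space M"
  using L2_space_add[OF assms(1) L2_space_cmult[OF assms(2), of "-1"]] by simp

lemma L2_space_zero [simp]: "(\<lambda>x. 0) \<in> L2_space M"
  by (simp add: L2_space_def)

text \<open>The integral of \<open>(f x + t * g x)\<^sup>2\<close> is a nonnegative quadratic
  polynomial in \<open>t\<close>; its discriminant gives the estimate.\<close>

lemma L2_Cauchy_Schwarz:
  assumes "f \<in> L2_space M" "g \<in> L2_space M"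
  shows "\<bar>LINT x|M. f x * g x\<bar> \<le> L2_norm M f * L2_norm M g"
proof -
  note [simp] = L2_spaceD(2)[OF assms(1)] L2_spaceD(2)[OF assms(2)] L2_mult_integrable[OF assms]
  have "(LINT x|M. f x * g x)\<^sup>2 \<le> (LINT x|M. (f x)\<^sup>2) * (LINT x|M. (g x)\<^sup>2)"
  proof (rule quadratic_nonneg_imp_discriminant_le)
    fix t :: real
    have "(f x + t * g x)\<^sup>2 = (f x)\<^sup>2 + 2 * t * (f x * g x) + t\<^sup>2 * (g x)\<^sup>2" for x
      by (simp add: power2_eq_square algebra_simps)
    then have "(LINT x|M. (f x + t * g x)\<^sup>2) =
        (LINT x|M. (f x)\<^sup>2) + 2 * t * (LINT x|M. f x * g x) + t\<^sup>2 * (LINT x|M. (g x)\<^sup>2)"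
      by simp
    moreover have "0 \<le> (LINT x|M. (f x + t * g x)\<^sup>2)" by simp
    ultimately show "0 \<le> (LINT x|M. (f x)\<^sup>2) + 2 * t * (LINT x|M. f x * g x)
        + t\<^sup>2 * (LINT x|M. (g x)\<^sup>2)" by simp
  qed
  also have "\<dots> = (L2_norm M f * L2_norm M g)\<^sup>2"
    by (simp add: L2_norm_power2 power_mult_distrib)
  finally have "\<bar>LINT x|M. f x * g x\<bar>\<^sup>2 \<le> (L2_norm M f * L2_norm M g)\<^sup>2" by simp
  then show ?thesis by (rule power2_le_imp_le) simp
qed

lemma L2_norm_triangle:
  assumes "f \<in> L2_space M" "g \<in> L2_space M"
  shows "L2_norm M (\<lambda>x. f x + g x) \<le> L2_norm M f + L2_norm M g"
proof (rule power2_le_imp_le)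
  note [simp] = L2_spaceD(2)[OF assms(1)] L2_spaceD(2)[OF assms(2)] L2_mult_integrable[OF assms]
  have "(L2_norm M (\<lambda>x. f x + g x))\<^sup>2 = (LINT x|M. (f x)\<^sup>2 + (g x)\<^sup>2 + 2 * (f x * g x))"
    by (simp add: L2_norm_power2 power2_sum mult.assoc)
  also have "\<dots> = (L2_norm M f)\<^sup>2 + (L2_norm M g)\<^sup>2 + 2 * (LINT x|M. f x * g x)"
    by (simp add: L2_norm_power2)
  also have "\<dots> \<le> (L2_norm M f + L2_norm M g)\<^sup>2"
    using L2_Cauchy_Schwarz[OF assms] by (simp add: power2_sum)
  finally show "(L2_norm M (\<lambda>x. f x + g x))\<^sup>2 \<le> (L2_norm M f + L2_norm M g)\<^sup>2" .
qed simp

lemma L2_norm_triangle_diff: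
  assumes "f \<in> L2_space M" "g \<in> L2_space M" "h \<in> L2_space M"
  shows "L2_norm M (\<lambda>x. f x - h x) \<le> L2_norm M (\<lambda>x. f x - g x) + L2_norm M (\<lambda>x. g x - h x)"
  using L2_norm_triangle[OF L2_space_diff[OF assms(1,2)] L2_space_diff[OF assms(2,3)]] by simp

lemma L2_norm_diff_abs:
  assumes "f \<in> L2_space M" "g \<in> L2_space M"
  shows "\<bar>L2_norm M f - L2_norm M g\<bar> \<le> L2_norm M (\<lambda>x. f x - g x)"
  using L2_norm_triangle[OF L2_space_diff[OF assms] assms(2)]
    L2_norm_triangle[OF L2_space_diff[OF assms(2,1)] assms(1)]
  by (simp add: L2_norm_minus_commute[of M g f])

lemma L2_space_bound:
  assumes "g \<in> L2_space M" "f \<in> borel_measurable M" "\<And>x. x \<in> space M \<Longrightarrow> \<bar>f x\<bar> \<le> g x"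
  shows "f \<in> L2_space M" "L2_norm M f \<le> L2_norm M g"
proof -
  have le: "(f x)\<^sup>2 \<le> (g x)\<^sup>2" if "x \<in> space M" for x
    using assms(3)[OF that] by (metis abs_ge_zero power2_abs power_mono)
  have "integrable M (\<lambda>x. (f x)\<^sup>2)"
    by (rule Bochner_Integration.integrable_bound[OF L2_spaceD(2)[OF assms(1)]])
      (use assms(2) le in \<open>auto intro!: AE_I2\<close>)
  then show f: "f \<in> L2_space M" using assms(2) by (simp add: L2_space_def)
  show "L2_norm M f \<le> L2_norm M g"
    unfolding L2_norm_def
    using L2_spaceD(2)[OF f] L2_spaceD(2)[OF assms(1)] le
    by (intro real_sqrt_le_mono integral_mono) auto
qed

lemma (in finite_measure) L2_space_bounded:
  assumes "f \<in> borel_measurable M" "\<And>x. x \<in> space M \<Longrightarrow> \<bar>f x\<bar> \<le> B"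
  shows "f \<in> L2_space M"
  by (rule L2_space_bound(1)[of "\<lambda>_. B"]) (use assms in \<open>auto simp: L2_space_def\<close>)

lemma (in finite_measure) L2_space_integrable:
  assumes "f \<in> L2_space M"
  shows "integrable M f" "(LINT x|M. \<bar>f x\<bar>) \<le> sqrt (measure M (space M)) * L2_norm M f"
proof -
  have one: "(\<lambda>_. 1) \<in> L2_space M" by (simp add: L2_space_def)
  show "integrable M f" using L2_mult_integrable[OF one assms] by simp
  have abs: "(\<lambda>x. \<bar>f x\<bar>) \<in> L2_space M" using L2_spaceD[OF assms] by (simp add: L2_space_def)
  show "(LINT x|M. \<bar>f x\<bar>) \<le> sqrt (measure M (space M)) * L2_norm M f"
    using L2_Cauchy_Schwarz[OF one abs] by (simp add: L2_norm_def)
qed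

section \<open>Limits and completeness in \<open>L2_space\<close>\<close>

lemma L2_Fatou:
  assumes g: "\<And>m. g m \<in> L2_space M" and f: "f \<in> borel_measurable M"
    and lim: "AE x in M. (\<lambda>m. g m x) \<longlonglongrightarrow> f x"
    and bd: "\<forall>\<^sub>F m in sequentially. L2_norm M (g m) \<le> K"
  shows "f \<in> L2_space M" "L2_norm M f \<le> K"
proof -
  note [measurable] = f L2_spaceD(1)[OF g]
  \<comment> \<open>A single instance of the bound gives \<open>0 \<le> K\<close>, which is needed
    to take roots at the end.\<close>
  obtain m where "L2_norm M (g m) \<le> K"
    using eventually_happens'[OF sequentially_bot bd] by auto
  then have K: "0 \<le> K"
    using L2_norm_nonneg[of M "g m"] by linarith
  have "(\<integral>\<^sup>+ x. ennreal ((f x)\<^sup>2) \<partial>M) = (\<integral>\<^sup>+ x. liminf (\<lambda>m. ennreal ((g m x)\<^sup>2)) \<partial>M)"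
  proof (rule nn_integral_cong_AE)
    show "AE x in M. ennreal ((f x)\<^sup>2) = liminf (\<lambda>m. ennreal ((g m x)\<^sup>2))"
      using lim
    proof eventually_elim
      case (elim x)
      then have "(\<lambda>m. ennreal ((g m x)\<^sup>2)) \<longlonglongrightarrow> ennreal ((f x)\<^sup>2)"
        by (intro tendsto_ennrealI tendsto_power)
      from lim_imp_Liminf[OF _ this] show ?case by simp
    qed
  qed
  also have "\<dots> \<le> liminf (\<lambda>m. \<integral>\<^sup>+ x. ennreal ((g m x)\<^sup>2) \<partial>M)"
    by (rule nn_integral_liminf) simp
  also have "\<dots> \<le> ennreal (K\<^sup>2)"
  proof -
    have "\<forall>\<^sub>F m in sequentially. (\<integral>\<^sup>+ x. ennreal ((g m x)\<^sup>2) \<partial>M) \<le> ennreal (K\<^sup>2)"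
      using bd
    proof eventually_elim
      case (elim m)
      have "(\<integral>\<^sup>+ x. ennreal ((g m x)\<^sup>2) \<partial>M) = ennreal ((L2_norm M (g m))\<^sup>2)"
        unfolding L2_norm_power2 by (rule nn_integral_eq_integral) (use L2_spaceD[OF g] in auto)
      also have "\<dots> \<le> ennreal (K\<^sup>2)"
        using elim by (intro ennreal_leI power_mono) auto
      finally show ?case .
    qed
    then show ?thesis
      by (rule Liminf_le[OF sequentially_bot])
  qed
  finally have *: "(\<integral>\<^sup>+ x. ennreal ((f x)\<^sup>2) \<partial>M) \<le> ennreal (K\<^sup>2)" .
  have int: "integrable M (\<lambda>x. (f x)\<^sup>2)"
  proof (rule integrableI_bounded)
    show "(\<integral>\<^sup>+ x. ennreal (norm ((f x)\<^sup>2)) \<partial>M) < \<infinity>"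
      using * le_less_trans[OF _ ennreal_less_top] by auto
  qed simp
  then show "f \<in> L2_space M" by (simp add: L2_space_def)
  have "ennreal (LINT x|M. (f x)\<^sup>2) \<le> ennreal (K\<^sup>2)"
    using * nn_integral_eq_integral[OF int] by simp
  then have "(L2_norm M f)\<^sup>2 \<le> K\<^sup>2" unfolding L2_norm_power2 by (simp add: ennreal_le_iff)
  then show "L2_norm M f \<le> K" using K by (rule power2_le_imp_le)
qed

text \<open>On a finite measure space the L^2 norm controls the L^1 norm, so the sum of all
  \<open>\<bar>g n x\<bar>\<close> has a finite integral and is finite almost everywhere.\<close>

lemma (in finite_measure) L2_summable_AE:
  assumes g: "\<And>n. g n \<in> L2_space M" and s: "summable (\<lambda>n. L2_norm M (g n))"
  shows "AE x in M. summable (\<lambda>n. \<bar>g n x\<bar>)"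
proof -
  note [measurable] = L2_spaceD(1)[OF g]
  let ?m = "sqrt (measure M (space M))"
  have "(\<integral>\<^sup>+ x. (\<Sum>n. ennreal \<bar>g n x\<bar>) \<partial>M) = (\<Sum>n. \<integral>\<^sup>+ x. ennreal \<bar>g n x\<bar> \<partial>M)"
    by (rule nn_integral_suminf) simp
  also have "\<dots> \<le> (\<Sum>n. ennreal (?m * L2_norm M (g n)))"
  proof (rule suminf_le)
    fix n
    have "(\<integral>\<^sup>+ x. ennreal \<bar>g n x\<bar> \<partial>M) = ennreal (LINT x|M. \<bar>g n x\<bar>)"
      by (rule nn_integral_eq_integral) (use L2_space_integrable[OF g] in auto)
    also have "\<dots> \<le> ennreal (?m * L2_norm M (g n))"
      by (rule ennreal_leI) (rule L2_space_integrable[OF g])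
    finally show "(\<integral>\<^sup>+ x. ennreal \<bar>g n x\<bar> \<partial>M) \<le> ennreal (?m * L2_norm M (g n))" .
  qed auto
  also have "\<dots> = ennreal (\<Sum>n. ?m * L2_norm M (g n))"
    by (rule suminf_ennreal2) (use s in \<open>auto intro: summable_mult\<close>)
  also have "\<dots> < \<infinity>" by simp
  finally have "AE x in M. (\<Sum>n. ennreal \<bar>g n x\<bar>) \<noteq> \<infinity>"
    by (intro nn_integral_PInf_AE) auto
  then show ?thesis
    by eventually_elim (rule summable_suminf_not_top, auto)
qed

lemma summable_diff_imp_convergent:
  fixes a :: "nat \<Rightarrow> real"
  assumes "summable (\<lambda>n. \<bar>a (Suc n) - a n\<bar>)"
  shows "convergent a"
proof -
  have "summable (\<lambda>n. a (Suc n) - a n)" by (rule summable_rabs_cancel[OF assms])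
  then have "convergent (\<lambda>n. \<Sum>i<n. a (Suc i) - a i)" by (simp add: summable_iff_convergent)
  then have "convergent (\<lambda>n. a n - a 0)" by (simp add: sum_lessThan_telescope)
  then show ?thesis
    using convergent_diff_const_right_iff[of a "a 0"] by simp
qed

text \<open>Telescoping by the triangle inequality: \<open>D m\<close> plays the distance between
  the terms \<open>n\<close> and \<open>m\<close> of a sequence, \<open>d k\<close> that between
  consecutive terms.\<close>

lemma summable_dist_tail:
  assumes sum: "summable d" and d: "\<And>n. (0::real) \<le> d n"
    and tri: "\<And>k. k \<ge> n \<Longrightarrow> D (Suc k) \<le> D k + d k" and D0: "D n = 0" and "m \<ge> n"
  shows "D m \<le> (\<Sum>k. d (k + n))"
proof -
  have "D (n + i) \<le> (\<Sum>k<i. d (k + n))" for i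
  proof (induction i)
    case (Suc i)
    have "D (Suc (n + i)) \<le> D (n + i) + d (n + i)" by (rule tri) simp
    then show ?case using Suc by (simp add: add.commute)
  qed (simp add: D0)
  also have "(\<Sum>k<i. d (k + n)) \<le> (\<Sum>k. d (k + n))" for i
    by (rule sum_le_suminf) (use sum d in auto)
  finally show ?thesis using \<open>m \<ge> n\<close> by (metis le_add_diff_inverse)
qed

text \<open>Riesz-Fischer for summable increments, where no subsequence has to be chosen. The limit
  is the explicit function \<open>w'\<close>, so that one formula can later define \<open>u\<close>
  on all fibres.\<close>

lemma (in finite_measure) L2_complete:
  assumes w: "\<And>n. w n \<in> L2_space M"
    and s: "summable (\<lambda>n. L2_norm M (\<lambda>x. w (Suc n) x - w n x))"
  defines "w' \<equiv> (\<lambda>x. lim (\<lambda>n. w n x))"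
  shows "w' \<in> L2_space M" "(\<lambda>n. L2_norm M (\<lambda>x. w n x - w' x)) \<longlonglongrightarrow> 0"
proof -
  note [measurable] = L2_spaceD(1)[OF w]
  let ?d = "\<lambda>n. L2_norm M (\<lambda>x. w (Suc n) x - w n x)"
  have m[measurable]: "w' \<in> borel_measurable M" unfolding w'_def by measurable
  have "AE x in M. summable (\<lambda>n. \<bar>w (Suc n) x - w n x\<bar>)"
    by (rule L2_summable_AE[OF L2_space_diff[OF w w] s])
  then have lim: "AE x in M. (\<lambda>n. w n x) \<longlonglongrightarrow> w' x"
    by eventually_elim (simp add: w'_def summable_diff_imp_convergent convergent_LIMSEQ_iff[symmetric])
  \<comment> \<open>The tail of the series bounds \<open>w n x - w m x\<close> in norm for every
    \<open>m \<ge> n\<close>; Fatou carries the bound over to \<open>m\<close> tending to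
    infinity.\<close>
  have *: "(\<lambda>x. w n x - w' x) \<in> L2_space M \<and> L2_norm M (\<lambda>x. w n x - w' x) \<le> (\<Sum>k. ?d (k + n))" for n
  proof (intro conjI)
    have ae: "AE x in M. (\<lambda>m. w n x - w m x) \<longlonglongrightarrow> w n x - w' x"
      using lim by eventually_elim (intro tendsto_intros)
    have "L2_norm M (\<lambda>x. w n x - w m x) \<le> (\<Sum>k. ?d (k + n))" if "m \<ge> n" for m
    proof (rule summable_dist_tail[where D = "\<lambda>m. L2_norm M (\<lambda>x. w n x - w m x)"])
      show "L2_norm M (\<lambda>x. w n x - w (Suc k) x) \<le> L2_norm M (\<lambda>x. w n x - w k x) + ?d k" for k
        using L2_norm_triangle_diff[OF w w w, of n "Suc k" k]
        by (simp add: L2_norm_minus_commute[of M "w k" "w (Suc k)"])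
    qed (use s that in \<open>auto simp: L2_norm_def\<close>)
    then have ev: "\<forall>\<^sub>F m in sequentially. L2_norm M (\<lambda>x. w n x - w m x) \<le> (\<Sum>k. ?d (k + n))"
      by (auto simp: eventually_sequentially)
    have meas: "(\<lambda>x. w n x - w' x) \<in> borel_measurable M" by simp
    show "(\<lambda>x. w n x - w' x) \<in> L2_space M" "L2_norm M (\<lambda>x. w n x - w' x) \<le> (\<Sum>k. ?d (k + n))"
      using L2_Fatou[OF L2_space_diff[OF w w] meas ae ev] by auto
  qed
  have "(\<lambda>x. w 0 x - (w 0 x - w' x)) \<in> L2_space M" by (intro L2_space_diff w *[THEN conjunct1])
  then show "w' \<in> L2_space M" by simp
  have "(\<lambda>n. \<Sum>k. ?d (k + n)) \<longlonglongrightarrow> 0"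
    by (rule suminf_exist_split2[OF s])
  then show "(\<lambda>n. L2_norm M (\<lambda>x. w n x - w' x)) \<longlonglongrightarrow> 0"
    by (rule tendsto_sandwich[OF _ _ tendsto_const, rotated 2]) (use * in auto)
qed

section \<open>Completeness of Lebesgue measure\<close>

text \<open>By completeness, a change on a null set preserves measurability. Strong measurability
  provides limits almost everywhere only, and this is how norms and cell means of Bochner functions
  become measurable in \<open>x\<close>.\<close>

lemma measurable_lebesgue_on_AE_limit:
  fixes g :: "'a::euclidean_space \<Rightarrow> real"
  assumes S: "S \<in> sets lebesgue" and f: "\<And>n. f n \<in> borel_measurable (lebesgue_on S)"
    and lim: "AE x in lebesgue_on S. (\<lambda>n. f n x) \<longlonglongrightarrow> g x"
  shows "g \<in> borel_measurable (lebesgue_on S)"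
proof -
  interpret complete_measure "lebesgue_on S"
  proof
    fix A B assume AB: "B \<subseteq> A" "A \<in> null_sets (lebesgue_on S)"
    then have "A \<in> null_sets lebesgue" "A \<subseteq> S"
      using null_sets_restrict_space[OF S] by auto
    then have "B \<in> sets lebesgue"
      using AB(1) completion.complete by blast
    then show "B \<in> sets (lebesgue_on S)"
      using AB(1) \<open>A \<subseteq> S\<close> S by (simp add: sets_restrict_space_iff)
  qed
  note [measurable] = f
  let ?h = "\<lambda>x. lim (\<lambda>n. f n x)"
  have h: "?h \<in> borel_measurable (lebesgue_on S)" by measurable
  have eq: "AE x in lebesgue_on S. ?h x = g x"
    using lim by eventually_elim (rule limI)
  show ?thesis
  proof (rule measurableI)
    fix B :: "real set" assume B: "B \<in> sets borel"
    show "g -` B \<inter> space (lebesgue_on S) \<in> sets (lebesgue_on S)"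
    proof (rule in_sets_AE)
      show "?h -` B \<inter> space (lebesgue_on S) \<in> sets (lebesgue_on S)"
        using h B by (rule measurable_sets)
      show "AE x in lebesgue_on S. x \<in> ?h -` B \<inter> space (lebesgue_on S) \<longleftrightarrow>
          x \<in> g -` B \<inter> space (lebesgue_on S)"
        using eq by eventually_elim auto
    qed auto
  qed auto
qed

section \<open>Approximate Riesz representation\<close>

text \<open>A nearly minimising element of \<open>b v v - 2 * F v\<close> nearly represents \<open>F\<close>; a limit of such
  elements need not exist in \<open>S\<close>.\<close>

lemma approximate_Riesz:
  fixes b :: "'v \<Rightarrow> 'v \<Rightarrow> real" and F :: "'v \<Rightarrow> real" and comb :: "'v \<Rightarrow> real \<Rightarrow> 'v \<Rightarrow> 'v"
  assumes ne: "S \<noteq> {}"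
    and comb: "\<And>v t w. v \<in> S \<Longrightarrow> w \<in> S \<Longrightarrow> comb v t w \<in> S"
    and F: "\<And>v t w. v \<in> S \<Longrightarrow> w \<in> S \<Longrightarrow> F (comb v t w) = F v + t * F w"
    and b: "\<And>v t w z. v \<in> S \<Longrightarrow> w \<in> S \<Longrightarrow> z \<in> S \<Longrightarrow> b (comb v t w) z = b v z + t * b w z"
    and sym: "\<And>v w. v \<in> S \<Longrightarrow> w \<in> S \<Longrightarrow> b v w = b w v"
    and pos: "\<And>v. v \<in> S \<Longrightarrow> 0 \<le> b v v"
    and bd: "\<And>v. v \<in> S \<Longrightarrow> \<bar>F v\<bar> \<le> K * sqrt (b v v)"
    and e: "0 < e"
  obtains v where "v \<in> S" "\<And>w. w \<in> S \<Longrightarrow> \<bar>b v w - F w\<bar> \<le> e * sqrt (b w w)"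
proof -
  define J where "J v = b v v - 2 * F v" for v
  have "- K\<^sup>2 \<le> J v" if "v \<in> S" for v
  proof -
    \<comment> \<open>Completing the square: the bound on \<open>F\<close> keeps \<open>J\<close>
      above \<open>- K\<^sup>2\<close>.\<close>
    have "0 \<le> (sqrt (b v v) - K)\<^sup>2" by simp
    also have "\<dots> = b v v - 2 * (K * sqrt (b v v)) + K\<^sup>2"
      using pos[OF that] by (simp add: power2_diff)
    finally show ?thesis using bd[OF that] unfolding J_def by linarith
  qed
  then have bb: "bdd_below (J ` S)" by (auto intro!: bdd_belowI)
  have "\<exists>x\<in>J ` S. x < Inf (J ` S) + e\<^sup>2"
    by (rule cInf_lessD) (use ne e in auto)
  then obtain v where v: "v \<in> S" "J v < Inf (J ` S) + e\<^sup>2" by auto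
  show thesis
  proof (rule that[OF v(1)])
    fix w assume w: "w \<in> S"
    \<comment> \<open>As \<open>J v\<close> is within \<open>e\<^sup>2\<close> of the infimum,
      passing to \<open>comb v t w\<close>, which stands for \<open>v + t * w\<close>, cannot lower
      \<open>J\<close> by more than that. This holds for all \<open>t\<close>, so the discriminant
      applies.\<close>
    have "(b v w - F w)\<^sup>2 \<le> e\<^sup>2 * b w w"
    proof (rule quadratic_nonneg_imp_discriminant_le)
      fix t
      have c: "comb v t w \<in> S" using comb v w by blast
      have "Inf (J ` S) \<le> J (comb v t w)" using c by (intro cInf_lower bb) auto
      also have "J (comb v t w) = b v (comb v t w) + t * b w (comb v t w) - 2 * (F v + t * F w)"
        unfolding J_def using b[OF v(1) w c] F[OF v(1) w] by simp
      also have "b v (comb v t w) = b v v + t * b v w"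
        using sym[OF v(1) c] b[OF v(1) w v(1)] sym[OF v(1) w] by simp
      also have "b w (comb v t w) = b v w + t * b w w"
        using sym[OF w c] b[OF v(1) w w] by simp
      finally have "Inf (J ` S) \<le> J v + 2 * t * (b v w - F w) + t\<^sup>2 * b w w"
        unfolding J_def by (simp add: algebra_simps power2_eq_square)
      then show "0 \<le> e\<^sup>2 + 2 * t * (b v w - F w) + t\<^sup>2 * b w w" using v(2) by linarith
    qed
    then have "sqrt ((b v w - F w)\<^sup>2) \<le> sqrt (e\<^sup>2 * b w w)" by (rule real_sqrt_le_mono)
    then show "\<bar>b v w - F w\<bar> \<le> e * sqrt (b w w)" using e by (simp add: real_sqrt_mult)
  qed
qed

section \<open>Periodic continuous functions\<close>

lemma C_perD:
  assumes "f \<in> C_per"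
  shows "continuous_on UNIV f" "f (y + axis i 1) = f y"
  using assms by (auto simp: C_per_def)

text \<open>Periodicity is given for unit steps along the axes; an integer vector is reached one
  coordinate at a time, and a negative number of steps is undone by the opposite positive
  number.\<close>

lemma C_per_add_int:
  fixes f :: "real ^ 'd \<Rightarrow> real"
  assumes f: "f \<in> C_per" and k: "\<And>i. k $ i \<in> \<int>"
  shows "f (y + k) = f y"
proof -
  have nat: "f (y + axis i (real n)) = f y" for i n y
  proof (induction n)
    case 0
    then show ?case by (simp add: axis_eq_0_iff[THEN iffD2])
  next
    case (Suc n)
    have "axis i (real (Suc n)) = axis i (real n) + axis i 1"
      by (simp add: vec_eq_iff axis_def)
    then show ?case using C_perD(2)[OF f, of "y + axis i (real n)" i] Suc by (simp add: add.assoc)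
  qed
  have int: "f (y + axis i (of_int z)) = f y" for i z y
  proof (cases z)
    case (nonneg n)
    then show ?thesis using nat[of y i n] by simp
  next
    case (neg n)
    have "y + axis i (of_int z) + axis i (real (Suc n)) = y"
      by (simp add: neg vec_eq_iff axis_def)
    then show ?thesis using nat[of "y + axis i (of_int z)" i "Suc n"] by (simp only:)
  qed
  have "f (y + (\<Sum>i\<in>I. axis i (k $ i))) = f y" if "finite I" for I
    using that
  proof (induction I)
    case (insert i I)
    obtain z where "k $ i = of_int z" using k[of i] Ints_cases by blast
    then have "f (y + (\<Sum>i\<in>I. axis i (k $ i)) + axis i (k $ i)) = f (y + (\<Sum>i\<in>I. axis i (k $ i)))"
      using int by simp
    moreover have "y + (\<Sum>i\<in>insert i I. axis i (k $ i)) = y + (\<Sum>i\<in>I. axis i (k $ i)) + axis i (k $ i)"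
      using insert.hyps by (simp add: algebra_simps)
    ultimately show ?case using insert.IH by (simp only:)
  qed simp
  moreover have "(\<Sum>i\<in>UNIV. axis i (k $ i)) = k"
    by (simp add: vec_eq_iff axis_def if_distrib cong: if_cong)
  ultimately show ?thesis by (metis finite)
qed

definition frac_vec :: "real ^ 'd \<Rightarrow> real ^ 'd" where
  "frac_vec y = (\<chi> i. frac (y $ i))"

definition floor_vec :: "real ^ 'd \<Rightarrow> real ^ 'd" where
  "floor_vec y = (\<chi> i. of_int \<lfloor>y $ i\<rfloor>)"

lemma frac_plus_floor_vec: "frac_vec y + floor_vec y = y"
  by (simp add: vec_eq_iff frac_vec_def floor_vec_def frac_def)

lemma floor_vec_Ints: "floor_vec y $ i \<in> \<int>"
  by (simp add: floor_vec_def)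

lemma C_per_frac_vec: "f \<in> C_per \<Longrightarrow> f (frac_vec y) = f y"
  using C_per_add_int[of f "floor_vec y" "frac_vec y"] floor_vec_Ints frac_plus_floor_vec by metis

lemma mem_unit_cell: "y \<in> unit_cell \<longleftrightarrow> (\<forall>i. 0 \<le> y $ i \<and> y $ i \<le> 1)"
  by (simp add: unit_cell_def mem_box_cart)

lemma frac_vec_in_unit_cell: "frac_vec y \<in> unit_cell"
  by (simp add: mem_unit_cell frac_vec_def frac_ge_0 frac_lt_1 less_imp_le)

lemma unit_cell_nonempty: "unit_cell \<noteq> {}"
  using frac_vec_in_unit_cell by blast

lemma C_per_bdd_above: "f \<in> C_per \<Longrightarrow> bdd_above ((\<lambda>y. \<bar>f y\<bar>) ` unit_cell)"
  by (intro bounded_imp_bdd_above compact_imp_bounded compact_continuous_image)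
    (auto simp: unit_cell_def intro!: continuous_intros continuous_on_subset[OF C_perD(1)])

text \<open>\<open>frac_vec\<close> moves any point into the cell without changing the value, so the
  supremum over one cell bounds the function everywhere.\<close>

lemma C_per_abs_le_sup_norm: "f \<in> C_per \<Longrightarrow> \<bar>f y\<bar> \<le> sup_norm f"
  using cSUP_upper[OF frac_vec_in_unit_cell C_per_bdd_above, of f y]
  by (simp add: sup_norm_def C_per_frac_vec)

lemma sup_norm_le: "(\<And>y. \<bar>f y\<bar> \<le> B) \<Longrightarrow> sup_norm f \<le> B"
  unfolding sup_norm_def by (rule cSUP_least[OF unit_cell_nonempty])

lemma sup_norm_nonneg: "f \<in> C_per \<Longrightarrow> 0 \<le> sup_norm f"
  using C_per_abs_le_sup_norm[of f 0] by linarith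

lemma sup_norm_zero [simp]: "sup_norm (\<lambda>y. 0) = 0"
  by (simp add: sup_norm_def unit_cell_nonempty)

lemma sup_norm_uminus_commute: "sup_norm (\<lambda>y. f y - g y) = sup_norm (\<lambda>y. g y - f y)"
  by (simp add: sup_norm_def abs_minus_commute)

lemma C_per_const [simp]: "(\<lambda>y. c) \<in> C_per"
  by (simp add: C_per_def)

lemma C_per_add: "f \<in> C_per \<Longrightarrow> g \<in> C_per \<Longrightarrow> (\<lambda>y. f y + g y) \<in> C_per"
  by (auto simp: C_per_def intro!: continuous_intros)

lemma C_per_mult: "f \<in> C_per \<Longrightarrow> g \<in> C_per \<Longrightarrow> (\<lambda>y. f y * g y) \<in> C_per"
  by (auto simp: C_per_def intro!: continuous_intros)

lemma C_per_diff: "f \<in> C_per \<Longrightarrow> g \<in> C_per \<Longrightarrow> (\<lambda>y. f y - g y) \<in> C_per"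
  by (auto simp: C_per_def intro!: continuous_intros)

lemma sup_norm_triangle:
  assumes "f \<in> C_per" "g \<in> C_per"
  shows "sup_norm (\<lambda>y. f y + g y) \<le> sup_norm f + sup_norm g"
proof (rule sup_norm_le)
  fix y
  show "\<bar>f y + g y\<bar> \<le> sup_norm f + sup_norm g"
    using C_per_abs_le_sup_norm[OF assms(1), of y] C_per_abs_le_sup_norm[OF assms(2), of y] by linarith
qed

lemma sup_norm_triangle_diff:
  assumes "f \<in> C_per" "g \<in> C_per"
  shows "sup_norm (\<lambda>y. f y - g y) \<le> sup_norm f + sup_norm g"
proof (rule sup_norm_le)
  fix y
  show "\<bar>f y - g y\<bar> \<le> sup_norm f + sup_norm g"
    using C_per_abs_le_sup_norm[OF assms(1), of y] C_per_abs_le_sup_norm[OF assms(2), of y] by linarith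
qed

lemma sup_norm_diff_abs:
  assumes "f \<in> C_per" "g \<in> C_per"
  shows "\<bar>sup_norm f - sup_norm g\<bar> \<le> sup_norm (\<lambda>y. f y - g y)"
  using sup_norm_triangle[OF C_per_diff[OF assms] assms(2)]
    sup_norm_triangle[OF C_per_diff[OF assms(2,1)] assms(1)]
  by (simp add: sup_norm_uminus_commute[of g f])

lemma C_per_borel_measurable: "f \<in> C_per \<Longrightarrow> f \<in> borel_measurable borel"
  by (rule borel_measurable_continuous_onI[OF C_perD(1)])

lemma unit_cell_lmeasurable [simp]: "unit_cell \<in> lmeasurable"
  by (simp add: unit_cell_def)

lemma finite_measure_unit_cell: "finite_measure (lebesgue_on unit_cell)"
  by (rule finite_measure_lebesgue_on) simp

lemma measure_unit_cell: "measure lebesgue (unit_cell :: (real ^ 'd) set) = 1"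
proof -
  have "cbox 0 1 \<noteq> ({} :: (real ^ 'd) set)"
    using unit_cell_nonempty by (simp add: unit_cell_def)
  then show ?thesis by (simp add: unit_cell_def content_cbox_cart)
qed

lemma measure_space_unit_cell:
  "measure (lebesgue_on unit_cell) (space (lebesgue_on (unit_cell :: (real ^ 'd) set))) = 1"
  using measure_unit_cell by (simp add: measure_restrict_space fmeasurableD)

lemma borel_measurable_lebesgue_on_borel:
  "f \<in> borel_measurable borel \<Longrightarrow> f \<in> borel_measurable (lebesgue_on S)"
  by (intro measurable_restrict_space1 measurable_completion) simp

lemma C_per_L2_space: "f \<in> C_per \<Longrightarrow> f \<in> L2_space (lebesgue_on unit_cell)"
  by (rule finite_measure.L2_space_bounded[OF finite_measure_unit_cell])
    (auto intro: borel_measurable_lebesgue_on_borel C_per_borel_measurable C_per_abs_le_sup_norm)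

lemma L2_norm_le_sup_norm:
  assumes "f \<in> C_per"
  shows "L2_norm (lebesgue_on unit_cell) f \<le> sup_norm f"
proof -
  interpret finite_measure "lebesgue_on unit_cell :: (real ^ 'a) measure" by (rule finite_measure_unit_cell)
  have "L2_norm (lebesgue_on unit_cell) f \<le> L2_norm (lebesgue_on (unit_cell :: (real ^ 'a) set)) (\<lambda>_. sup_norm f)"
    by (rule L2_space_bound(2))
      (use C_per_abs_le_sup_norm[OF assms] L2_spaceD(1)[OF C_per_L2_space[OF assms]]
        in \<open>auto intro: C_per_L2_space\<close>)
  also have "\<dots> = sup_norm f"
    using measure_space_unit_cell[where 'd = 'a] sup_norm_nonneg[OF assms] by (simp add: L2_norm_def)
  finally show ?thesis .
qed

section \<open>Periodic step functions on a grid\<close>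

text \<open>For \<open>m > 0\<close>, the lower corner of the subcell of side \<open>1 / m\<close>
  that contains the fractional part of \<open>y\<close>. With finitely many values for each
  \<open>m\<close>, it supplies a countable periodic family in place of a countable dense set of
  continuous functions.\<close>

definition quantize :: "nat \<Rightarrow> real ^ 'd \<Rightarrow> real ^ 'd" where
  "quantize m y = (\<chi> i. of_int \<lfloor>real m * frac (y $ i)\<rfloor> / real m)"

lemma quantize_in_unit_cell: "m > 0 \<Longrightarrow> quantize m y \<in> unit_cell"
proof -
  assume m: "m > 0"
  have "of_int \<lfloor>real m * frac (y $ i)\<rfloor> \<le> real m" for i
  proof -
    have "real m * frac (y $ i) \<le> real m * 1"
      by (intro mult_left_mono) (auto simp: frac_lt_1 less_imp_le)
    then show ?thesis using of_int_floor_le[of "real m * frac (y $ i)"] by linarith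
  qed
  then show ?thesis using m by (auto simp: mem_unit_cell quantize_def divide_le_eq)
qed

text \<open>The rounding error in a coordinate is again a fractional part, divided by
  \<open>real m\<close>; the factor \<open>CARD('d)\<close> comes from passing through the l1
  norm.\<close>

lemma norm_frac_vec_quantize:
  fixes y :: "real ^ 'd"
  assumes "m > 0"
  shows "norm (frac_vec y - quantize m y) \<le> real CARD('d) / real m"
proof -
  have "\<bar>frac (y $ i) - of_int \<lfloor>real m * frac (y $ i)\<rfloor> / real m\<bar> \<le> 1 / real m" for i
  proof -
    have "frac (y $ i) - of_int \<lfloor>real m * frac (y $ i)\<rfloor> / real m = frac (real m * frac (y $ i)) / real m"
      using assms by (simp add: frac_def[of "real m * _"] diff_divide_distrib)
    then show ?thesis using assms by (simp add: divide_right_mono frac_lt_1 less_imp_le)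
  qed
  then have "(\<Sum>i\<in>UNIV. \<bar>(frac_vec y - quantize m y) $ i\<bar>) \<le> (\<Sum>i\<in>(UNIV :: 'd set). 1 / real m)"
    by (intro sum_mono) (simp add: frac_vec_def quantize_def)
  then show ?thesis using norm_le_l1_cart[of "frac_vec y - quantize m y"] by simp
qed

lemma finite_range_quantize: "finite (range (quantize m :: real ^ 'd \<Rightarrow> real ^ 'd))"
proof (rule finite_subset)
  let ?H = "Pi\<^sub>E (UNIV :: 'd set) (\<lambda>_. {0..int m})"
  show "range (quantize m) \<subseteq> (\<lambda>h. \<chi> i. of_int (h i) / real m) ` ?H"
  proof clarify
    fix y :: "real ^ 'd"
    have "\<lfloor>real m * frac (y $ i)\<rfloor> \<in> {0..int m}" for i
    proof -
      have "real m * frac (y $ i) \<le> real m * 1"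
        by (intro mult_left_mono) (auto simp: frac_lt_1 less_imp_le)
      then show ?thesis by (auto simp: floor_le_iff)
    qed
    then show "quantize m y \<in> (\<lambda>h. \<chi> i. of_int (h i) / real m) ` ?H"
      unfolding quantize_def by (intro image_eqI[where x = "\<lambda>i. \<lfloor>real m * frac (y $ i)\<rfloor>"]) auto
  qed
  show "finite ((\<lambda>h. (\<chi> i. of_int (h i) / real m) :: real ^ 'd) ` ?H)"
    by (intro finite_imageI finite_PiE) auto
qed

lemma measurable_quantize_eq:
  fixes v :: "real ^ 'd"
  assumes "\<tau> \<in> borel_measurable M"
  shows "{x \<in> space M. quantize m (\<tau> x) = v} \<in> sets M"
proof -
  have [measurable]: "(\<lambda>x. \<tau> x $ i) \<in> borel_measurable M" for i
    using assms by (rule measurable_compose)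
      (intro borel_measurable_continuous_onI continuous_intros)
  have "{x \<in> space M. quantize m (\<tau> x) = v} =
      {x \<in> space M. \<forall>i\<in>(UNIV :: 'd set). of_int \<lfloor>real m * (\<tau> x $ i - of_int \<lfloor>\<tau> x $ i\<rfloor>)\<rfloor> / real m = v $ i}"
    by (auto simp: quantize_def vec_eq_iff frac_def)
  also have "\<dots> \<in> sets M" by measurable
  finally show ?thesis .
qed

lemma C_per_step_approx:
  fixes f :: "real ^ 'd \<Rightarrow> real"
  assumes f: "f \<in> C_per" and e: "e > 0"
  obtains m where "\<And>y. \<bar>f y - f (quantize m y)\<bar> \<le> e"
proof -
  have "uniformly_continuous_on unit_cell f"
    by (rule compact_uniformly_continuous[OF continuous_on_subset[OF C_perD(1)[OF f]]])
      (auto simp: unit_cell_def)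
  then obtain d where d: "d > 0"
    "\<And>x y. x \<in> unit_cell \<Longrightarrow> y \<in> unit_cell \<Longrightarrow> dist x y < d \<Longrightarrow> dist (f x) (f y) < e"
    using e unfolding uniformly_continuous_on_def by metis
  \<comment> \<open>The mesh is so fine that the rounding error, at most
    \<open>CARD('d) / m\<close>, is below the modulus of continuity \<open>d\<close>.\<close>
  obtain m :: nat where m: "real CARD('d) / d < real m" using reals_Archimedean2 by blast
  have "0 < real CARD('d) / d" using d by simp
  then have m0: "m > 0" using m by linarith
  have md: "real CARD('d) / real m < d" using m m0 d(1) by (simp add: field_simps)
  show thesis
  proof (rule that)
    fix y
    have "dist (f (frac_vec y)) (f (quantize m y)) < e"
      by (rule d(2)[OF frac_vec_in_unit_cell quantize_in_unit_cell[OF m0]])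
        (use norm_frac_vec_quantize[OF m0, of y] md in \<open>simp add: dist_norm\<close>)
    then show "\<bar>f y - f (quantize m y)\<bar> \<le> e"
      using C_per_frac_vec[OF f] by (simp add: dist_real_def)
  qed
qed

section \<open>Lebesgue measure under invertible affine maps\<close>

text \<open>The library's change of variables formula is restricted to coordinate types with a
  wellorder, so scaling by some constant (not identified as \<open>\<bar>det A\<bar>\<close>, which is not needed) is
  derived here for an arbitrary finite coordinate type.\<close>

lemma linear_image_measure_scaling:
  fixes f :: "real ^ 'd \<Rightarrow> real ^ 'd"
  assumes "linear f"
  obtains c where "\<And>S. S \<in> lmeasurable \<Longrightarrow> f ` S \<in> lmeasurable"
    "\<And>S. S \<in> lmeasurable \<Longrightarrow> measure lebesgue (f ` S) = c * measure lebesgue S"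
proof -
  let ?P = "\<lambda>f :: real ^ 'd \<Rightarrow> real ^ 'd. \<exists>c. \<forall>S\<in>lmeasurable. f ` S \<in> lmeasurable \<and>
      measure lebesgue (f ` S) = c * measure lebesgue S"
  \<comment> \<open>Preserving the volume of boxes implies preserving that of all measurable sets,
    so swaps and shears only have to be checked on boxes.\<close>
  have suff: "?P f" if "linear f" "\<And>a b. measure lebesgue (f ` cbox a b) = measure lebesgue (cbox a b)"
    for f :: "real ^ 'd \<Rightarrow> real ^ 'd"
  proof (intro exI[of _ 1] ballI)
    fix S :: "(real ^ 'd) set" assume "S \<in> lmeasurable"
    then have "f ` S \<in> lmeasurable \<and> 1 * measure lebesgue S = measure lebesgue (f ` S)"
      by (rule measure_linear_sufficient[OF that(1)]) (simp add: that(2))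
    then show "f ` S \<in> lmeasurable \<and> measure lebesgue (f ` S) = 1 * measure lebesgue S" by simp
  qed
  have "?P f"
  proof (rule induct_linear_elementary[OF assms])
    fix f g :: "real ^ 'd \<Rightarrow> real ^ 'd"
    assume "?P f" "?P g"
    then obtain c c' where
      "\<forall>S\<in>lmeasurable. f ` S \<in> lmeasurable \<and> measure lebesgue (f ` S) = c * measure lebesgue S"
      "\<forall>S\<in>lmeasurable. g ` S \<in> lmeasurable \<and> measure lebesgue (g ` S) = c' * measure lebesgue S"
      by blast
    then have "\<forall>S\<in>lmeasurable. f ` g ` S \<in> lmeasurable \<and>
        measure lebesgue (f ` g ` S) = c * c' * measure lebesgue S"
      by (simp only: mult.assoc) auto
    then show "?P (f \<circ> g)" unfolding image_comp by blast
  next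
    fix f :: "real ^ 'd \<Rightarrow> real ^ 'd" and i
    assume "linear f" and 0: "\<And>x. f x $ i = 0"
    have "negligible (f ` S)" for S
      by (rule negligible_subset[OF negligible_standard_hyperplane_cart[of i]]) (use 0 in auto)
    then show "?P f"
      by (intro exI[of _ 0]) (auto simp: negligible_iff_measure)
  next
    fix c :: "'d \<Rightarrow> real"
    show "?P (\<lambda>x. \<chi> i. c i * x $ i)"
      using measurable_stretch measure_stretch by (intro exI[of _ "\<bar>prod c UNIV\<bar>"]) blast
  next
    fix m n :: 'd
    let ?h = "\<lambda>x :: real ^ 'd. \<chi> i. x $ Transposition.transpose m n i"
    show "?P ?h"
    proof (rule suff)
      show "linear ?h" by (rule linearI) (simp_all add: vec_eq_iff)
      fix a b
      have hh: "?h (?h x) = x" for x by (simp add: vec_eq_iff)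
      have mem: "x \<in> cbox a b \<Longrightarrow> ?h x \<in> cbox (?h a) (?h b)" for x a b
        by (simp add: mem_box_cart)
      have "?h ` cbox a b = cbox (?h a) (?h b)"
      proof (intro equalityI subsetI)
        fix y assume "y \<in> cbox (?h a) (?h b)"
        from mem[OF this] have "?h y \<in> cbox a b" unfolding hh .
        then show "y \<in> ?h ` cbox a b" using hh[of y] by (metis image_eqI)
      qed (use mem in blast)
      moreover have "measure lebesgue (cbox (?h a) (?h b)) = measure lebesgue (cbox a b)"
      proof (cases "cbox a b = {}")
        case True
        then show ?thesis using \<open>?h ` cbox a b = _\<close> by (metis image_is_empty)
      next
        case False
        then have "cbox (?h a) (?h b) \<noteq> {}" using \<open>?h ` cbox a b = _\<close> by (metis image_is_empty)
        then show ?thesis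
          using False prod.permute[OF permutes_swap_id, of m UNIV n "\<lambda>i. b $ i - a $ i"]
          by (simp add: content_cbox_cart o_def)
      qed
      ultimately show "measure lebesgue (?h ` cbox a b) = measure lebesgue (cbox a b)" by simp
    qed
  next
    fix m n :: 'd
    assume mn: "m \<noteq> n"
    let ?h = "\<lambda>x :: real ^ 'd. \<chi> i. if i = m then x $ m + x $ n else x $ i"
    have lin: "linear ?h" by (rule linearI) (auto simp: vec_eq_iff algebra_simps)
    show "?P ?h"
    proof (rule suff[OF lin])
      fix a b :: "real ^ 'd"
      show "measure lebesgue (?h ` cbox a b) = measure lebesgue (cbox a b)"
      proof (cases "cbox a b = {}")
        case False
        \<comment> \<open>The volume formula for sheared boxes wants a lower corner with nonnegative
          \<open>n\<close>-th coordinate; this translation makes the coordinate 0.\<close>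
        define t where "t = axis n (a $ n)"
        have eq: "cbox a b = (+) t ` cbox (a - t) (b - t)"
          by (simp add: cbox_translation[symmetric])
        then have ne: "cbox (a - t) (b - t) \<noteq> {}" using False by auto
        have "?h ` cbox a b = (+) (?h t) ` ?h ` cbox (a - t) (b - t)"
          unfolding eq image_image using linear_add[OF lin, of t] by simp
        then have "measure lebesgue (?h ` cbox a b) = measure lebesgue (?h ` cbox (a - t) (b - t))"
          by (simp add: measure_translation)
        also have "\<dots> = measure lebesgue (cbox (a - t) (b - t))"
          by (rule measure_shear_interval[OF mn ne]) (simp add: t_def axis_def)
        also have "\<dots> = measure lebesgue (cbox a b)"
          unfolding eq by (rule measure_translation[symmetric])
        finally show ?thesis .
      qed simp
    qed
  qed
  then show thesis using that by blast
qed

text \<open>The unit ball has positive volume and is mapped onto itself, which forces the scaling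
  constant to be 1.\<close>

lemma orthogonal_image_measure:
  fixes f :: "real ^ 'd \<Rightarrow> real ^ 'd"
  assumes f: "orthogonal_transformation f" and S: "S \<in> lmeasurable"
  shows "f ` S \<in> lmeasurable" "measure lebesgue (f ` S) = measure lebesgue S"
proof -
  obtain c where c: "\<And>S. S \<in> lmeasurable \<Longrightarrow> f ` S \<in> lmeasurable"
    "\<And>S. S \<in> lmeasurable \<Longrightarrow> measure lebesgue (f ` S) = c * measure lebesgue S"
    using linear_image_measure_scaling[OF orthogonal_transformation_linear[OF f]] by blast
  show "f ` S \<in> lmeasurable" using c(1)[OF S] .
  have "f ` ball 0 1 = ball 0 1"
    using image_orthogonal_transformation_ball[OF f, of 0 1] linear_0[OF orthogonal_transformation_linear[OF f]]
    by simp
  then have "c * measure lebesgue (ball (0 :: real ^ 'd) 1) = measure lebesgue (ball (0 :: real ^ 'd) 1)"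
    using c(2)[of "ball 0 1"] by simp
  moreover have "measure lebesgue (ball (0 :: real ^ 'd) 1) > 0"
    using content_ball_pos[of 1 "0 :: real ^ 'd"] by simp
  ultimately have "c = 1" by simp
  then show "measure lebesgue (f ` S) = measure lebesgue S" using c(2)[OF S] by simp
qed

section \<open>Affine maps and change of variables\<close>

definition affine_map :: "real ^ 'd ^ 'd \<Rightarrow> real ^ 'd \<Rightarrow> real ^ 'd \<Rightarrow> real ^ 'd" where
  "affine_map A q y = q + A *v y"

definition affine_inv :: "real ^ 'd ^ 'd \<Rightarrow> real ^ 'd \<Rightarrow> real ^ 'd \<Rightarrow> real ^ 'd" where
  "affine_inv A q x = matrix_inv A *v (x - q)"

lemma matrix_inv_invertible:
  assumes "invertible A"
  shows "A ** matrix_inv A = mat 1" "matrix_inv A ** A = mat 1"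
proof -
  have "\<exists>A'. A ** A' = mat 1 \<and> A' ** A = mat 1"
    using assms by (simp add: invertible_def)
  from someI_ex[OF this] show "A ** matrix_inv A = mat 1" "matrix_inv A ** A = mat 1"
    by (simp_all add: matrix_inv_def)
qed

lemma affine_inv_affine_map:
  assumes "invertible A"
  shows "affine_inv A q (affine_map A q y) = y" "affine_map A q (affine_inv A q x) = x"
  by (simp_all add: affine_inv_def affine_map_def matrix_vector_mul_assoc
      matrix_inv_invertible[OF assms])

lemma affine_inv_eq: "affine_inv A q = affine_map (matrix_inv A) (- (matrix_inv A *v q))"
  by (simp add: fun_eq_iff affine_inv_def affine_map_def matrix_vector_mult_diff_distrib)

lemma affine_map_measure_scaling:
  fixes A :: "real ^ 'd ^ 'd"
  obtains c where "\<And>S. S \<in> lmeasurable \<Longrightarrow> affine_map A q ` S \<in> lmeasurable"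
    "\<And>S. S \<in> lmeasurable \<Longrightarrow> measure lebesgue (affine_map A q ` S) = c * measure lebesgue S"
proof -
  have im: "affine_map A q ` S = (+) q ` (*v) A ` S" for S
    by (auto simp: affine_map_def image_image)
  show thesis
    using linear_image_measure_scaling[OF matrix_vector_mul_linear[of A]] that
    unfolding im by (metis measurable_translation measure_translation)
qed

text \<open>Sets of infinite measure are included so that a push-forward can be compared with a
  density. The constant cannot vanish because mapping a ball forth and back multiplies its volume by
  \<open>c' * c\<close>.\<close>

lemma affine_map_emeasure_scaling:
  fixes A :: "real ^ 'd ^ 'd"
  assumes A: "invertible A"
  obtains c where "c > 0" "\<And>S. S \<in> sets lebesgue \<Longrightarrow> affine_map A q ` S \<in> sets lebesgue"
    "\<And>S. S \<in> sets lebesgue \<Longrightarrow> emeasure lebesgue (affine_map A q ` S) = ennreal c * emeasure lebesgue S"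
proof -
  let ?T = "affine_map A q" and ?I = "affine_inv A q"
  obtain c where c: "\<And>S. S \<in> lmeasurable \<Longrightarrow> ?T ` S \<in> lmeasurable"
    "\<And>S. S \<in> lmeasurable \<Longrightarrow> measure lebesgue (?T ` S) = c * measure lebesgue S"
    using affine_map_measure_scaling by blast
  obtain c' where c': "\<And>S. S \<in> lmeasurable \<Longrightarrow> ?I ` S \<in> lmeasurable"
    "\<And>S. S \<in> lmeasurable \<Longrightarrow> measure lebesgue (?I ` S) = c' * measure lebesgue S"
    unfolding affine_inv_eq using affine_map_measure_scaling by blast
  have IT: "?I ` ?T ` S = S" for S
    by (simp add: image_image affine_inv_affine_map[OF A])
  let ?B = "ball (0 :: real ^ 'd) 1"
  have B: "measure lebesgue ?B > 0" using content_ball_pos[of 1 "0 :: real ^ 'd"] by simp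
  have "measure lebesgue (?I ` ?T ` ?B) = c' * (c * measure lebesgue ?B)"
    using c c' by simp
  then have "c \<noteq> 0" using B unfolding IT by auto
  moreover have "0 \<le> c * measure lebesgue ?B"
    using c(2)[of ?B] by (metis lmeasurable_ball measure_nonneg)
  ultimately have cpos: "c > 0" using mult_neg_pos[of c, OF _ B] by linarith
  show thesis
  proof (rule that[OF cpos])
    fix S :: "(real ^ 'd) set" assume S: "S \<in> sets lebesgue"
    have "?T ` S = (\<Union>n. ?T ` (S \<inter> cball 0 (real n)))"
    proof -
      have "S = (\<Union>n. S \<inter> cball 0 (real n))"
        by (auto simp: real_arch_simple)
      then show ?thesis by (metis image_UN)
    qed
    moreover have "?T ` (S \<inter> cball 0 (real n)) \<in> sets lebesgue" for n
      by (intro fmeasurableD c(1)) (auto intro!: bounded_set_imp_lmeasurable S)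
    ultimately show TS: "?T ` S \<in> sets lebesgue" by auto
    show "emeasure lebesgue (?T ` S) = ennreal c * emeasure lebesgue S"
    proof (cases "S \<in> lmeasurable")
      case True
      then show ?thesis
        using c cpos by (simp add: emeasure_eq_measure2 ennreal_mult)
    next
      case False
      \<comment> \<open>An image of finite measure would be carried back by the inverse to a set of
        finite measure.\<close>
      then have "?T ` S \<notin> lmeasurable" using c'(1)[of "?T ` S"] unfolding IT by blast
      then have "emeasure lebesgue (?T ` S) = \<infinity>" "emeasure lebesgue S = \<infinity>"
        using S TS False by (auto simp: fmeasurable_def less_top[symmetric])
      then show ?thesis using cpos by (simp add: ennreal_mult_top)
    qed
  qed
qed

text \<open>The push-forward of Lebesgue measure under \<open>affine_inv A q\<close> is
  \<open>c\<close> times Lebesgue measure. Being an identity of measures, this gives the integral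
  formula for every measurable \<open>g\<close>, integrable or not.\<close>

lemma affine_inv_integral:
  fixes A :: "real ^ 'd ^ 'd"
  assumes A: "invertible A"
  obtains c where "c > 0" "\<And>S. S \<in> lmeasurable \<Longrightarrow> affine_map A q ` S \<in> lmeasurable"
    "\<And>S. S \<in> lmeasurable \<Longrightarrow> measure lebesgue (affine_map A q ` S) = c * measure lebesgue S"
    "affine_inv A q \<in> measurable lebesgue lebesgue"
    "\<And>g :: real ^ 'd \<Rightarrow> real. g \<in> borel_measurable lebesgue \<Longrightarrow>
       (LINT x|lebesgue. g (affine_inv A q x)) = c * (LINT y|lebesgue. g y)"
proof -
  let ?T = "affine_map A q" and ?I = "affine_inv A q"
  obtain c where c: "c > 0" "\<And>S. S \<in> sets lebesgue \<Longrightarrow> ?T ` S \<in> sets lebesgue"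
    "\<And>S. S \<in> sets lebesgue \<Longrightarrow> emeasure lebesgue (?T ` S) = ennreal c * emeasure lebesgue S"
    using affine_map_emeasure_scaling[OF A] by blast
  have pre: "?I -` S = ?T ` S" for S
  proof (intro equalityI subsetI)
    fix x assume "x \<in> ?I -` S"
    then have "?T (?I x) \<in> ?T ` S" by blast
    then show "x \<in> ?T ` S" by (simp only: affine_inv_affine_map(2)[OF A])
  next
    fix x assume "x \<in> ?T ` S"
    then show "x \<in> ?I -` S" using affine_inv_affine_map(1)[OF A] by auto
  qed
  have I: "?I \<in> measurable lebesgue lebesgue"
    by (rule measurableI) (use c(2) pre in auto)
  have eq: "distr lebesgue lebesgue ?I = density lebesgue (\<lambda>_. ennreal c)"
  proof (rule measure_eqI)
    fix S assume "S \<in> sets (distr lebesgue lebesgue ?I)"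
    then have S: "S \<in> sets lebesgue" by simp
    then show "emeasure (distr lebesgue lebesgue ?I) S = emeasure (density lebesgue (\<lambda>_. ennreal c)) S"
      using emeasure_distr[OF I S] c(3)[OF S] by (simp add: pre emeasure_density nn_integral_cmult)
  qed simp
  show thesis
  proof (rule that[OF c(1) _ _ I])
    fix S :: "(real ^ 'd) set" assume S: "S \<in> lmeasurable"
    have S': "S \<in> sets lebesgue" using S by (rule fmeasurableD)
    have "emeasure lebesgue (?T ` S) = ennreal (c * measure lebesgue S)"
      using c(1) c(3)[OF S'] emeasure_eq_measure2[OF S] by (simp add: ennreal_mult)
    then show "?T ` S \<in> lmeasurable" "measure lebesgue (?T ` S) = c * measure lebesgue S"
      using c(1) c(2)[OF S'] by (auto intro: fmeasurableI simp: measure_def)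
  next
    fix g :: "real ^ 'd \<Rightarrow> real" assume g: "g \<in> borel_measurable lebesgue"
    have "(LINT x|lebesgue. g (?I x)) = (LINT y|distr lebesgue lebesgue ?I. g y)"
      by (rule integral_distr[symmetric, OF I g])
    also have "\<dots> = c * (LINT y|lebesgue. g y)"
      unfolding eq using integral_density[OF g, of "\<lambda>_. c"] c(1) by simp
    finally show "(LINT x|lebesgue. g (?I x)) = c * (LINT y|lebesgue. g y)" .
  qed
qed

section \<open>Averages of rapidly oscillating periodic functions\<close>

abbreviation cell_mean :: "(real ^ 'd \<Rightarrow> real) \<Rightarrow> real" where
  "cell_mean g \<equiv> LINT y|lebesgue_on unit_cell. g y"

lemma cell_mean_nonneg: "(\<And>y. 0 \<le> g y) \<Longrightarrow> 0 \<le> cell_mean g"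
  by simp

text \<open>Its integer translates tile the space without overlap, while those of
  \<open>unit_cell\<close> share faces.\<close>

definition half_open_cell :: "(real ^ 'd) set" where
  "half_open_cell = {y. floor_vec y = 0}"

lemma mem_half_open_cell: "y \<in> half_open_cell \<longleftrightarrow> (\<forall>i. 0 \<le> y $ i \<and> y $ i < 1)"
  by (simp add: half_open_cell_def floor_vec_def vec_eq_iff floor_eq_iff)

lemma negligible_unit_cell_diff:
  "negligible ((unit_cell - half_open_cell) \<union> (half_open_cell - unit_cell) :: (real ^ 'd) set)"
proof (rule negligible_subset)
  show "negligible (\<Union>i. {y :: real ^ 'd. y $ i = 1})"
    using negligible_standard_hyperplane[of "axis i 1 :: real ^ 'd" 1 for i]
    by (intro negligible_Union) (auto simp: cart_eq_inner_axis axis_in_Basis_iff)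
  show "(unit_cell - half_open_cell) \<union> (half_open_cell - unit_cell) \<subseteq> (\<Union>i. {y :: real ^ 'd. y $ i = 1})"
    by (auto simp: mem_unit_cell mem_half_open_cell not_le not_less less_imp_le) (metis order_antisym)
qed

lemma half_open_cell_lmeasurable: "half_open_cell \<in> lmeasurable"
  by (rule lmeasurable_negligible_symdiff[OF unit_cell_lmeasurable negligible_unit_cell_diff])

lemma measure_half_open_cell: "measure lebesgue (half_open_cell :: (real ^ 'd) set) = 1"
  by (rule trans[OF measure_negligible_symdiff[OF unit_cell_lmeasurable negligible_unit_cell_diff]
        measure_unit_cell])

lemma integral_half_open_cell:
  assumes g: "g \<in> borel_measurable borel"
  shows "(LINT y|lebesgue. indicator half_open_cell y * g y) = cell_mean g"
proof -
  have [measurable]: "g \<in> borel_measurable lebesgue"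
    using g by (intro measurable_completion) simp
  note [measurable] = fmeasurableD[OF half_open_cell_lmeasurable] fmeasurableD[OF unit_cell_lmeasurable]
  have "(LINT y|lebesgue. indicator half_open_cell y * g y) = (LINT y|lebesgue. indicator unit_cell y * g y)"
  proof (rule integral_cong_AE)
    have "AE y in lebesgue. y \<notin> (unit_cell - half_open_cell) \<union> (half_open_cell - unit_cell)"
      by (rule AE_not_in) (use negligible_unit_cell_diff negligible_iff_null_sets in blast)
    then show "AE y in lebesgue. indicator half_open_cell y * g y = indicator unit_cell y * g y"
      by eventually_elim (auto simp: indicator_def)
  qed simp_all
  also have "\<dots> = cell_mean g"
    using integral_restrict_space[of unit_cell lebesgue g] by (simp add: fmeasurableD)
  finally show ?thesis .
qed

text \<open>The scaling constant enters the integral and the volume of the cell alike, so the mean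
  over an affine cell equals the mean over the unit cell.\<close>

lemma affine_cell_integral:
  assumes A: "invertible A" and g: "g \<in> C_per"
  shows "affine_map A q ` half_open_cell \<in> lmeasurable"
    "integrable lebesgue (\<lambda>x. indicator (affine_map A q ` half_open_cell) x * g (affine_inv A q x))"
    "(LINT x|lebesgue. indicator (affine_map A q ` half_open_cell) x * g (affine_inv A q x)) =
       measure lebesgue (affine_map A q ` half_open_cell) * cell_mean g"
proof -
  obtain c where c: "c > 0" "\<And>S. S \<in> lmeasurable \<Longrightarrow> affine_map A q ` S \<in> lmeasurable"
    "\<And>S. S \<in> lmeasurable \<Longrightarrow> measure lebesgue (affine_map A q ` S) = c * measure lebesgue S"
    "affine_inv A q \<in> measurable lebesgue lebesgue"
    "\<And>g :: real ^ 'a \<Rightarrow> real. g \<in> borel_measurable lebesgue \<Longrightarrow>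
       (LINT x|lebesgue. g (affine_inv A q x)) = c * (LINT y|lebesgue. g y)"
    using affine_inv_integral[OF A] by blast
  have gm: "g \<in> borel_measurable borel" by (rule C_per_borel_measurable[OF g])
  have [measurable]: "g \<in> borel_measurable lebesgue"
    using gm by (intro measurable_completion) simp
  note [measurable] = fmeasurableD[OF half_open_cell_lmeasurable]
  show P: "affine_map A q ` half_open_cell \<in> lmeasurable"
    by (rule c(2)[OF half_open_cell_lmeasurable])
  have ind: "indicator (affine_map A q ` half_open_cell) x = (indicator half_open_cell (affine_inv A q x) :: real)" for x
  proof -
    have "x \<in> affine_map A q ` half_open_cell \<longleftrightarrow> affine_inv A q x \<in> half_open_cell"
      using affine_inv_affine_map[OF A] by (metis image_iff)
    then show ?thesis by (simp add: indicator_def)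
  qed
  have "(LINT x|lebesgue. indicator half_open_cell (affine_inv A q x) * g (affine_inv A q x)) = c * cell_mean g"
    by (subst c(5)[of "\<lambda>y. indicator half_open_cell y * g y"]) (simp_all add: integral_half_open_cell[OF gm])
  then show "(LINT x|lebesgue. indicator (affine_map A q ` half_open_cell) x * g (affine_inv A q x)) =
       measure lebesgue (affine_map A q ` half_open_cell) * cell_mean g"
    using c(3)[OF half_open_cell_lmeasurable] by (simp add: ind measure_half_open_cell)
  have [measurable]: "(\<lambda>x. g (affine_inv A q x)) \<in> borel_measurable lebesgue"
    by (rule measurable_compose[OF c(4)]) simp
  show "integrable lebesgue (\<lambda>x. indicator (affine_map A q ` half_open_cell) x * g (affine_inv A q x))"
  proof (rule Bochner_Integration.integrable_bound)
    show "integrable lebesgue (\<lambda>x. indicator (affine_map A q ` half_open_cell) x * sup_norm g)"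
      using P by (intro integrable_mult_left) (simp add: lmeasurable_iff_integrable)
    show "AE x in lebesgue. norm (indicator (affine_map A q ` half_open_cell) x * g (affine_inv A q x))
        \<le> norm (indicator (affine_map A q ` half_open_cell) x * sup_norm g)"
      using C_per_abs_le_sup_norm[OF g] sup_norm_nonneg[OF g] by (auto simp: indicator_def)
  qed (use fmeasurableD[OF P] in measurable)
qed

text \<open>A bounded set meets finitely many lattice cells; this makes the sum over cells in the
  averaging estimate finite.\<close>

lemma finite_floor_vec_image:
  assumes "bounded (S :: (real ^ 'd) set)"
  shows "finite (floor_vec ` S)"
proof -
  obtain B where B: "\<And>y. y \<in> S \<Longrightarrow> norm y \<le> B" using assms by (auto simp: bounded_iff)
  have "floor_vec ` S \<subseteq> (\<lambda>h. \<chi> i. of_int (h i)) ` Pi\<^sub>E (UNIV :: 'd set) (\<lambda>_. {\<lfloor>- B\<rfloor>..\<lfloor>B\<rfloor>})"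
  proof clarify
    fix y assume "y \<in> S"
    then have "\<bar>y $ i\<bar> \<le> B" for i using B component_le_norm_cart[of y i] by force
    then have "- B \<le> y $ i" "y $ i \<le> B" for i by (auto simp: abs_le_iff minus_le_iff)
    then have "\<lfloor>- B\<rfloor> \<le> \<lfloor>y $ i\<rfloor>" "\<lfloor>y $ i\<rfloor> \<le> \<lfloor>B\<rfloor>" for i by (auto intro!: floor_mono simp del: floor_minus)
    then show "floor_vec y \<in> (\<lambda>h. \<chi> i. of_int (h i)) ` Pi\<^sub>E (UNIV :: 'd set) (\<lambda>_. {\<lfloor>- B\<rfloor>..\<lfloor>B\<rfloor>})"
      unfolding floor_vec_def
      by (intro image_eqI[where x = "\<lambda>i. \<lfloor>y $ i\<rfloor>"]) auto
  qed
  then show ?thesis by (rule finite_subset) (intro finite_imageI finite_PiE, auto)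
qed

lemma continuous_on_matrix_vector_mult:
  "continuous_on S (\<lambda>x :: real ^ 'd. (A :: real ^ 'd ^ 'd) *v x)"
  by (rule linear_continuous_on) (simp add: matrix_vector_mul_bounded_linear)

lemma affine_inv_borel_measurable: "affine_inv A q \<in> borel_measurable borel"
proof (rule borel_measurable_continuous_onI)
  show "continuous_on UNIV (affine_inv A q)"
    unfolding affine_inv_def matrix_vector_mult_diff_distrib
    by (intro continuous_intros continuous_on_matrix_vector_mult)
qed

text \<open>The cells meeting \<open>E\<close> are disjoint, cover \<open>E\<close> and are contained in \<open>E'\<close>.\<close>

lemma integral_periodic_le:
  fixes A :: "real ^ 'd ^ 'd"
  assumes A: "invertible A" and g: "g \<in> C_per" and g0: "\<And>y. 0 \<le> g y"
    and E: "E \<in> sets lebesgue" "bounded E" and E': "E' \<in> lmeasurable"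
    and small: "\<And>w. (\<And>i. \<bar>w $ i\<bar> \<le> 1) \<Longrightarrow> norm (A *v w) \<le> \<delta>"
    and nbhd: "\<And>x y. y \<in> E \<Longrightarrow> dist x y \<le> \<delta> \<Longrightarrow> x \<in> E'"
  shows "(LINT x|lebesgue. indicator E x * g (affine_inv A q x)) \<le> measure lebesgue E' * cell_mean g"
proof -
  define P where "P k = {x. floor_vec (affine_inv A q x) = k}" for k
  define K where "K = floor_vec ` affine_inv A q ` E"
  let ?g = "\<lambda>x. g (affine_inv A q x)"
  have "bounded (affine_inv A q ` E)"
  proof -
    have "affine_inv A q ` E = (\<lambda>z. z - matrix_inv A *v q) ` (*v) (matrix_inv A) ` E"
      by (auto simp: affine_inv_def matrix_vector_mult_diff_distrib image_image)
    then show ?thesis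
      using E(2) by (simp add: bounded_linear_image matrix_vector_mul_bounded_linear bounded_translation_minus)
  qed
  then have finK: "finite K" unfolding K_def by (rule finite_floor_vec_image)
  have P: "P k \<in> lmeasurable" "integrable lebesgue (\<lambda>x. indicator (P k) x * ?g x)"
    "(LINT x|lebesgue. indicator (P k) x * ?g x) = measure lebesgue (P k) * cell_mean g"
    if "k \<in> K" for k
  proof -
    \<comment> \<open>Taking the lattice point of index \<open>k\<close> as origin turns
      \<open>P k\<close> into the image of the half-open cell; periodicity of \<open>g\<close>
      absorbs the shift.\<close>
    let ?q = "q + A *v k"
    have kint: "k $ i \<in> \<int>" for i using that by (auto simp: K_def floor_vec_Ints)
    have shift: "affine_inv A q x = affine_inv A ?q x + k" for x
    proof -
      have "matrix_inv A *v (A *v k) = k"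
        by (simp add: matrix_vector_mul_assoc matrix_inv_invertible[OF A])
      then show ?thesis by (simp add: affine_inv_def matrix_vector_mult_diff_distrib matrix_vector_right_distrib)
    qed
    have fl: "floor_vec (y + k) = k \<longleftrightarrow> y \<in> half_open_cell" for y
    proof -
      have "\<lfloor>y $ i + k $ i\<rfloor> = \<lfloor>y $ i\<rfloor> + k $ i" for i
        using kint[of i] by (auto elim!: Ints_cases)
      then show ?thesis by (simp add: half_open_cell_def floor_vec_def vec_eq_iff)
    qed
    have "P k = affine_map A ?q ` half_open_cell"
    proof (intro equalityI subsetI)
      fix x assume "x \<in> P k"
      then have "affine_inv A ?q x \<in> half_open_cell" by (simp add: P_def shift fl)
      then have "affine_map A ?q (affine_inv A ?q x) \<in> affine_map A ?q ` half_open_cell" by blast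
      then show "x \<in> affine_map A ?q ` half_open_cell" by (simp only: affine_inv_affine_map(2)[OF A])
    next
      fix x assume "x \<in> affine_map A ?q ` half_open_cell"
      then show "x \<in> P k" by (auto simp: P_def shift fl affine_inv_affine_map[OF A])
    qed
    moreover have "?g x = g (affine_inv A ?q x)" for x
      unfolding shift by (rule C_per_add_int[OF g kint])
    ultimately show "P k \<in> lmeasurable" "integrable lebesgue (\<lambda>x. indicator (P k) x * ?g x)"
      "(LINT x|lebesgue. indicator (P k) x * ?g x) = measure lebesgue (P k) * cell_mean g"
      using affine_cell_integral[OF A g, of ?q] by simp_all
  qed
  \<comment> \<open>Points of one cell have coordinates with equal integer parts, so
    \<open>small\<close> bounds their distance by \<open>\<delta>\<close>, and a cell that meets
    \<open>E\<close> stays in \<open>E'\<close>.\<close>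
  have sub: "P k \<subseteq> E'" if "k \<in> K" for k
  proof
    fix x assume "x \<in> P k"
    from that obtain y where y: "y \<in> E" "floor_vec (affine_inv A q y) = k" by (auto simp: K_def)
    let ?w = "affine_inv A q x - affine_inv A q y"
    have "\<bar>?w $ i\<bar> \<le> 1" for i
    proof -
      have "floor_vec (affine_inv A q x) $ i = floor_vec (affine_inv A q y) $ i"
        using \<open>x \<in> P k\<close> y(2) by (simp add: P_def)
      then have "\<lfloor>affine_inv A q x $ i\<rfloor> = \<lfloor>affine_inv A q y $ i\<rfloor>"
        by (simp add: floor_vec_def)
      then show ?thesis by simp linarith
    qed
    then have "norm (A *v ?w) \<le> \<delta>" by (rule small)
    also have "A *v ?w = affine_map A q (affine_inv A q x) - affine_map A q (affine_inv A q y)"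
      by (simp add: affine_map_def matrix_vector_mult_diff_distrib)
    finally have "dist x y \<le> \<delta>" by (simp add: affine_inv_affine_map[OF A] dist_norm)
    then show "x \<in> E'" by (rule nbhd[OF y(1)])
  qed
  \<comment> \<open>At a point of \<open>E\<close> one summand equals the left side, and
    \<open>g0\<close> makes the others nonnegative. Enlarging \<open>E\<close> to full cells is what
    makes the estimate one-sided.\<close>
  have le: "indicator E x * ?g x \<le> (\<Sum>k\<in>K. indicator (P k) x * ?g x)" for x
  proof (cases "x \<in> E")
    case True
    let ?k = "floor_vec (affine_inv A q x)"
    have "?k \<in> K" using True by (simp add: K_def)
    then have "indicator (P ?k) x * ?g x \<le> (\<Sum>k\<in>K. indicator (P k) x * ?g x)"
      using g0 by (intro member_le_sum finK) auto
    then show ?thesis using True by (simp add: P_def)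
  next
    case False
    then show ?thesis using g0 by (simp add: sum_nonneg)
  qed
  have int: "integrable lebesgue (\<lambda>x. \<Sum>k\<in>K. indicator (P k) x * ?g x)"
    by (intro Bochner_Integration.integrable_sum P(2))
  have [measurable]: "?g \<in> borel_measurable lebesgue"
    using measurable_compose[OF affine_inv_borel_measurable C_per_borel_measurable[OF g]]
    by (intro measurable_completion) simp
  have "integrable lebesgue (\<lambda>x. indicator E x * ?g x)"
    by (rule Bochner_Integration.integrable_bound[OF int])
      (use E(1) g0 le in \<open>auto intro!: AE_I2 simp: abs_of_nonneg sum_nonneg\<close>)
  then have "(LINT x|lebesgue. indicator E x * ?g x) \<le> (LINT x|lebesgue. (\<Sum>k\<in>K. indicator (P k) x * ?g x))"
    by (rule integral_mono[OF _ int le])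
  also have "\<dots> = (\<Sum>k\<in>K. measure lebesgue (P k) * cell_mean g)"
    using P by simp
  also have "\<dots> = measure lebesgue (\<Union>k\<in>K. P k) * cell_mean g"
  proof -
    have "measure lebesgue (\<Union>k\<in>K. P k) = (\<Sum>k\<in>K. measure lebesgue (P k))"
      by (rule measure_UNION'[OF finK P(1)]) (auto simp: P_def pairwise_def disjnt_def)
    then show ?thesis by (simp add: sum_distrib_right)
  qed
  also have "\<dots> \<le> measure lebesgue E' * cell_mean g"
  proof (intro mult_right_mono measure_mono_fmeasurable)
    show "0 \<le> cell_mean g" using g0 by simp
  qed (use P(1) finK sub E' in \<open>auto intro!: fmeasurableD\<close>)
  finally show ?thesis .
qed

section \<open>Cubes, their neighbourhoods and sums over them\<close>

text \<open>In the cube's own coordinates the neighbourhood lies in the box enlarged by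
  \<open>\<delta>\<close> on every side; orthogonal maps keep distances and volumes. With
  \<open>\<delta> = 0\<close> the lemma also serves for the cube itself.\<close>

lemma open_cube_neighbourhood:
  fixes C :: "(real ^ 'd) set"
  assumes C: "open_cube s C" and s: "0 < s" and d: "0 \<le> \<delta>"
  obtains C' where "C' \<in> lmeasurable" "C \<subseteq> C'" "\<And>x y. y \<in> C \<Longrightarrow> dist x y \<le> \<delta> \<Longrightarrow> x \<in> C'"
    "measure lebesgue C' = (s + 2 * \<delta>) ^ CARD('d)"
    "C \<in> lmeasurable" "measure lebesgue C = s ^ CARD('d)"
proof -
  obtain a and f :: "real ^ 'd \<Rightarrow> real ^ 'd" where f: "orthogonal_transformation f" and Cf: "C = (\<lambda>x. a + f x) ` box 0 (s *\<^sub>R 1)"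
    using C unfolding open_cube_def by blast
  let ?b = "cbox (- (\<delta> *\<^sub>R 1)) ((s + \<delta>) *\<^sub>R 1) :: (real ^ 'd) set"
  have im: "(\<lambda>x. a + f x) ` S = (+) a ` f ` S" for S by auto
  have meas: "(\<lambda>x. a + f x) ` S \<in> lmeasurable"
    "measure lebesgue ((\<lambda>x. a + f x) ` S) = measure lebesgue S" if "S \<in> lmeasurable" for S
    unfolding im using orthogonal_image_measure[OF f that]
    by (simp_all add: measurable_translation measure_translation)
  show thesis
  proof (rule that[of "(\<lambda>x. a + f x) ` ?b"])
    show "C \<subseteq> (\<lambda>x. a + f x) ` ?b"
      unfolding Cf
    proof (intro image_mono subsetI)
      fix x :: "real ^ 'd" assume "x \<in> box 0 (s *\<^sub>R 1)"
      then have "0 < x $ i" "x $ i < s" for i by (auto simp: mem_box_cart)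
      then have "- \<delta> \<le> x $ i" "x $ i \<le> s + \<delta>" for i
        using d by (smt (verit))+
      then show "x \<in> ?b" by (simp add: mem_box_cart)
    qed
    show "(\<lambda>x. a + f x) ` ?b \<in> lmeasurable" by (rule meas) simp
    have ne: "?b \<noteq> {}" using s d by (auto simp: interval_ne_empty_cart)
    have "measure lebesgue ?b = (s + 2 * \<delta>) ^ CARD('d)"
      using content_cbox_cart[OF ne] by (simp add: algebra_simps)
    then show "measure lebesgue ((\<lambda>x. a + f x) ` ?b) = (s + 2 * \<delta>) ^ CARD('d)"
      by (simp add: meas)
    show "C \<in> lmeasurable" unfolding Cf by (rule meas) simp
    have ne': "cbox 0 (s *\<^sub>R 1) \<noteq> ({} :: (real ^ 'd) set)" using s by (auto simp: interval_ne_empty_cart)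
    have "measure lebesgue (box 0 (s *\<^sub>R 1) :: (real ^ 'd) set) = measure lebesgue (cbox 0 (s *\<^sub>R 1) :: (real ^ 'd) set)"
      by (simp add: measure_lborel_box_eq measure_lborel_cbox_eq)
    also have "\<dots> = s ^ CARD('d)" using content_cbox_cart[OF ne'] by simp
    finally show "measure lebesgue C = s ^ CARD('d)" unfolding Cf by (simp add: meas)
    fix x y assume y: "y \<in> C" "dist x y \<le> \<delta>"
    then obtain w where w: "y = a + f w" "w \<in> box 0 (s *\<^sub>R 1)" by (auto simp: Cf)
    obtain v where v: "f v = x - y"
      using orthogonal_transformation_surj[OF f] by (metis surjD)
    have lin: "linear f" by (rule orthogonal_transformation_linear[OF f])
    have "norm v \<le> \<delta>" using v y(2) orthogonal_transformation_norm[OF f, of v] by (simp add: dist_norm)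
    then have vi: "\<bar>v $ i\<bar> \<le> \<delta>" for i using component_le_norm_cart[of v i] by linarith
    have "w + v \<in> ?b"
      unfolding mem_box_cart
    proof (intro allI conjI)
      fix i
      have "0 < w $ i" "w $ i < s" using w(2) by (auto simp: mem_box_cart)
      then show "(- (\<delta> *\<^sub>R 1)) $ i \<le> (w + v) $ i" "(w + v) $ i \<le> ((s + \<delta>) *\<^sub>R 1) $ i"
        using vi[of i] by auto
    qed
    moreover have "x = a + f (w + v)" using v w(1) by (simp add: linear_add[OF lin])
    ultimately show "x \<in> (\<lambda>x. a + f x) ` ?b" by blast
  qed
qed

lemma open_cube_subset_cball:
  fixes C :: "(real ^ 'd) set"
  assumes C: "open_cube s C" and z: "z \<in> C" "norm z \<le> B"
  shows "C \<subseteq> cball 0 (B + real CARD('d) * s)"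
proof
  fix y assume "y \<in> C"
  obtain a and f :: "real ^ 'd \<Rightarrow> real ^ 'd" where f: "orthogonal_transformation f" and Cf: "C = (\<lambda>x. a + f x) ` box 0 (s *\<^sub>R 1)"
    using C unfolding open_cube_def by blast
  obtain w w' where w: "y = a + f w" "z = a + f w'" "w \<in> box 0 (s *\<^sub>R 1)" "w' \<in> box 0 (s *\<^sub>R 1)"
    using \<open>y \<in> C\<close> z(1) by (auto simp: Cf)
  have "y - z = f (w - w')"
    using linear_diff[OF orthogonal_transformation_linear[OF f]] w by simp
  then have "norm (y - z) = norm (w - w')" using orthogonal_transformation_norm[OF f] by simp
  also have "\<dots> \<le> (\<Sum>i\<in>UNIV. \<bar>(w - w') $ i\<bar>)" by (rule norm_le_l1_cart)
  also have "\<dots> \<le> (\<Sum>i\<in>(UNIV :: 'd set). s)"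
  proof (rule sum_mono)
    fix i
    have "0 < w $ i" "w $ i < s" "0 < w' $ i" "w' $ i < s" using w(3,4) by (auto simp: mem_box_cart)
    then show "\<bar>(w - w') $ i\<bar> \<le> s" by simp
  qed
  finally have "norm (y - z) \<le> real CARD('d) * s" by simp
  then have "norm y \<le> B + real CARD('d) * s" using norm_triangle_sub[of y z] z(2) by linarith
  then show "y \<in> cball 0 (B + real CARD('d) * s)" by simp
qed

text \<open>The cells needed for \<open>E \<inter> Q n\<close> lie in \<open>E'\<close> and in the
  enlarged cube, hence in \<open>E' \<inter> Q n\<close> or in a shell around \<open>Q n\<close>. By
  disjointness the first parts add up to at most the volume of \<open>E'\<close>; the shells,
  possibly overlapping, are simply counted.\<close>

lemma sum_integral_periodic_le:
  fixes A :: "nat \<Rightarrow> real ^ 'd ^ 'd"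
  assumes s: "0 < s" and d: "0 \<le> \<delta>"
    and Q: "\<And>n. n \<in> I \<Longrightarrow> open_cube s (Q n)" "disjoint_family_on Q I" "finite I"
    and A: "\<And>n. n \<in> I \<Longrightarrow> invertible (A n)" and g: "g \<in> C_per" and g0: "\<And>y. 0 \<le> g y"
    and small: "\<And>n w. n \<in> I \<Longrightarrow> (\<And>i. \<bar>w $ i\<bar> \<le> 1) \<Longrightarrow> norm (A n *v w) \<le> \<delta>"
    and E: "E \<in> sets lebesgue" "bounded E" and E': "E' \<in> lmeasurable"
    and nbhd: "\<And>x y. y \<in> E \<Longrightarrow> dist x y \<le> \<delta> \<Longrightarrow> x \<in> E'"
  shows "(\<Sum>n\<in>I. LINT x|lebesgue. indicator (E \<inter> Q n) x * g (affine_inv (A n) (q n) x)) \<le>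
    (measure lebesgue E' + real (card I) * ((s + 2 * \<delta>) ^ CARD('d) - s ^ CARD('d))) * cell_mean g"
proof -
  let ?v = "(s + 2 * \<delta>) ^ CARD('d) - s ^ CARD('d)"
  have Qm: "Q n \<in> lmeasurable" if "n \<in> I" for n
    using open_cube_neighbourhood[OF Q(1)[OF that] s d] by blast
  have "(LINT x|lebesgue. indicator (E \<inter> Q n) x * g (affine_inv (A n) (q n) x)) \<le>
      (measure lebesgue (E' \<inter> Q n) + ?v) * cell_mean g" if n: "n \<in> I" for n
  proof -
    obtain C' where C': "C' \<in> lmeasurable" "Q n \<subseteq> C'" "\<And>x y. y \<in> Q n \<Longrightarrow> dist x y \<le> \<delta> \<Longrightarrow> x \<in> C'"
      "measure lebesgue C' = (s + 2 * \<delta>) ^ CARD('d)" "measure lebesgue (Q n) = s ^ CARD('d)"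
      using open_cube_neighbourhood[OF Q(1)[OF n] s d] by metis
    have "(LINT x|lebesgue. indicator (E \<inter> Q n) x * g (affine_inv (A n) (q n) x)) \<le>
        measure lebesgue (E' \<inter> C') * cell_mean g"
    proof (rule integral_periodic_le[OF A[OF n] g g0])
      show "E \<inter> Q n \<in> sets lebesgue" using E(1) fmeasurableD[OF Qm[OF n]] by blast
      show "bounded (E \<inter> Q n)" using E(2) by blast
      show "E' \<inter> C' \<in> lmeasurable" using E' C'(1) by blast
    qed (use small[OF n] nbhd C'(3) in auto)
    also have "measure lebesgue (E' \<inter> C') \<le> measure lebesgue ((E' \<inter> Q n) \<union> (C' - Q n))"
      using E' C'(1) Qm[OF n] by (intro measure_mono_fmeasurable fmeasurable.Un) (auto dest: fmeasurableD)
    also have "\<dots> \<le> measure lebesgue (E' \<inter> Q n) + measure lebesgue (C' - Q n)"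
      using E' C'(1) Qm[OF n] by (intro measure_Un_le) (auto dest: fmeasurableD)
    also have "measure lebesgue (C' - Q n) = ?v"
      using measurable_measure_Diff[OF C'(1) fmeasurableD[OF Qm[OF n]] C'(2)] C'(4,5) by simp
    finally show ?thesis using cell_mean_nonneg[of g] g0 by (simp add: mult_right_mono)
  qed
  then have "(\<Sum>n\<in>I. LINT x|lebesgue. indicator (E \<inter> Q n) x * g (affine_inv (A n) (q n) x)) \<le>
      (\<Sum>n\<in>I. (measure lebesgue (E' \<inter> Q n) + ?v) * cell_mean g)"
    by (rule sum_mono)
  also have "\<dots> = ((\<Sum>n\<in>I. measure lebesgue (E' \<inter> Q n)) + real (card I) * ?v) * cell_mean g"
    by (simp add: sum_distrib_right[symmetric] sum.distrib)
  also have "\<dots> \<le> (measure lebesgue E' + real (card I) * ?v) * cell_mean g"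
  proof (intro mult_right_mono add_right_mono)
    have "(\<Sum>n\<in>I. measure lebesgue (E' \<inter> Q n)) = measure lebesgue (\<Union>n\<in>I. E' \<inter> Q n)"
      by (rule measure_UNION'[symmetric])
        (use Q E' Qm in \<open>auto simp: disjoint_family_on_def pairwise_def disjnt_def\<close>)
    also have "\<dots> \<le> measure lebesgue E'"
      using E' Qm Q(3) by (intro measure_mono_fmeasurable) (auto dest: fmeasurableD)
    finally show "(\<Sum>n\<in>I. measure lebesgue (E' \<inter> Q n)) \<le> measure lebesgue E'" .
    show "0 \<le> cell_mean g" using g0 by simp
  qed
  finally show ?thesis .
qed

text \<open>With \<open>c\<close> the period, the right side is the argument occurring in
  \<open>lp_approx\<close>; the small cells thus become affine images of the unit cell.\<close>

lemma affine_inv_scaleR: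
  assumes "invertible A" "c \<noteq> 0"
  shows "affine_inv (c *\<^sub>R A) q x = (1 / c) *\<^sub>R (matrix_inv A *v (x - q))"
proof -
  have inv: "invertible (c *\<^sub>R A)" by (rule scalar_invertible[OF assms(2,1)])
  have "A *v (matrix_inv A *v (x - q)) = x - q"
    by (simp add: matrix_vector_mul_assoc matrix_inv_invertible[OF assms(1)])
  then have "affine_map (c *\<^sub>R A) q ((1 / c) *\<^sub>R (matrix_inv A *v (x - q))) = x"
    using assms(2) by (simp add: affine_map_def matrix_scaleR_vector_ac[symmetric] scaleR_matrix_vector_assoc[symmetric]
        matrix_vector_mult_scaleR)
  then show ?thesis using affine_inv_affine_map(1)[OF inv] by metis
qed

lemma integrable_indicator_bounded:
  fixes f :: "'a::euclidean_space \<Rightarrow> real"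
  assumes E: "E \<in> lmeasurable" and f: "f \<in> borel_measurable lebesgue" and B: "\<And>x. \<bar>f x\<bar> \<le> B"
  shows "integrable lebesgue (\<lambda>x. indicator E x * f x)"
proof (rule Bochner_Integration.integrable_bound)
  show "integrable lebesgue (\<lambda>x. indicator E x * B)"
    using E by (intro integrable_mult_left) (simp add: lmeasurable_iff_integrable)
  show "(\<lambda>x. indicator E x * f x) \<in> borel_measurable lebesgue"
    using fmeasurableD[OF E] f by measurable
  have "\<bar>f x\<bar> \<le> \<bar>B\<bar>" for x using B[of x] by linarith
  then show "AE x in lebesgue. norm (indicator E x * f x) \<le> norm (indicator E x * B)"
    by (auto simp: indicator_def)
qed

section \<open>Locally periodic oscillations\<close>

text \<open>\<open>s j\<close> is the side of the cubes. Coordinates of two points of one cell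
  differ by at most 1, so by \<open>D_bound\<close> such points of the lattice used on
  \<open>Q j n\<close> are at distance at most \<open>\<epsilon> j * M\<close>.\<close>

locale lp_setting =
  fixes \<Omega> :: "(real ^ 'd) set" and D :: "real ^ 'd \<Rightarrow> real ^ 'd ^ 'd"
    and \<epsilon> s :: "nat \<Rightarrow> real" and N :: "nat \<Rightarrow> nat" and Q :: "nat \<Rightarrow> nat \<Rightarrow> (real ^ 'd) set"
    and p q :: "nat \<Rightarrow> nat \<Rightarrow> real ^ 'd" and M :: real
  assumes open_Om: "open \<Omega>" and bounded_Om: "bounded \<Omega>"
    and D_invertible: "\<And>x. invertible (D x)"
    and D_bound: "\<And>x w. x \<in> \<Omega> \<Longrightarrow> (\<And>i. \<bar>w $ i\<bar> \<le> 1) \<Longrightarrow> norm (D x *v w) \<le> M"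
    and eps_pos: "\<And>j. 0 < \<epsilon> j" and side_pos: "\<And>j. 0 < s j"
    and eps_lim: "\<epsilon> \<longlonglongrightarrow> 0" and side_lim: "s \<longlonglongrightarrow> 0"
    and ratio_lim: "(\<lambda>j. \<epsilon> j / s j) \<longlonglongrightarrow> 0"
    and cube: "\<And>j n. n \<in> {1..N j} \<Longrightarrow> open_cube (s j) (Q j n)"
    and disj: "\<And>j. disjoint_family_on (Q j) {1..N j}"
    and meets: "\<And>j n. n \<in> {1..N j} \<Longrightarrow> Q j n \<inter> \<Omega> \<noteq> {}"
    and frozen: "\<And>j n. n \<in> {1..N j} \<Longrightarrow> p j n \<in> \<Omega>"
begin

definition cubes :: "nat \<Rightarrow> (real ^ 'd) set" where
  "cubes j = (\<Union>n\<in>{1..N j}. Q j n)"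

text \<open>By disjointness at most one summand is nonzero. The default value 0 off the cubes is
  masked by the factor \<open>indicator (cubes j)\<close> wherever the phase is used.\<close>

definition phase :: "nat \<Rightarrow> real ^ 'd \<Rightarrow> real ^ 'd" where
  "phase j x = (\<Sum>n=1..N j. indicator (Q j n) x *\<^sub>R affine_inv (\<epsilon> j *\<^sub>R D (p j n)) (q j n) x)"

lemma sum_indicator_cubes:
  fixes f :: "nat \<Rightarrow> 'b::real_vector"
  assumes "n \<in> {1..N j}" "x \<in> Q j n"
  shows "(\<Sum>m=1..N j. indicator (Q j m) x *\<^sub>R f m) = f n"
proof -
  have "x \<notin> Q j m" if "m \<in> {1..N j}" "m \<noteq> n" for m
    using disj[of j] assms that unfolding disjoint_family_on_def by blast
  then have "(\<Sum>m=1..N j. indicator (Q j m) x *\<^sub>R f m) = (\<Sum>m=1..N j. if m = n then f n else 0)"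
    using assms(2) by (intro sum.cong) auto
  then show ?thesis using assms(1) by simp
qed

lemma phase_eq: "n \<in> {1..N j} \<Longrightarrow> x \<in> Q j n \<Longrightarrow> phase j x = affine_inv (\<epsilon> j *\<^sub>R D (p j n)) (q j n) x"
  unfolding phase_def by (rule sum_indicator_cubes)

lemma sum_indicator_cubes_0:
  fixes f :: "nat \<Rightarrow> real"
  assumes "x \<notin> cubes j"
  shows "(\<Sum>m=1..N j. f m * indicator (Q j m) x) = 0"
  using assms by (intro sum.neutral) (auto simp: cubes_def)

text \<open>At most one cube contains \<open>x\<close>, so the sum collapses to one evaluation, and
  the covering is seen through \<open>cubes j\<close> and \<open>phase j\<close>.\<close>

lemma lp_approx_eq:
  "lp_approx D (\<epsilon> j) (N j) (Q j) (p j) (q j) f x = indicator (cubes j) x * f x (phase j x)"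
proof (cases "x \<in> cubes j")
  case True
  then obtain n where n: "n \<in> {1..N j}" "x \<in> Q j n" by (auto simp: cubes_def)
  let ?f = "\<lambda>n. f x ((1 / \<epsilon> j) *\<^sub>R (matrix_inv (D (p j n)) *v (x - q j n)))"
  have "lp_approx D (\<epsilon> j) (N j) (Q j) (p j) (q j) f x = (\<Sum>m=1..N j. indicator (Q j m) x *\<^sub>R ?f m)"
    by (simp add: lp_approx_def mult.commute)
  also have "\<dots> = ?f n" by (rule sum_indicator_cubes[OF n])
  also have "\<dots> = f x (phase j x)"
    using eps_pos[of j] by (simp add: phase_eq[OF n] affine_inv_scaleR[OF D_invertible])
  finally show ?thesis using True by simp
next
  case False
  then show ?thesis unfolding lp_approx_def sum_indicator_cubes_0[OF False] by simp
qed

lemma cube_lmeasurable: "n \<in> {1..N j} \<Longrightarrow> Q j n \<in> lmeasurable"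
  using open_cube_neighbourhood[OF cube side_pos order_refl] by blast

lemma cube_sets_borel: "n \<in> {1..N j} \<Longrightarrow> Q j n \<in> sets borel"
proof (rule borel_open)
  assume "n \<in> {1..N j}"
  from cube[OF this] obtain a and f :: "real ^ 'd \<Rightarrow> real ^ 'd" where f: "orthogonal_transformation f"
    and Q: "Q j n = (\<lambda>x. a + f x) ` box 0 (s j *\<^sub>R 1)"
    unfolding open_cube_def by blast
  have "Q j n = (+) a ` f ` box 0 (s j *\<^sub>R 1)" unfolding Q by auto
  moreover have "open (f ` box 0 (s j *\<^sub>R 1))"
    using orthogonal_transformation_linear[OF f] orthogonal_transformation_surj[OF f]
    by (intro open_surjective_linear_image) auto
  ultimately show "open (Q j n)" by (simp add: open_translation)
qed

lemma cubes_sets_borel: "cubes j \<in> sets borel"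
  unfolding cubes_def using cube_sets_borel by (intro sets.finite_UN) auto

lemma phase_borel_measurable: "phase j \<in> borel_measurable borel"
proof -
  note [measurable] = affine_inv_borel_measurable
  have [measurable]: "indicator (Q j n) \<in> borel_measurable borel" if "n \<in> {1..N j}" for n
    using cube_sets_borel[OF that] by simp
  show ?thesis unfolding phase_def[abs_def]
    by (intro borel_measurable_sum borel_measurable_scaleR) auto
qed

text \<open>The left side is the total volume of the cubes. They are disjoint, meet the bounded set
  \<open>\<Omega>\<close> and, once their side is below 1, fit into one fixed ball.\<close>

lemma bounded_cube_volume: "\<exists>V. \<forall>\<^sub>F j in sequentially. real (N j) * s j ^ CARD('d) \<le> V"
proof -
  obtain B where B: "\<And>x. x \<in> \<Omega> \<Longrightarrow> norm x \<le> B" using bounded_Om by (auto simp: bounded_iff)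
  let ?K = "cball (0 :: real ^ 'd) (B + real CARD('d))"
  have "\<forall>\<^sub>F j in sequentially. s j < 1" using side_lim by (rule order_tendstoD) simp
  then have "\<forall>\<^sub>F j in sequentially. real (N j) * s j ^ CARD('d) \<le> measure lebesgue ?K"
  proof eventually_elim
    case (elim j)
    have sub: "Q j n \<subseteq> ?K" if n: "n \<in> {1..N j}" for n
    proof -
      obtain z where "z \<in> Q j n" "z \<in> \<Omega>" using meets[OF n] by blast
      then have "Q j n \<subseteq> cball 0 (B + real CARD('d) * s j)"
        using open_cube_subset_cball[OF cube[OF n]] B by blast
      also have "\<dots> \<subseteq> ?K"
        using elim side_pos[of j] by (intro subset_cball) (simp add: mult_left_le)
      finally show ?thesis .
    qed
    have "real (N j) * s j ^ CARD('d) = (\<Sum>n\<in>{1..N j}. measure lebesgue (Q j n))"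
    proof -
      have "measure lebesgue (Q j n) = s j ^ CARD('d)" if "n \<in> {1..N j}" for n
        using open_cube_neighbourhood[OF cube[OF that] side_pos order_refl] by metis
      then show ?thesis by simp
    qed
    also have "\<dots> = measure lebesgue (cubes j)"
      unfolding cubes_def
      by (rule measure_UNION'[symmetric])
        (use cube_lmeasurable disj[of j] in \<open>auto simp: disjoint_family_on_def pairwise_def disjnt_def\<close>)
    also have "\<dots> \<le> measure lebesgue ?K"
      unfolding cubes_def
    proof (rule measure_mono_fmeasurable)
      show "(\<Union>n\<in>{1..N j}. Q j n) \<subseteq> ?K" using sub by (rule UN_least)
    qed (use cube_lmeasurable in \<open>auto dest: fmeasurableD\<close>)
    finally show ?case .
  qed
  then show ?thesis by blast
qed

text \<open>Factoring out \<open>s j ^ CARD('d)\<close> leaves the bounded total volume of the cubes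
  times an expression in \<open>\<epsilon> j / s j\<close> that tends to 0: here the cells have to
  be small compared with the cubes.\<close>

lemma shell_volume_lim:
  "(\<lambda>j. real (N j) * ((s j + 2 * (\<epsilon> j * M)) ^ CARD('d) - s j ^ CARD('d))) \<longlonglongrightarrow> 0"
proof -
  let ?h = "\<lambda>j. (1 + 2 * M * (\<epsilon> j / s j)) ^ CARD('d) - 1"
  obtain V where V: "\<forall>\<^sub>F j in sequentially. real (N j) * s j ^ CARD('d) \<le> V"
    using bounded_cube_volume by blast
  have "?h \<longlonglongrightarrow> (1 + 2 * M * 0) ^ CARD('d) - 1"
    by (intro tendsto_intros ratio_lim)
  then have h: "?h \<longlonglongrightarrow> 0" by simp
  have eq: "real (N j) * ((s j + 2 * (\<epsilon> j * M)) ^ CARD('d) - s j ^ CARD('d)) = real (N j) * s j ^ CARD('d) * ?h j" for j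
  proof -
    have "s j + 2 * (\<epsilon> j * M) = s j * (1 + 2 * M * (\<epsilon> j / s j))"
      using side_pos[of j] by (simp add: field_simps)
    then have "(s j + 2 * (\<epsilon> j * M)) ^ CARD('d) = s j ^ CARD('d) * (1 + 2 * M * (\<epsilon> j / s j)) ^ CARD('d)"
      by (simp add: power_mult_distrib)
    then show ?thesis by (simp add: algebra_simps)
  qed
  show ?thesis
    unfolding eq
  proof (rule Lim_null_comparison)
    show "\<forall>\<^sub>F j in sequentially. norm (real (N j) * s j ^ CARD('d) * ?h j) \<le> \<bar>V\<bar> * \<bar>?h j\<bar>"
      using V
    proof eventually_elim
      case (elim j)
      then have "\<bar>real (N j) * s j ^ CARD('d)\<bar> \<le> \<bar>V\<bar>" using side_pos[of j] by simp
      then show ?case unfolding real_norm_def abs_mult[of _ "?h j"] by (intro mult_right_mono) auto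
    qed
    show "(\<lambda>j. \<bar>V\<bar> * \<bar>?h j\<bar>) \<longlonglongrightarrow> 0"
      using tendsto_mult_left[OF tendsto_rabs[OF h], of "\<bar>V\<bar>"] by simp
  qed
qed

lemma lmeasurable_Om: "\<Omega> \<in> lmeasurable"
  by (rule lmeasurable_open[OF bounded_Om open_Om])

section \<open>The asymptotic upper bound for oscillating integrals\<close>

lemma oscillation_measurable:
  assumes "g \<in> C_per"
  shows "(\<lambda>x. indicator (cubes j) x * g (phase j x)) \<in> borel_measurable borel"
  using cubes_sets_borel measurable_compose[OF phase_borel_measurable C_per_borel_measurable[OF assms]]
  by measurable

lemma oscillation_integral_eq:
  assumes g: "g \<in> C_per" and T: "T \<in> lmeasurable"
  shows "(LINT x|lebesgue. indicator T x * (indicator (cubes j) x * g (phase j x))) =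
    (\<Sum>n\<in>{1..N j}. LINT x|lebesgue. indicator (T \<inter> Q j n) x * g (affine_inv (\<epsilon> j *\<^sub>R D (p j n)) (q j n) x))"
proof -
  have eq: "indicator T x * (indicator (cubes j) x * g (phase j x)) =
      (\<Sum>n\<in>{1..N j}. indicator (T \<inter> Q j n) x * g (affine_inv (\<epsilon> j *\<^sub>R D (p j n)) (q j n) x))" for x
  proof (cases "x \<in> cubes j")
    case True
    then obtain n where n: "n \<in> {1..N j}" "x \<in> Q j n" by (auto simp: cubes_def)
    have "(\<Sum>n\<in>{1..N j}. indicator (T \<inter> Q j n) x * g (affine_inv (\<epsilon> j *\<^sub>R D (p j n)) (q j n) x)) =
        (\<Sum>n\<in>{1..N j}. indicator (Q j n) x *\<^sub>R (indicator T x * g (affine_inv (\<epsilon> j *\<^sub>R D (p j n)) (q j n) x)))"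
      by (intro sum.cong) (auto simp: indicator_def)
    also have "\<dots> = indicator T x * g (affine_inv (\<epsilon> j *\<^sub>R D (p j n)) (q j n) x)"
      by (rule sum_indicator_cubes[OF n])
    finally show ?thesis using True by (simp add: phase_eq[OF n])
  next
    case False
    then show ?thesis by (subst sum.neutral) (auto simp: cubes_def)
  qed
  have "integrable lebesgue (\<lambda>x. indicator (T \<inter> Q j n) x * g (affine_inv (\<epsilon> j *\<^sub>R D (p j n)) (q j n) x))"
    if "n \<in> {1..N j}" for n
  proof (rule integrable_indicator_bounded)
    show "T \<inter> Q j n \<in> lmeasurable" using T cube_lmeasurable[OF that] by blast
    show "(\<lambda>x. g (affine_inv (\<epsilon> j *\<^sub>R D (p j n)) (q j n) x)) \<in> borel_measurable lebesgue"
      using measurable_compose[OF affine_inv_borel_measurable C_per_borel_measurable[OF g]]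
      by (intro measurable_completion) simp
    show "\<bar>g (affine_inv (\<epsilon> j *\<^sub>R D (p j n)) (q j n) x)\<bar> \<le> sup_norm g" for x
      by (rule C_per_abs_le_sup_norm[OF g])
  qed
  then show ?thesis unfolding eq by (rule Bochner_Integration.integral_sum)
qed

text \<open>Regularity of Lebesgue measure gives a compact \<open>T\<close> inside \<open>A\<close>
  and an open \<open>O'\<close> around it, both close to \<open>A\<close> in measure. A
  neighbourhood of \<open>T\<close> lies in \<open>O'\<close>, so for small periods the cells
  meeting \<open>T\<close> do too; on \<open>A - T\<close> the sup norm of \<open>g\<close>
  suffices.\<close>

lemma oscillation_upper_bound:
  assumes A: "A \<in> sets lebesgue" "A \<subseteq> \<Omega>" and g: "g \<in> C_per" and g0: "\<And>y. 0 \<le> g y" and e: "0 < e"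
  shows "\<forall>\<^sub>F j in sequentially.
    (LINT x|lebesgue. indicator A x * (indicator (cubes j) x * g (phase j x))) \<le> measure lebesgue A * cell_mean g + e"
proof -
  define G where "G = sup_norm g"
  have G: "0 \<le> G" "\<And>y. \<bar>g y\<bar> \<le> G"
    unfolding G_def using sup_norm_nonneg[OF g] C_per_abs_le_sup_norm[OF g] by auto
  define I where "I = cell_mean g"
  have I: "0 \<le> I" unfolding I_def using g0 by simp
  \<comment> \<open>One half of \<open>e\<close> pays for the two regularity errors
    \<open>\<eta> * G\<close> and \<open>\<eta> * I\<close>, the other for the shells; the added 1
    keeps the denominator positive.\<close>
  define \<eta> where "\<eta> = e / (2 * (G + I + 1))"
  have eta: "\<eta> > 0" "\<eta> * G + \<eta> * I \<le> e / 2"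
  proof -
    show "\<eta> > 0" unfolding \<eta>_def using e G(1) I by simp
    have "\<eta> * (G + I) \<le> \<eta> * (G + I + 1)" using \<open>\<eta> > 0\<close> by (intro mult_left_mono) auto
    also have "\<dots> = e / 2" unfolding \<eta>_def using G(1) I by (simp add: field_simps)
    finally show "\<eta> * G + \<eta> * I \<le> e / 2" by (simp add: algebra_simps)
  qed
  have bA: "bounded A" using A(2) bounded_Om bounded_subset by blast
  have Al: "A \<in> lmeasurable" using A(1) bA by (rule bounded_set_imp_lmeasurable[rotated])
  obtain T where T: "closed T" "T \<subseteq> A" "A - T \<in> lmeasurable" "emeasure lebesgue (A - T) < ennreal \<eta>"
    using sets_lebesgue_inner_closed[OF A(1) eta(1)] by blast
  have AT: "measure lebesgue (A - T) \<le> \<eta>"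
    using T(4) eta(1) emeasure_eq_measure2[OF T(3)] by (simp add: ennreal_less_iff)
  have bT: "bounded T" using bA T(2) bounded_subset by blast
  then have cT: "compact T" using T(1) by (simp add: compact_eq_bounded_closed)
  then have Tl: "T \<in> lmeasurable" by (rule lmeasurable_compact)
  obtain O' where O': "open O'" "A \<subseteq> O'" "O' - A \<in> lmeasurable" "emeasure lebesgue (O' - A) < ennreal \<eta>"
    using sets_lebesgue_outer_open[OF A(1) eta(1)] by blast
  have Ol: "O' \<in> lmeasurable"
    using fmeasurable.Un[OF Al O'(3)] O'(2) by (simp add: Un_absorb1)
  have "measure lebesgue (O' - A) \<le> \<eta>"
    using O'(4) eta(1) emeasure_eq_measure2[OF O'(3)] by (simp add: ennreal_less_iff)
  then have Om: "measure lebesgue O' \<le> measure lebesgue A + \<eta>"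
    using measurable_measure_Diff[OF Ol A(1) O'(2)] by simp
  obtain d where d: "d > 0" "(\<Union>x\<in>T. cball x d) \<subseteq> O'"
    using compact_subset_open_imp_cball_epsilon_subset[OF cT O'(1)] T(2) O'(2) by blast
  have "(\<lambda>j. \<epsilon> j * M) \<longlonglongrightarrow> 0 * M" by (intro tendsto_intros eps_lim)
  then have ev1: "\<forall>\<^sub>F j in sequentially. \<epsilon> j * M < d"
    using d(1) by (intro order_tendstoD) auto
  let ?sh = "\<lambda>j. real (N j) * ((s j + 2 * (\<epsilon> j * M)) ^ CARD('d) - s j ^ CARD('d))"
  have "(\<lambda>j. ?sh j * I) \<longlonglongrightarrow> 0 * I" by (intro tendsto_intros shell_volume_lim)
  then have ev2: "\<forall>\<^sub>F j in sequentially. ?sh j * I < e / 2"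
    using e by (intro order_tendstoD) auto
  show ?thesis
    using ev1 ev2
  proof eventually_elim
    case (elim j)
    let ?f = "\<lambda>x. indicator (cubes j) x * g (phase j x)"
    have fm: "?f \<in> borel_measurable lebesgue"
      using oscillation_measurable[OF g] by (intro measurable_completion) simp
    have fb: "\<bar>?f x\<bar> \<le> G" for x using G by (auto simp: indicator_def)
    note int = integrable_indicator_bounded[OF _ fm fb]
    \<comment> \<open>\<open>D_bound\<close> speaks of points of \<open>\<Omega>\<close>, so it
      yields the sign of \<open>M\<close> when \<open>\<Omega>\<close> is nonempty. For empty
      \<open>\<Omega>\<close> there are no cubes and the bound below is trivial.\<close>
    have M: "0 \<le> M" if ne: "\<Omega> \<noteq> {}"
    proof -
      obtain x where "x \<in> \<Omega>" using ne by blast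
      from D_bound[OF this, of 0] show ?thesis by simp
    qed
    have T_le: "(LINT x|lebesgue. indicator T x * ?f x) \<le> (measure lebesgue O' + ?sh j) * I"
    proof (cases "\<Omega> = {}")
      case True
      then have "T = {}" "N j = 0" using A(2) T(2) meets[of 1 j] by (auto simp: Suc_le_eq)
      then show ?thesis using I by simp
    next
      case False
      have "(LINT x|lebesgue. indicator T x * ?f x) \<le>
          (measure lebesgue O' + real (card {1..N j}) * ((s j + 2 * (\<epsilon> j * M)) ^ CARD('d) - s j ^ CARD('d))) * cell_mean g"
        unfolding oscillation_integral_eq[OF g Tl]
      proof (rule sum_integral_periodic_le[OF side_pos])
        show "0 \<le> \<epsilon> j * M" using M[OF False] eps_pos[of j] by simp
        show "invertible (\<epsilon> j *\<^sub>R D (p j n))" for n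
          using eps_pos[of j] D_invertible by (intro scalar_invertible) auto
        show "norm (\<epsilon> j *\<^sub>R D (p j n) *v w) \<le> \<epsilon> j * M" if "n \<in> {1..N j}" "\<And>i. \<bar>w $ i\<bar> \<le> 1" for n w
          using D_bound[OF frozen[OF that(1)] that(2)] eps_pos[of j]
          by (simp add: scaleR_matrix_vector_assoc[symmetric])
        show "x \<in> O'" if "y \<in> T" "dist x y \<le> \<epsilon> j * M" for x y
        proof -
          have "x \<in> cball y d" using that(2) elim(1) by (simp add: dist_commute)
          then show ?thesis using d(2) that(1) by blast
        qed
      qed (use cube disj g g0 bT Ol fmeasurableD[OF Tl] in auto)
      then show ?thesis by (simp add: I_def)
    qed
    have "indicator A x * ?f x \<le> indicator T x * ?f x + indicator (A - T) x * G" for x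
      using fb[of x] T(2) by (auto simp: indicator_def)
    moreover have intG: "integrable lebesgue (\<lambda>x. indicator (A - T) x * G)"
      using T(3) by (intro integrable_mult_left) (simp add: lmeasurable_iff_integrable)
    ultimately have "(LINT x|lebesgue. indicator A x * ?f x) \<le>
        (LINT x|lebesgue. indicator T x * ?f x + indicator (A - T) x * G)"
      by (intro integral_mono int[OF Al] Bochner_Integration.integrable_add int[OF Tl]) auto
    also have "\<dots> = (LINT x|lebesgue. indicator T x * ?f x) + measure lebesgue (A - T) * G"
      using int[OF Tl] intG by simp
    also have "\<dots> \<le> (measure lebesgue O' + ?sh j) * I + \<eta> * G"
      using T_le AT G(1) by (intro add_mono mult_right_mono) auto
    also have "\<dots> \<le> (measure lebesgue A + \<eta> + ?sh j) * I + \<eta> * G"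
      using Om I by (intro add_right_mono mult_right_mono)
    also have "\<dots> = measure lebesgue A * I + (\<eta> * G + \<eta> * I) + ?sh j * I" by (simp add: algebra_simps)
    also have "\<dots> \<le> measure lebesgue A * I + e"
      using eta(2) elim(2) by linarith
    finally show ?case by (simp add: I_def)
  qed
qed

end

section \<open>Simple functions with values in a function space\<close>

text \<open>\<open>H\<close> is kept general so that one splitting over level sets serves values at
  a point \<open>y\<close>, squares along the oscillation and cell means.\<close>

lemma simple_function_decompose:
  fixes H :: "'b \<Rightarrow> 'a \<Rightarrow> real"
  assumes s: "simple_function M s" and x: "x \<in> space M"
  shows "H (s x) x = (\<Sum>f\<in>s ` space M. indicator (s -` {f} \<inter> space M) x * H f x)"
proof -
  have "(\<Sum>f\<in>s ` space M. indicator (s -` {f} \<inter> space M) x * H f x) =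
      (\<Sum>f\<in>s ` space M. if f = s x then H f x else 0)"
    using x by (intro sum.cong) auto
  then show ?thesis using x simple_functionD(1)[OF s] by simp
qed

lemma (in finite_measure) simple_function_L2_space:
  fixes f :: "'a \<Rightarrow> real"
  assumes "simple_function M f"
  shows "f \<in> L2_space M"
proof (rule L2_space_bounded)
  show "f \<in> borel_measurable M" by (rule borel_measurable_simple_function[OF assms])
  fix x assume "x \<in> space M"
  then show "\<bar>f x\<bar> \<le> Max ((\<lambda>x. \<bar>f x\<bar>) ` space M)"
    using simple_functionD(1)[OF assms] by (intro Max_ge) (auto simp: image_image[symmetric, of abs f])
qed

lemma (in finite_measure) simple_function_integrable:
  fixes f :: "'a \<Rightarrow> real"
  assumes "simple_function M f"
  shows "integrable M f"
  by (rule L2_space_integrable(1)[OF simple_function_L2_space[OF assms]])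

definition simple_C_per :: "(real ^ 'd) set \<Rightarrow> (real ^ 'd \<Rightarrow> real ^ 'd \<Rightarrow> real) set" where
  "simple_C_per \<Omega> = {s. simple_function (lebesgue_on \<Omega>) s \<and> (\<forall>x\<in>\<Omega>. s x \<in> C_per)}"

lemma simple_C_perD:
  assumes "s \<in> simple_C_per \<Omega>"
  shows "simple_function (lebesgue_on \<Omega>) s" "x \<in> \<Omega> \<Longrightarrow> s x \<in> C_per"
  using assms by (auto simp: simple_C_per_def)

lemma simple_C_per_comb:
  assumes "s \<in> simple_C_per \<Omega>" "t \<in> simple_C_per \<Omega>"
  shows "(\<lambda>x y. s x y + c * t x y) \<in> simple_C_per \<Omega>"
proof -
  have "simple_function (lebesgue_on \<Omega>) (\<lambda>x. (\<lambda>f g y. f y + c * g y) (s x) (t x))"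
    by (rule simple_function_compose2[OF simple_C_perD(1)[OF assms(1)] simple_C_perD(1)[OF assms(2)]])
  then show ?thesis
    using assms unfolding simple_C_per_def by (auto intro!: C_per_add C_per_mult)
qed

lemma simple_C_per_diff:
  assumes "s \<in> simple_C_per \<Omega>" "t \<in> simple_C_per \<Omega>"
  shows "(\<lambda>x y. s x y - t x y) \<in> simple_C_per \<Omega>"
  using simple_C_per_comb[OF assms, of "-1"] by simp

lemma simple_C_per_zero: "(\<lambda>x y. 0) \<in> simple_C_per \<Omega>"
  by (simp add: simple_C_per_def)

lemma L2_C_perD:
  assumes "\<psi> \<in> L2_C_per \<Omega>"
  shows "x \<in> \<Omega> \<Longrightarrow> \<psi> x \<in> C_per"
    "(\<lambda>x. sup_norm (\<psi> x)) \<in> L2_space (lebesgue_on \<Omega>)"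
    "\<exists>s. (\<forall>i. s i \<in> simple_C_per \<Omega>) \<and>
       (AE x in lebesgue_on \<Omega>. (\<lambda>i :: nat. sup_norm (\<lambda>y. s i x y - \<psi> x y)) \<longlonglongrightarrow> 0)"
proof -
  show C: "x \<in> \<Omega> \<Longrightarrow> \<psi> x \<in> C_per" for x using assms by (simp add: L2_C_per_def bochner_L2_def)
  have i: "integrable (lebesgue_on \<Omega>) (\<lambda>x. (sup_norm (\<psi> x))\<^sup>2)"
    using assms by (simp add: L2_C_per_def bochner_L2_def)
  \<comment> \<open>Integrability is given for the squared norm; the norm, being nonnegative, is its
    root and inherits measurability.\<close>
  have "(\<lambda>x. sqrt ((sup_norm (\<psi> x))\<^sup>2)) \<in> borel_measurable (lebesgue_on \<Omega>)"
    using borel_measurable_integrable[OF i] by measurable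
  then have "(\<lambda>x. sup_norm (\<psi> x)) \<in> borel_measurable (lebesgue_on \<Omega>)"
    by (rule measurable_cong[THEN iffD1, rotated]) (use sup_norm_nonneg[OF C] in auto)
  with i show "(\<lambda>x. sup_norm (\<psi> x)) \<in> L2_space (lebesgue_on \<Omega>)" by (simp add: L2_space_def)
  show "\<exists>s. (\<forall>i. s i \<in> simple_C_per \<Omega>) \<and>
       (AE x in lebesgue_on \<Omega>. (\<lambda>i :: nat. sup_norm (\<lambda>y. s i x y - \<psi> x y)) \<longlonglongrightarrow> 0)"
    using assms by (simp add: L2_C_per_def bochner_L2_def strongly_measurable_def simple_C_per_def)
qed

text \<open>Cutting the approximating simple functions off where they are large compared with \<open>\<psi>\<close> makes
  dominated convergence applicable.\<close>

lemma L2_C_per_approx: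
  assumes Om: "\<Omega> \<in> lmeasurable" and psi: "\<psi> \<in> L2_C_per \<Omega>" and e: "e > 0"
  obtains w where "w \<in> simple_C_per \<Omega>"
    "(\<lambda>x. sup_norm (\<lambda>y. \<psi> x y - w x y)) \<in> L2_space (lebesgue_on \<Omega>)"
    "L2_norm (lebesgue_on \<Omega>) (\<lambda>x. sup_norm (\<lambda>y. \<psi> x y - w x y)) \<le> e"
proof -
  let ?M = "lebesgue_on \<Omega>" and ?N = "\<lambda>x. sup_norm (\<psi> x)"
  obtain s :: "nat \<Rightarrow> _" where s: "\<And>i. s i \<in> simple_C_per \<Omega>"
    and lim: "AE x in ?M. (\<lambda>i. sup_norm (\<lambda>y. s i x y - \<psi> x y)) \<longlonglongrightarrow> 0"
    using L2_C_perD(3)[OF psi] by blast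
  note C = L2_C_perD(1)[OF psi] and N = L2_C_perD(2)[OF psi]
  have [measurable]: "?N \<in> borel_measurable ?M" by (rule L2_spaceD[OF N])
  have sn: "simple_function ?M (\<lambda>x. sup_norm (s i x))" for i
    by (rule simple_function_compose1[OF simple_C_perD(1)[OF s]])
  note [measurable] = borel_measurable_simple_function[OF sn]
  \<comment> \<open>Since 2 exceeds 1, the cutoff is eventually inactive wherever
    \<open>sup_norm (\<psi> x)\<close> is positive and the approximation converges; it yields
    \<open>3 * sup_norm (\<psi> x)\<close> as dominating function for the difference.\<close>
  define w where "w i x = (if sup_norm (s i x) \<le> 2 * ?N x then s i x else (\<lambda>y. 0))" for i x
  have w: "w i \<in> simple_C_per \<Omega>" for i
  proof -
    have "simple_function ?M (\<lambda>x. if sup_norm (s i x) \<le> 2 * ?N x then s i x else (\<lambda>y. 0))"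
    proof (rule simple_function_If[OF simple_C_perD(1)[OF s]])
      show "{x \<in> space ?M. sup_norm (s i x) \<le> 2 * ?N x} \<in> sets ?M" by measurable
    qed simp
    then have "simple_function ?M (w i)" by (simp add: w_def[abs_def])
    then show ?thesis using simple_C_perD(2)[OF s] by (auto simp: simple_C_per_def w_def)
  qed
  let ?h = "\<lambda>i x. sup_norm (\<lambda>y. \<psi> x y - w i x y)"
  \<comment> \<open>With \<open>s k\<close> in place of \<open>\<psi>\<close> the norm is a simple
    function of \<open>x\<close>; the limit in \<open>k\<close> exists almost everywhere.\<close>
  have h_meas: "?h i \<in> borel_measurable ?M" for i
  proof (rule measurable_lebesgue_on_AE_limit)
    show "\<Omega> \<in> sets lebesgue" using Om by (rule fmeasurableD)
    show "(\<lambda>x. sup_norm (\<lambda>y. s k x y - w i x y)) \<in> borel_measurable ?M" for k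
      by (intro borel_measurable_simple_function
          simple_function_compose1[OF simple_C_perD(1)[OF simple_C_per_diff[OF s w]]])
    show "AE x in ?M. (\<lambda>k. sup_norm (\<lambda>y. s k x y - w i x y)) \<longlonglongrightarrow> ?h i x"
      using lim AE_space
    proof eventually_elim
      case (elim x)
      then have x: "x \<in> \<Omega>" by simp
      have "\<bar>sup_norm (\<lambda>y. s k x y - w i x y) - ?h i x\<bar> \<le> sup_norm (\<lambda>y. s k x y - \<psi> x y)" for k
        using sup_norm_diff_abs[OF C_per_diff[OF simple_C_perD(2)[OF s x] simple_C_perD(2)[OF w x]]
            C_per_diff[OF C[OF x] simple_C_perD(2)[OF w x]], of k i i] by simp
      then show ?case
        by (intro LIM_zero_cancel[OF Lim_null_comparison[OF _ elim(1)]]) auto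
    qed
  qed
  have h_bd: "\<bar>?h i x\<bar> \<le> 3 * ?N x" if x: "x \<in> \<Omega>" for i x
  proof -
    have "sup_norm (w i x) \<le> 2 * ?N x" using sup_norm_nonneg[OF C[OF x]] by (simp add: w_def)
    then have "?h i x \<le> 3 * ?N x"
      using sup_norm_triangle_diff[OF C[OF x] simple_C_perD(2)[OF w x], of i] by simp
    then show ?thesis
      using sup_norm_nonneg[OF C_per_diff[OF C[OF x] simple_C_perD(2)[OF w x]], of i] by simp
  qed
  have h_L2: "?h i \<in> L2_space ?M" for i
    by (rule L2_space_bound(1)[OF L2_space_cmult[OF N, of 3] h_meas]) (use h_bd in simp)
  have h_lim: "AE x in ?M. (\<lambda>i. (?h i x)\<^sup>2) \<longlonglongrightarrow> 0"
    using lim AE_space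
  proof eventually_elim
    case (elim x)
    then have x: "x \<in> \<Omega>" by simp
    have ev: "\<forall>\<^sub>F i in sequentially. ?h i x \<le> sup_norm (\<lambda>y. s i x y - \<psi> x y)"
    \<comment> \<open>Where the norm of \<open>\<psi> x\<close> is 0 there is no strict inequality
      to use, but there the domination already forces the difference to have norm 0.\<close>
    proof (cases "?N x = 0")
      case True
      have "?h i x \<le> 0" for i using h_bd[OF x, of i] True by simp
      moreover have "0 \<le> sup_norm (\<lambda>y. s i x y - \<psi> x y)" for i
        by (rule sup_norm_nonneg[OF C_per_diff[OF simple_C_perD(2)[OF s x] C[OF x]]])
      ultimately show ?thesis by (intro always_eventually) (use order_trans in blast)
    next
      case False
      then have "?N x > 0" using sup_norm_nonneg[OF C[OF x]] by simp
      then have "\<forall>\<^sub>F i in sequentially. sup_norm (\<lambda>y. s i x y - \<psi> x y) < ?N x"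
        by (rule order_tendstoD(2)[OF elim(1)])
      then show ?thesis
      proof eventually_elim
        case (elim i)
        have "sup_norm (s i x) \<le> 2 * ?N x"
          using elim sup_norm_diff_abs[OF simple_C_perD(2)[OF s x] C[OF x], of i] by linarith
        then show ?case by (simp add: w_def sup_norm_uminus_commute[of "\<psi> x"])
      qed
    qed
    have "(\<lambda>i. ?h i x) \<longlonglongrightarrow> 0"
    proof (rule tendsto_sandwich[OF _ ev tendsto_const elim(1)])
      show "\<forall>\<^sub>F i in sequentially. 0 \<le> ?h i x"
        using sup_norm_nonneg[OF C_per_diff[OF C[OF x] simple_C_perD(2)[OF w x]]] by simp
    qed
    from tendsto_power[OF this, of 2] show ?case by simp
  qed
  have "(\<lambda>i. LINT x|?M. (?h i x)\<^sup>2) \<longlonglongrightarrow> (LINT x|?M. 0)"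
  proof (rule integral_dominated_convergence)
    show "integrable ?M (\<lambda>x. (3 * ?N x)\<^sup>2)" by (rule L2_spaceD(2)[OF L2_space_cmult[OF N]])
    show "AE x in ?M. norm ((?h i x)\<^sup>2) \<le> (3 * ?N x)\<^sup>2" for i
      using AE_space
    proof eventually_elim
      case (elim x)
      then have "\<bar>?h i x\<bar>\<^sup>2 \<le> (3 * ?N x)\<^sup>2" using h_bd[of x i] by (intro power_mono) auto
      then show ?case by simp
    qed
  qed (use h_meas h_lim in auto)
  then have "(\<lambda>i. L2_norm ?M (?h i)) \<longlonglongrightarrow> sqrt 0"
    unfolding L2_norm_def by (intro tendsto_real_sqrt) simp
  then have "\<forall>\<^sub>F i in sequentially. L2_norm ?M (?h i) < e"
    using e by (intro order_tendstoD) auto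
  then obtain i where "L2_norm ?M (?h i) < e" by (auto simp: eventually_sequentially)
  then show thesis using that[OF w h_L2, of i] by simp
qed

text \<open>A three-term estimate: \<open>b\<close> may change with \<open>e\<close>, but it has to
  be close to \<open>a\<close> for all \<open>j\<close> at once.\<close>

lemma convergent_of_approx:
  fixes a :: "nat \<Rightarrow> real"
  assumes "\<And>e. e > 0 \<Longrightarrow> \<exists>b. convergent b \<and> (\<forall>j. \<bar>a j - b j\<bar> \<le> e)"
  shows "convergent a"
proof (rule Cauchy_convergent, rule metric_CauchyI)
  fix e :: real assume e: "e > 0"
  obtain b where b: "convergent b" "\<And>j. \<bar>a j - b j\<bar> \<le> e / 4" using assms[of "e / 4"] e by auto
  obtain K where K: "\<And>m n. m \<ge> K \<Longrightarrow> n \<ge> K \<Longrightarrow> dist (b m) (b n) < e / 4"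
    using metric_CauchyD[OF convergent_Cauchy[OF b(1)], of "e / 4"] e by auto
  show "\<exists>K. \<forall>m\<ge>K. \<forall>n\<ge>K. dist (a m) (a n) < e"
  proof (intro exI allI impI)
    fix m n assume "K \<le> m" "K \<le> n"
    then show "dist (a m) (a n) < e"
      using K[of m n] b(2)[of m] b(2)[of n] e unfolding dist_real_def by linarith
  qed
qed

text \<open>Outer regularity encloses a measurable set in an open set of nearly the same measure,
  and finite unions of members of a countable basis exhaust the open set.\<close>

lemma countable_dense_sets:
  obtains \<F> :: "'a::euclidean_space set set" where "countable \<F>" "\<And>B. B \<in> \<F> \<Longrightarrow> open B"
    "\<And>A e. A \<in> lmeasurable \<Longrightarrow> e > 0 \<Longrightarrow>
       \<exists>B\<in>\<F>. B \<in> lmeasurable \<and> measure lebesgue ((A - B) \<union> (B - A)) \<le> e"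
proof -
  obtain \<B> :: "'a set set" where B: "countable \<B>" "topological_basis \<B>" using ex_countable_basis by blast
  define \<F> where "\<F> = Union ` {X. X \<subseteq> \<B> \<and> finite X}"
  show thesis
  proof
    show "countable \<F>" unfolding \<F>_def
      using countable_Collect_finite_subset[OF B(1)] by (intro countable_image) (simp add: conj_commute)
    show "open B" if "B \<in> \<F>" for B
      using that topological_basis_open[OF B(2)] by (auto simp: \<F>_def)
    fix A :: "'a set" and e :: real assume A: "A \<in> lmeasurable" and e: "e > 0"
    obtain V where V: "open V" "A \<subseteq> V" "V - A \<in> lmeasurable" "emeasure lebesgue (V - A) < ennreal (e / 2)"
      using sets_lebesgue_outer_open[OF fmeasurableD[OF A], of "e / 2"] e by auto
    have VA: "measure lebesgue (V - A) \<le> e / 2"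
      using V(4) e emeasure_eq_measure2[OF V(3)] by (simp add: ennreal_less_iff)
    have Vl: "V \<in> lmeasurable" using fmeasurable.Un[OF A V(3)] V(2) by (simp add: Un_absorb1)
    obtain X where X: "X \<subseteq> \<B>" "\<Union>X = V" using B(2) V(1) unfolding topological_basis_def by blast
    \<comment> \<open>With the empty set added, \<open>Y\<close> is the range of a sequence even if
      \<open>X\<close> is empty.\<close>
    define Y where "Y = insert {} X"
    have "countable Y" unfolding Y_def using X(1) B(1) countable_subset by blast
    then obtain c :: "nat \<Rightarrow> _" where c: "range c = Y"
      using range_from_nat_into[of Y] unfolding Y_def by blast
    let ?B = "\<lambda>n. \<Union>i<n. c i"
    have cB: "c i \<in> X \<or> c i = {}" for i using c unfolding Y_def by blast
    have sub: "?B n \<subseteq> V" for n using cB X(2) by blast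
    have op: "open (?B n)" for n
      using cB X(1) topological_basis_open[OF B(2)] by (intro open_UN ballI) (metis open_empty subsetD)
    have Bl: "?B n \<in> lmeasurable" for n
      using Vl sub op fmeasurableI2[of V lebesgue "?B n"] by simp
    have UV: "(\<Union>n. ?B n) = V"
    proof -
      have "(\<Union>n. ?B n) = \<Union>(range c)" by blast
      then show ?thesis using c X(2) by (simp add: Y_def)
    qed
    have "(\<lambda>n. measure lebesgue (?B n)) \<longlonglongrightarrow> measure lebesgue (\<Union>n. ?B n)"
    proof (rule Lim_measure_incseq)
      show "range ?B \<subseteq> sets lebesgue" using Bl fmeasurableD by blast
      show "incseq ?B" by (rule incseq_SucI) (auto simp: less_Suc_eq)
      show "emeasure lebesgue (\<Union>n. ?B n) \<noteq> \<infinity>" unfolding UV using fmeasurableD2[OF Vl] by simp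
    qed
    then have "\<forall>\<^sub>F n in sequentially. measure lebesgue V - e / 2 < measure lebesgue (?B n)"
      unfolding UV using e by (intro order_tendstoD) auto
    then obtain n where n: "measure lebesgue V - e / 2 < measure lebesgue (?B n)"
      by (auto simp: eventually_sequentially)
    have VB: "measure lebesgue (V - ?B n) < e / 2"
      using n measurable_measure_Diff[OF Vl fmeasurableD[OF Bl] sub, of n] by simp
    have "measure lebesgue ((A - ?B n) \<union> (?B n - A)) \<le> measure lebesgue ((V - ?B n) \<union> (V - A))"
      using V(2) sub[of n] Vl A Bl[of n]
      by (intro measure_mono_fmeasurable fmeasurable.Un fmeasurable.Diff) (auto dest: fmeasurableD)
    also have "\<dots> \<le> measure lebesgue (V - ?B n) + measure lebesgue (V - A)"
      using Vl A Bl[of n] by (intro measure_Un_le) (auto dest: fmeasurableD)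
    also have "\<dots> \<le> e" using VA VB by linarith
    finally have le: "measure lebesgue ((A - ?B n) \<union> (?B n - A)) \<le> e" .
    have "?B n = \<Union>((c ` {..<n}) \<inter> X)" using cB by blast
    then have "?B n \<in> \<F>" unfolding \<F>_def using X(1) by (intro image_eqI[of _ _ "(c ` {..<n}) \<inter> X"]) auto
    with le Bl show "\<exists>B\<in>\<F>. B \<in> lmeasurable \<and> measure lebesgue ((A - B) \<union> (B - A)) \<le> e" by blast
  qed
qed

section \<open>Extraction of a convergent subsequence\<close>

text \<open>\<open>U\<close> and \<open>\<tau>\<close> abstract from \<open>cubes\<close> and
  \<open>phase\<close>. The geometry of the covering is condensed into \<open>upper_bound\<close>,
  and what follows is functional analysis.\<close>

locale oscillation =
  fixes \<Omega> :: "(real ^ 'd) set" and U :: "nat \<Rightarrow> (real ^ 'd) set"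
    and \<tau> :: "nat \<Rightarrow> real ^ 'd \<Rightarrow> real ^ 'd" and v :: "nat \<Rightarrow> real ^ 'd \<Rightarrow> real" and C :: real
  assumes Om: "\<Omega> \<in> lmeasurable"
    and U_borel: "\<And>j. U j \<in> sets borel" and tau_borel: "\<And>j. \<tau> j \<in> borel_measurable borel"
    and upper_bound: "\<And>A g e. A \<in> sets lebesgue \<Longrightarrow> A \<subseteq> \<Omega> \<Longrightarrow> g \<in> C_per \<Longrightarrow> (\<And>y. 0 \<le> g y) \<Longrightarrow> 0 < e \<Longrightarrow>
      \<forall>\<^sub>F j in sequentially. (LINT x|lebesgue. indicator A x * (indicator (U j) x * g (\<tau> j x)))
        \<le> measure lebesgue A * cell_mean g + e"
    and v_L2: "\<And>j. v j \<in> L2_space (lebesgue_on \<Omega>)"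
    and v_bound: "\<And>j. L2_norm (lebesgue_on \<Omega>) (v j) \<le> C"
begin

abbreviation "M \<equiv> lebesgue_on \<Omega>"

interpretation M: finite_measure M
  by (rule finite_measure_lebesgue_on[OF Om])

definition osc :: "nat \<Rightarrow> (real ^ 'd \<Rightarrow> real ^ 'd \<Rightarrow> real) \<Rightarrow> real ^ 'd \<Rightarrow> real" where
  "osc j f x = indicator (U j) x * f x (\<tau> j x)"

definition pairing :: "nat \<Rightarrow> (real ^ 'd \<Rightarrow> real ^ 'd \<Rightarrow> real) \<Rightarrow> real" where
  "pairing j f = (LINT x|M. v j x * osc j f x)"

lemma C_nonneg: "0 \<le> C"
  using v_bound[of 0] L2_norm_nonneg order_trans by blast

lemma sets_M_iff: "A \<in> sets M \<longleftrightarrow> A \<in> sets lebesgue \<and> A \<subseteq> \<Omega>"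
  using fmeasurableD[OF Om] by (auto simp: sets_restrict_space_iff)

lemma measure_M: "A \<in> sets M \<Longrightarrow> measure M A = measure lebesgue A"
  using fmeasurableD[OF Om] by (simp add: sets_M_iff measure_restrict_space)

lemma integral_M_indicator:
  assumes "A \<in> sets M"
  shows "(LINT x|M. indicator A x * f x) = (LINT x|lebesgue. indicator A x * (f x :: real))"
proof -
  have "(LINT x|M. indicator A x * f x) = (LINT x|lebesgue. indicator \<Omega> x *\<^sub>R (indicator A x * f x))"
    by (rule integral_restrict_space) (use fmeasurableD[OF Om] in simp)
  also have "\<dots> = (LINT x|lebesgue. indicator A x * f x)"
    using assms by (intro Bochner_Integration.integral_cong) (auto simp: sets_M_iff indicator_def)
  finally show ?thesis .
qed

text \<open>A majorant that does not involve the oscillating variable bounds the oscillating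
  function uniformly in \<open>j\<close>, whatever \<open>\<tau> j\<close> is.\<close>

lemma osc_L2I:
  assumes "osc j f \<in> borel_measurable M" "h \<in> L2_space M" "\<And>x y. x \<in> \<Omega> \<Longrightarrow> \<bar>f x y\<bar> \<le> h x"
  shows "osc j f \<in> L2_space M" "L2_norm M (osc j f) \<le> L2_norm M h"
proof -
  have "\<bar>osc j f x\<bar> \<le> h x" if "x \<in> \<Omega>" for x
    using assms(3)[OF that, of "\<tau> j x"] by (auto simp: osc_def indicator_def)
  then show "osc j f \<in> L2_space M" "L2_norm M (osc j f) \<le> L2_norm M h"
    using L2_space_bound[OF assms(2,1)] by auto
qed

text \<open>Cauchy-Schwarz with the bound \<open>C\<close> gives stability uniform in
  \<open>j\<close>; both density arguments, for product functions and for general test functions,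
  rest on it.\<close>

lemma pairing_diff_le:
  assumes f: "osc j f \<in> L2_space M" and g: "osc j g \<in> L2_space M" and h: "h \<in> L2_space M"
    and le: "\<And>x y. x \<in> \<Omega> \<Longrightarrow> \<bar>f x y - g x y\<bar> \<le> h x"
  shows "\<bar>pairing j f - pairing j g\<bar> \<le> C * L2_norm M h"
proof -
  have eq: "osc j f x - osc j g x = osc j (\<lambda>x y. f x y - g x y) x" for x
    by (simp add: osc_def algebra_simps)
  have d: "osc j (\<lambda>x y. f x y - g x y) \<in> L2_space M"
    using L2_space_diff[OF f g] by (simp add: eq)
  have "pairing j f - pairing j g = (LINT x|M. v j x * osc j (\<lambda>x y. f x y - g x y) x)"
    unfolding pairing_def eq[symmetric] right_diff_distrib
    by (intro Bochner_Integration.integral_diff[symmetric] L2_mult_integrable v_L2 f g)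
  also have "\<bar>\<dots>\<bar> \<le> L2_norm M (v j) * L2_norm M (osc j (\<lambda>x y. f x y - g x y))"
    by (rule L2_Cauchy_Schwarz[OF v_L2 d])
  also have "\<dots> \<le> C * L2_norm M h"
    by (intro mult_mono v_bound osc_L2I(2)[OF L2_spaceD(1)[OF d] h] C_nonneg L2_norm_nonneg) (use le in auto)
  finally show ?thesis .
qed

lemma pairing_sum:
  assumes "finite I" "\<And>i. i \<in> I \<Longrightarrow> osc j (f i) \<in> L2_space M"
    and eq: "\<And>x y. x \<in> \<Omega> \<Longrightarrow> g x y = (\<Sum>i\<in>I. c i * f i x y)"
  shows "pairing j g = (\<Sum>i\<in>I. c i * pairing j (f i))" "osc j g \<in> borel_measurable M"
proof -
  have o: "osc j g x = (\<Sum>i\<in>I. c i * osc j (f i) x)" if "x \<in> \<Omega>" for x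
    using eq[OF that] by (simp add: osc_def sum_distrib_left mult_ac)
  have "pairing j g = (LINT x|M. (\<Sum>i\<in>I. c i * (v j x * osc j (f i) x)))"
    unfolding pairing_def
    by (intro Bochner_Integration.integral_cong refl) (simp add: o sum_distrib_left mult_ac)
  also have "\<dots> = (\<Sum>i\<in>I. c i * pairing j (f i))"
    unfolding pairing_def
    by (subst Bochner_Integration.integral_sum)
      (auto intro!: integrable_mult_right L2_mult_integrable v_L2 assms)
  finally show "pairing j g = (\<Sum>i\<in>I. c i * pairing j (f i))" .
  have "(\<lambda>x. \<Sum>i\<in>I. c i * osc j (f i) x) \<in> borel_measurable M"
    using L2_spaceD(1)[OF assms(2)] by (intro borel_measurable_sum borel_measurable_times) auto
  then show "osc j g \<in> borel_measurable M"
    by (rule measurable_cong[THEN iffD1, rotated]) (simp add: o)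
qed

lemma osc_product_L2:
  assumes A: "A \<in> sets M" and f: "f \<in> C_per"
  shows "osc j (\<lambda>x y. indicator A x * f y) \<in> L2_space M"
proof (rule osc_L2I)
  have "(\<lambda>x. indicator (U j) x * f (\<tau> j x)) \<in> borel_measurable borel"
    using U_borel measurable_compose[OF tau_borel C_per_borel_measurable[OF f]] by measurable
  from borel_measurable_lebesgue_on_borel[OF this]
  have "(\<lambda>x. indicator A x * (indicator (U j) x * f (\<tau> j x))) \<in> borel_measurable M"
    using A by measurable
  then show "osc j (\<lambda>x y. indicator A x * f y) \<in> borel_measurable M"
    by (simp add: osc_def[abs_def] mult_ac)
  show "(\<lambda>_. sup_norm f) \<in> L2_space M" by (simp add: L2_space_def)
  show "\<bar>indicator A x * f y\<bar> \<le> sup_norm f" for x y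
    using C_per_abs_le_sup_norm[OF f, of y] sup_norm_nonneg[OF f] by (auto simp: indicator_def)
qed

text \<open>In general discontinuous in \<open>y\<close>, hence outside \<open>simple_C_per\<close>.
  These functions serve the extraction of the subsequence: with \<open>B\<close> in a countable
  family and \<open>w\<close> a grid value there are countably many of them.\<close>

definition step :: "(real ^ 'd) set \<Rightarrow> nat \<Rightarrow> real ^ 'd \<Rightarrow> real ^ 'd \<Rightarrow> real ^ 'd \<Rightarrow> real" where
  "step B m w x y = indicator B x * (if quantize m y = w then 1 else 0)"

lemma osc_step_L2:
  assumes B: "B \<in> sets borel"
  shows "osc j (step B m w) \<in> L2_space M" "L2_norm M (osc j (step B m w)) \<le> L2_norm M (\<lambda>_. 1)"
proof -
  have "{x \<in> space borel. quantize m (\<tau> j x) = w} \<in> sets borel"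
    by (rule measurable_quantize_eq[OF tau_borel])
  then have "osc j (step B m w) \<in> borel_measurable borel"
    unfolding osc_def[abs_def] step_def using B U_borel by measurable
  then have *: "osc j (step B m w) \<in> borel_measurable M"
    by (rule borel_measurable_lebesgue_on_borel)
  show "osc j (step B m w) \<in> L2_space M" "L2_norm M (osc j (step B m w)) \<le> L2_norm M (\<lambda>_. 1)"
    by (rule osc_L2I[OF *]; auto simp: L2_space_def step_def indicator_def)+
qed

lemma pairing_le:
  assumes "osc j f \<in> L2_space M"
  shows "\<bar>pairing j f\<bar> \<le> C * L2_norm M (osc j f)"
  unfolding pairing_def
  using L2_Cauchy_Schwarz[OF v_L2 assms, of j] v_bound[of j]
  by (meson L2_norm_nonneg mult_right_mono order_trans)

lemma simple_level_sets:
  assumes "s \<in> simple_C_per \<Omega>"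
  shows "finite (s ` \<Omega>)" "s -` {f} \<inter> \<Omega> \<in> sets M" "f \<in> s ` \<Omega> \<Longrightarrow> f \<in> C_per"
  using simple_functionD[OF simple_C_perD(1)[OF assms]] simple_C_perD(2)[OF assms] by auto

lemma pairing_simple:
  assumes s: "s \<in> simple_C_per \<Omega>"
  shows "pairing j s = (\<Sum>f\<in>s ` \<Omega>. pairing j (\<lambda>x y. indicator (s -` {f} \<inter> \<Omega>) x * f y))"
    "osc j s \<in> borel_measurable M"
proof -
  note l = simple_level_sets[OF s]
  have "s x y = (\<Sum>f\<in>s ` \<Omega>. 1 * (indicator (s -` {f} \<inter> \<Omega>) x * f y))" if "x \<in> \<Omega>" for x y
    using simple_function_decompose[OF simple_C_perD(1)[OF s], of x "\<lambda>f _. f y"] that by simp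
  from pairing_sum[where f = "\<lambda>f x y. indicator (s -` {f} \<inter> \<Omega>) x * f y", OF l(1) osc_product_L2[OF l(2,3)] this]
  show "pairing j s = (\<Sum>f\<in>s ` \<Omega>. pairing j (\<lambda>x y. indicator (s -` {f} \<inter> \<Omega>) x * f y))"
    "osc j s \<in> borel_measurable M"
    by simp_all
qed

lemma simple_sup_norm_L2:
  assumes s: "s \<in> simple_C_per \<Omega>"
  shows "(\<lambda>x. sup_norm (s x)) \<in> L2_space M"
  by (rule M.simple_function_L2_space[OF simple_function_compose1[OF simple_C_perD(1)[OF s]]])

lemma osc_simple_L2:
  assumes s: "s \<in> simple_C_per \<Omega>"
  shows "osc j s \<in> L2_space M"
  by (rule osc_L2I(1)[OF pairing_simple(2)[OF s] simple_sup_norm_L2[OF s]])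
    (use simple_C_perD(2)[OF s] C_per_abs_le_sup_norm in blast)

text \<open>Replacing \<open>A\<close> by a set \<open>B\<close> of the countable family and
  \<open>f\<close> by its values at grid corners gives a finite combination of \<open>step\<close>
  functions. The error is small on \<open>A \<inter> B\<close> and merely bounded on the symmetric
  difference, which is small in measure.\<close>

lemma pairing_product_convergent:
  assumes dense: "\<And>A e. A \<in> lmeasurable \<Longrightarrow> e > 0 \<Longrightarrow>
       \<exists>B\<in>\<F>. B \<in> lmeasurable \<and> measure lebesgue ((A - B) \<union> (B - A)) \<le> e"
    and op: "\<And>B. B \<in> \<F> \<Longrightarrow> open B"
    and conv: "\<And>B m w. B \<in> \<F> \<Longrightarrow> w \<in> range (quantize m) \<Longrightarrow> convergent (\<lambda>j. pairing (\<phi> j) (step B m w))"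
    and A: "A \<in> sets M" and f: "f \<in> C_per"
  shows "convergent (\<lambda>j. pairing (\<phi> j) (\<lambda>x y. indicator A x * f y))"
proof (rule convergent_of_approx)
  fix e :: real assume e: "e > 0"
  define G where "G = sup_norm f"
  have G: "0 \<le> G" "\<And>y. \<bar>f y\<bar> \<le> G"
    unfolding G_def using sup_norm_nonneg[OF f] C_per_abs_le_sup_norm[OF f] by auto
  define K where "K = L2_norm M (\<lambda>_. 1)"
  have K: "0 \<le> K" by (simp add: K_def)
  have cancel: "e / (2 * X) * X = e / 2" if "X > 0" for X :: real using that by simp
  \<comment> \<open>\<open>e1\<close> will bound the rounding error of \<open>f\<close> and
    \<open>e2\<close> the norm of the indicator of the symmetric difference. Their contributions
    \<open>e1 * K\<close> and \<open>G * e2\<close>, multiplied by \<open>C\<close>, may use half of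
    \<open>e\<close> each.\<close>
  define e1 where "e1 = e / (2 * ((C + 1) * (K + 1)))"
  have e1: "e1 > 0" "C * (e1 * K) \<le> e / 2"
  proof -
    show "e1 > 0" unfolding e1_def using e C_nonneg K by simp
    have "C * K \<le> (C + 1) * (K + 1)" using C_nonneg K by (intro mult_mono) auto
    then have "e1 * (C * K) \<le> e1 * ((C + 1) * (K + 1))" using \<open>e1 > 0\<close> by (intro mult_left_mono) auto
    also have "\<dots> = e / 2" unfolding e1_def using C_nonneg K by (intro cancel) auto
    finally show "C * (e1 * K) \<le> e / 2" by (simp add: mult_ac)
  qed
  define e2 where "e2 = e / (2 * ((C + 1) * (G + 1)))"
  have e2: "e2 > 0" "C * (G * e2) \<le> e / 2"
  proof -
    show "e2 > 0" unfolding e2_def using e C_nonneg G(1) by simp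
    have "C * G \<le> (C + 1) * (G + 1)" using C_nonneg G(1) by (intro mult_mono) auto
    then have "e2 * (C * G) \<le> e2 * ((C + 1) * (G + 1))" using \<open>e2 > 0\<close> by (intro mult_left_mono) auto
    also have "\<dots> = e / 2" unfolding e2_def using C_nonneg G(1) by (intro cancel) auto
    finally show "C * (G * e2) \<le> e / 2" by (simp add: mult_ac)
  qed
  have Al: "A \<in> lmeasurable"
    using A Om fmeasurableI2[of \<Omega> lebesgue A] by (simp add: sets_M_iff)
  \<comment> \<open>The norm of an indicator is the root of the measure of its set, hence the square
    of \<open>e2\<close>.\<close>
  obtain B where B: "B \<in> \<F>" "B \<in> lmeasurable" "measure lebesgue ((A - B) \<union> (B - A)) \<le> e2\<^sup>2"
    using dense[OF Al, of "e2\<^sup>2"] e2(1) by auto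
  have Bb: "B \<in> sets borel" using op[OF B(1)] by (rule borel_open)
  obtain m where m: "\<And>y. \<bar>f y - f (quantize m y)\<bar> \<le> e1" using C_per_step_approx[OF f e1(1)] by blast
  define b where "b = (\<lambda>x y. indicator B x * f (quantize m y))"
  have b_eq: "b x y = (\<Sum>w\<in>range (quantize m). f w * step B m w x y)" for x y
  proof -
    have "(\<Sum>w\<in>range (quantize m). f w * step B m w x y) =
        (\<Sum>w\<in>range (quantize m). if w = quantize m y then indicator B x * f w else 0)"
      by (intro sum.cong) (auto simp: step_def)
    then show ?thesis by (simp add: b_def finite_range_quantize)
  qed
  note bs = pairing_sum[OF finite_range_quantize osc_step_L2(1)[OF Bb] b_eq]
  have osc_b: "osc j b \<in> L2_space M" for j
    by (rule osc_L2I(1)[OF bs(2), of "\<lambda>_. G"]) (use G in \<open>auto simp: b_def indicator_def L2_space_def\<close>)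
  have "convergent (\<lambda>j. pairing (\<phi> j) b)"
    unfolding bs(1) using conv[OF B(1)] by (intro convergent_sum convergent_mult convergent_const)
  moreover have "\<bar>pairing (\<phi> j) (\<lambda>x y. indicator A x * f y) - pairing (\<phi> j) b\<bar> \<le> e" for j
  proof -
    let ?S = "(A - B) \<union> (B - A)"
    let ?h = "\<lambda>x. G * indicator ?S x + e1 * 1"
    have Sl: "?S \<in> lmeasurable" using Al B(2) by blast
    have ind: "indicator ?S \<in> L2_space M" "L2_norm M (indicator ?S) \<le> e2"
    proof -
      have [measurable]: "indicator ?S \<in> borel_measurable M"
        using fmeasurableD[OF Sl] by (intro measurable_restrict_space1) simp
      show "indicator ?S \<in> L2_space M"
        by (rule M.L2_space_bounded[of _ 1]) auto
      have "(L2_norm M (indicator ?S))\<^sup>2 = (LINT x|M. indicator (?S \<inter> \<Omega>) x * 1)"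
        unfolding L2_norm_power2 by (intro Bochner_Integration.integral_cong) (auto simp: indicator_def)
      also have "\<dots> = measure lebesgue (?S \<inter> \<Omega>)"
        using fmeasurableD[OF Sl] fmeasurableD[OF Om]
        by (subst integral_M_indicator) (auto simp: sets_M_iff)
      also have "\<dots> \<le> measure lebesgue ?S"
        using Sl Om by (intro measure_mono_fmeasurable) (auto dest: fmeasurableD)
      also have "\<dots> \<le> e2\<^sup>2" by (rule B(3))
      finally show "L2_norm M (indicator ?S) \<le> e2" by (rule power2_le_imp_le) (use e2 in simp)
    qed
    have one: "(\<lambda>_. 1) \<in> L2_space M" by (simp add: L2_space_def)
    have h: "?h \<in> L2_space M" by (rule L2_space_add[OF L2_space_cmult[OF ind(1)] L2_space_cmult[OF one]])
    have "\<bar>pairing (\<phi> j) (\<lambda>x y. indicator A x * f y) - pairing (\<phi> j) b\<bar> \<le> C * L2_norm M ?h"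
    proof (rule pairing_diff_le[OF osc_product_L2[OF A f] osc_b h])
      fix x y
      show "\<bar>indicator A x * f y - b x y\<bar> \<le> ?h x"
        using m[of y] G(1) G(2)[of y] G(2)[of "quantize m y"] e1(1) by (auto simp: b_def indicator_def)
    qed
    also have "L2_norm M ?h \<le> G * e2 + e1 * K"
    proof -
      have "L2_norm M ?h \<le> L2_norm M (\<lambda>x. G * indicator ?S x) + L2_norm M (\<lambda>x. e1 * 1)"
        by (rule L2_norm_triangle[OF L2_space_cmult[OF ind(1)] L2_space_cmult[OF one]])
      also have "\<dots> = G * L2_norm M (indicator ?S) + e1 * K"
        unfolding L2_norm_cmult K_def using G(1) e1(1) by simp
      also have "\<dots> \<le> G * e2 + e1 * K"
        using ind(2) G(1) by (intro add_right_mono mult_left_mono)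
      finally show ?thesis .
    qed
    finally have "\<bar>pairing (\<phi> j) (\<lambda>x y. indicator A x * f y) - pairing (\<phi> j) b\<bar> \<le> C * (G * e2 + e1 * K)"
      using C_nonneg mult_left_mono by blast
    also have "\<dots> = C * (G * e2) + C * (e1 * K)" by (simp add: algebra_simps)
    also have "\<dots> \<le> e" using e1(2) e2(2) by linarith
    finally show ?thesis .
  qed
  ultimately show "\<exists>b. convergent b \<and> (\<forall>j. \<bar>pairing (\<phi> j) (\<lambda>x y. indicator A x * f y) - b j\<bar> \<le> e)"
    by blast
qed

lemma convergent_subsequence:
  obtains \<phi> :: "nat \<Rightarrow> nat" where "strict_mono \<phi>"
    "\<And>s. s \<in> simple_C_per \<Omega> \<Longrightarrow> convergent (\<lambda>j. pairing (\<phi> j) s)"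
proof -
  obtain \<F> :: "(real ^ 'd) set set" where F: "countable \<F>" "\<And>B. B \<in> \<F> \<Longrightarrow> open B"
    "\<And>A e. A \<in> lmeasurable \<Longrightarrow> e > 0 \<Longrightarrow>
       \<exists>B\<in>\<F>. B \<in> lmeasurable \<and> measure lebesgue ((A - B) \<union> (B - A)) \<le> e"
    using countable_dense_sets by blast
  define I where "I = \<F> \<times> (SIGMA m : UNIV. range (quantize m :: real ^ 'd \<Rightarrow> real ^ 'd))"
  have cI: "countable I"
    unfolding I_def using F(1) finite_range_quantize
    by (intro countable_SIGMA) (auto intro: countable_finite)
  let ?f = "\<lambda>j (B, m, w). pairing j (step B m w)"
  \<comment> \<open>The functions \<open>step\<close> take the values 0 and 1, whence a bound
    independent of the index, as the diagonal argument requires.\<close>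
  have bd: "norm (?f j i) \<le> C * L2_norm M (\<lambda>_. 1)" if "i \<in> I" for j i
  proof -
    obtain B m w where i: "i = (B, m, w)" by (cases i)
    then have "B \<in> sets borel" using that F(2) by (auto simp: I_def)
    from osc_step_L2[OF this] have "\<bar>pairing j (step B m w)\<bar> \<le> C * L2_norm M (\<lambda>_. 1)"
      using pairing_le C_nonneg by (meson mult_left_mono order_trans)
    then show ?thesis by (simp add: i)
  qed
  obtain \<phi> :: "nat \<Rightarrow> nat" where phi: "strict_mono \<phi>"
    "\<And>i. i \<in> I \<Longrightarrow> \<exists>l. (\<lambda>n. ?f (\<phi> n) i) \<longlonglongrightarrow> l"
    using function_convergent_subsequence[of I ?f, OF cI bd] by blast
  have conv: "convergent (\<lambda>j. pairing (\<phi> j) (step B m w))" if "B \<in> \<F>" "w \<in> range (quantize m)" for B m w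
    using phi(2)[of "(B, m, w)"] that by (auto simp: I_def convergent_def)
  show thesis
  proof (rule that[OF phi(1)])
    fix s assume s: "s \<in> simple_C_per \<Omega>"
    show "convergent (\<lambda>j. pairing (\<phi> j) s)"
      unfolding pairing_simple(1)[OF s] using simple_level_sets[OF s]
      by (intro convergent_sum pairing_product_convergent[OF F(3) F(2) conv]) auto
  qed
qed

section \<open>Bounds in the norm of L^2(\<Omega>; L^2(Y))\<close>

definition inner2 :: "(real ^ 'd \<Rightarrow> real ^ 'd \<Rightarrow> real) \<Rightarrow> (real ^ 'd \<Rightarrow> real ^ 'd \<Rightarrow> real) \<Rightarrow> real" where
  "inner2 s t = (LINT x|M. cell_mean (\<lambda>y. s x y * t x y))"

text \<open>On each of the finitely many level sets the squared value is a fixed nonnegative element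
  of \<open>C_per\<close>, so \<open>upper_bound\<close> applies to it.\<close>

lemma osc_simple_upper_bound:
  assumes s: "s \<in> simple_C_per \<Omega>" and e: "e > 0"
  shows "\<forall>\<^sub>F j in sequentially. (L2_norm M (osc j s))\<^sup>2 \<le> inner2 s s + e"
proof -
  note l = simple_level_sets[OF s]
  let ?A = "\<lambda>f. s -` {f} \<inter> \<Omega>"
  \<comment> \<open>The error is shared among the level sets; the added 1 covers the case that there
    are none.\<close>
  let ?e = "e / (real (card (s ` \<Omega>)) + 1)"
  have e': "?e > 0" using e by (intro divide_pos_pos) auto
  have sq: "f \<in> s ` \<Omega> \<Longrightarrow> (\<lambda>y. (f y)\<^sup>2) \<in> C_per" for f
    using C_per_mult[OF l(3) l(3)] by (simp add: power2_eq_square)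
  let ?I = "\<lambda>j f. LINT x|lebesgue. indicator (?A f) x * (indicator (U j) x * (f (\<tau> j x))\<^sup>2)"
  have "\<forall>\<^sub>F j in sequentially. \<forall>f\<in>s ` \<Omega>. ?I j f \<le> measure lebesgue (?A f) * cell_mean (\<lambda>y. (f y)\<^sup>2) + ?e"
  proof (intro eventually_ball_finite[OF l(1)] ballI)
    fix f assume f: "f \<in> s ` \<Omega>"
    show "\<forall>\<^sub>F j in sequentially. ?I j f \<le> measure lebesgue (?A f) * cell_mean (\<lambda>y. (f y)\<^sup>2) + ?e"
      by (rule upper_bound) (use l(2)[of f] sq[OF f] e' in \<open>auto simp: sets_M_iff\<close>)
  qed
  then show ?thesis
  proof eventually_elim
    case (elim j)
    have "(L2_norm M (osc j s))\<^sup>2 = (LINT x|M. (\<Sum>f\<in>s ` \<Omega>. indicator (?A f) x * (indicator (U j) x * (f (\<tau> j x))\<^sup>2)))"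
      unfolding L2_norm_power2
    proof (intro Bochner_Integration.integral_cong refl)
      fix x assume "x \<in> space M"
      from simple_function_decompose[OF simple_C_perD(1)[OF s] this, of "\<lambda>f x. indicator (U j) x * (f (\<tau> j x))\<^sup>2"]
      moreover have "(indicator (U j) x)\<^sup>2 = (indicator (U j) x :: real)" by (simp add: indicator_def)
      ultimately show "(osc j s x)\<^sup>2 = (\<Sum>f\<in>s ` \<Omega>. indicator (?A f) x * (indicator (U j) x * (f (\<tau> j x))\<^sup>2))"
        by (simp add: osc_def power_mult_distrib)
    qed
    also have "\<dots> = (\<Sum>f\<in>s ` \<Omega>. LINT x|M. indicator (?A f) x * (indicator (U j) x * (f (\<tau> j x))\<^sup>2))"
    proof (rule Bochner_Integration.integral_sum)
      fix f assume f: "f \<in> s ` \<Omega>"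
      have "integrable M (osc j (\<lambda>x y. indicator (?A f) x * (f y)\<^sup>2))"
        by (rule M.L2_space_integrable(1)[OF osc_product_L2[OF l(2) sq[OF f]]])
      then show "integrable M (\<lambda>x. indicator (?A f) x * (indicator (U j) x * (f (\<tau> j x))\<^sup>2))"
        by (simp add: osc_def[abs_def] mult_ac)
    qed
    also have "\<dots> = (\<Sum>f\<in>s ` \<Omega>. ?I j f)"
      by (intro sum.cong refl integral_M_indicator l(2))
    also have "\<dots> \<le> (\<Sum>f\<in>s ` \<Omega>. measure lebesgue (?A f) * cell_mean (\<lambda>y. (f y)\<^sup>2) + ?e)"
      using elim by (intro sum_mono) blast
    also have "\<dots> = (\<Sum>f\<in>s ` \<Omega>. measure lebesgue (?A f) * cell_mean (\<lambda>y. (f y)\<^sup>2)) + real (card (s ` \<Omega>)) * ?e"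
      by (simp add: sum.distrib)
    also have "(\<Sum>f\<in>s ` \<Omega>. measure lebesgue (?A f) * cell_mean (\<lambda>y. (f y)\<^sup>2)) = inner2 s s"
    proof -
      have "inner2 s s = (LINT x|M. (\<Sum>f\<in>s ` \<Omega>. indicator (?A f) x * cell_mean (\<lambda>y. (f y)\<^sup>2)))"
        unfolding inner2_def
      proof (intro Bochner_Integration.integral_cong refl)
        fix x assume "x \<in> space M"
        from simple_function_decompose[OF simple_C_perD(1)[OF s] this, of "\<lambda>f x. cell_mean (\<lambda>y. (f y)\<^sup>2)"]
        show "cell_mean (\<lambda>y. s x y * s x y) = (\<Sum>f\<in>s ` \<Omega>. indicator (?A f) x * cell_mean (\<lambda>y. (f y)\<^sup>2))"
          by (simp add: power2_eq_square)
      qed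
      also have "\<dots> = (\<Sum>f\<in>s ` \<Omega>. LINT x|M. indicator (?A f) x * cell_mean (\<lambda>y. (f y)\<^sup>2))"
        by (rule Bochner_Integration.integral_sum)
          (use l(2) in \<open>auto intro!: integrable_mult_left integrable_real_indicator simp: M.emeasure_finite less_top[symmetric]\<close>)
      also have "\<dots> = (\<Sum>f\<in>s ` \<Omega>. measure lebesgue (?A f) * cell_mean (\<lambda>y. (f y)\<^sup>2))"
      proof (intro sum.cong refl)
        fix f
        have "?A f \<inter> space M = ?A f" by auto
        then show "(LINT x|M. indicator (?A f) x * cell_mean (\<lambda>y. (f y)\<^sup>2)) =
            measure lebesgue (?A f) * cell_mean (\<lambda>y. (f y)\<^sup>2)"
          using measure_M[OF l(2)[of f]] by simp
      qed
      finally show ?thesis by simp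
    qed
    also have "inner2 s s + real (card (s ` \<Omega>)) * ?e \<le> inner2 s s + e"
      using e by (simp add: field_simps)
    finally show ?case .
  qed
qed

end

section \<open>Identification of the limit\<close>

lemma le_of_all_pow_half:
  fixes a K :: real
  assumes "\<And>n. a \<le> K * (1 / 2) ^ n"
  shows "a \<le> 0"
proof (rule LIMSEQ_le_const)
  have "(\<lambda>n. K * (1 / 2) ^ n) \<longlonglongrightarrow> K * 0"
    by (intro tendsto_intros LIMSEQ_realpow_zero) auto
  then show "(\<lambda>n. K * (1 / 2) ^ n) \<longlonglongrightarrow> 0" by simp
qed (use assms in blast)

context oscillation
begin

interpretation M: finite_measure M
  by (rule finite_measure_lebesgue_on[OF Om])

interpretation Y: finite_measure "lebesgue_on unit_cell :: (real ^ 'd) measure"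
  by (rule finite_measure_unit_cell)

abbreviation cell_L2 :: "(real ^ 'd \<Rightarrow> real) set" where
  "cell_L2 \<equiv> L2_space (lebesgue_on unit_cell)"

abbreviation cell_norm :: "(real ^ 'd \<Rightarrow> real) \<Rightarrow> real" where
  "cell_norm \<equiv> L2_norm (lebesgue_on unit_cell)"

definition norm2 :: "(real ^ 'd \<Rightarrow> real ^ 'd \<Rightarrow> real) \<Rightarrow> real" where
  "norm2 s = L2_norm M (\<lambda>x. cell_norm (s x))"

lemma simple_cell_L2: "s \<in> simple_C_per \<Omega> \<Longrightarrow> x \<in> \<Omega> \<Longrightarrow> s x \<in> cell_L2"
  by (rule C_per_L2_space[OF simple_C_perD(2)])

lemma simple_cell_norm_L2: "s \<in> simple_C_per \<Omega> \<Longrightarrow> (\<lambda>x. cell_norm (s x)) \<in> L2_space M"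
  by (rule M.simple_function_L2_space[OF simple_function_compose1[OF simple_C_perD(1)]])

lemma simple_inner_integrable:
  assumes "s \<in> simple_C_per \<Omega>" "t \<in> simple_C_per \<Omega>"
  shows "integrable M (\<lambda>x. cell_mean (\<lambda>y. s x y * t x y))"
proof -
  have "simple_function M (\<lambda>x. (\<lambda>f g. cell_mean (\<lambda>y. f y * g y)) (s x) (t x))"
    by (rule simple_function_compose2[OF simple_C_perD(1)[OF assms(1)] simple_C_perD(1)[OF assms(2)]])
  from M.simple_function_integrable[OF this] show ?thesis by simp
qed

lemma inner2_comb:
  assumes s: "s \<in> simple_C_per \<Omega>" and t: "t \<in> simple_C_per \<Omega>" and w: "w \<in> simple_C_per \<Omega>"
  shows "inner2 (\<lambda>x y. s x y + c * t x y) w = inner2 s w + c * inner2 t w"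
proof -
  have "cell_mean (\<lambda>y. (s x y + c * t x y) * w x y) =
      cell_mean (\<lambda>y. s x y * w x y) + c * cell_mean (\<lambda>y. t x y * w x y)" if x: "x \<in> \<Omega>" for x
  proof -
    note i = L2_mult_integrable[OF simple_cell_L2[OF _ x] simple_cell_L2[OF w x]]
    show ?thesis using i[OF s] i[OF t] by (simp add: distrib_right mult.assoc)
  qed
  then have "inner2 (\<lambda>x y. s x y + c * t x y) w =
      (LINT x|M. cell_mean (\<lambda>y. s x y * w x y) + c * cell_mean (\<lambda>y. t x y * w x y))"
    unfolding inner2_def by (intro Bochner_Integration.integral_cong) auto
  then show ?thesis
    using simple_inner_integrable[OF s w] simple_inner_integrable[OF t w] by (simp add: inner2_def)
qed

lemma inner2_commute: "inner2 s t = inner2 t s"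
  by (simp add: inner2_def mult.commute)

lemma inner2_self: "inner2 s s = (norm2 s)\<^sup>2"
  by (simp add: inner2_def norm2_def L2_norm_power2 power2_eq_square[symmetric])

lemma norm2_nonneg: "0 \<le> norm2 s"
  by (simp add: norm2_def)

lemma pairing_comb:
  assumes s: "s \<in> simple_C_per \<Omega>" and t: "t \<in> simple_C_per \<Omega>"
  shows "pairing j (\<lambda>x y. s x y + c * t x y) = pairing j s + c * pairing j t"
proof -
  note i = L2_mult_integrable[OF v_L2 osc_simple_L2]
  have "v j x * osc j (\<lambda>x y. s x y + c * t x y) x = v j x * osc j s x + c * (v j x * osc j t x)" for x
    by (simp add: osc_def algebra_simps)
  then show ?thesis using i[OF s] i[OF t] by (simp add: pairing_def)
qed

text \<open>At each \<open>j\<close>, Cauchy-Schwarz gives the norm of the oscillating function,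
  whose square is eventually below \<open>(norm2 s)\<^sup>2 + e\<close>. The norm on the product
  thus appears in the limit, after which \<open>e\<close> tends to 0.\<close>

lemma pairing_limit_bound:
  assumes phi: "strict_mono \<phi>" and s: "s \<in> simple_C_per \<Omega>"
    and lim: "(\<lambda>j. pairing (\<phi> j) s) \<longlonglongrightarrow> l"
  shows "\<bar>l\<bar> \<le> C * norm2 s"
proof -
  have le: "\<bar>l\<bar> \<le> C * sqrt ((norm2 s)\<^sup>2 + e)" if e: "e > 0" for e
  proof (rule tendsto_upperbound[OF tendsto_rabs[OF lim]])
    have "\<forall>\<^sub>F j in sequentially. (L2_norm M (osc (\<phi> j) s))\<^sup>2 \<le> (norm2 s)\<^sup>2 + e"
      using eventually_subseq[OF phi osc_simple_upper_bound[OF s e]] by (simp add: inner2_self)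
    then show "\<forall>\<^sub>F j in sequentially. \<bar>pairing (\<phi> j) s\<bar> \<le> C * sqrt ((norm2 s)\<^sup>2 + e)"
    proof eventually_elim
      case (elim j)
      then have "L2_norm M (osc (\<phi> j) s) \<le> sqrt ((norm2 s)\<^sup>2 + e)" by (rule real_le_rsqrt)
      then show ?case
        using pairing_le[OF osc_simple_L2[OF s], of "\<phi> j"] C_nonneg by (meson mult_left_mono order_trans)
    qed
  qed simp
  have "(\<lambda>n. C * sqrt ((norm2 s)\<^sup>2 + inverse (real (Suc n)))) \<longlonglongrightarrow> C * sqrt ((norm2 s)\<^sup>2 + 0)"
    by (intro tendsto_intros LIMSEQ_inverse_real_of_nat)
  then have "\<bar>l\<bar> \<le> C * sqrt ((norm2 s)\<^sup>2 + 0)"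
    by (rule LIMSEQ_le_const) (use le in auto)
  then show ?thesis using norm2_nonneg by simp
qed

lemma cell_mean_mult_le:
  assumes "f \<in> cell_L2" "g \<in> cell_L2" "h \<in> cell_L2"
  shows "\<bar>cell_mean (\<lambda>y. f y * h y) - cell_mean (\<lambda>y. g y * h y)\<bar> \<le> cell_norm (\<lambda>y. f y - g y) * cell_norm h"
proof -
  have "cell_mean (\<lambda>y. f y * h y) - cell_mean (\<lambda>y. g y * h y) = cell_mean (\<lambda>y. (f y - g y) * h y)"
    using L2_mult_integrable[OF assms(1,3)] L2_mult_integrable[OF assms(2,3)]
    by (simp add: left_diff_distrib)
  then show ?thesis using L2_Cauchy_Schwarz[OF L2_space_diff[OF assms(1,2)] assms(3)] by simp
qed

lemma two_scale_limit:
  assumes phi: "strict_mono \<phi>" and conv: "\<And>s. s \<in> simple_C_per \<Omega> \<Longrightarrow> convergent (\<lambda>j. pairing (\<phi> j) s)"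
  obtains u where "u \<in> L2_L2 \<Omega>"
    "\<And>\<psi>. \<psi> \<in> L2_C_per \<Omega> \<Longrightarrow>
      (\<lambda>j. pairing (\<phi> j) \<psi>) \<longlonglongrightarrow> (LINT x|M. cell_mean (\<lambda>y. u x y * \<psi> x y))"
proof -
  have Oms: "\<Omega> \<in> sets lebesgue" by (rule fmeasurableD[OF Om])
  define F where "F s = lim (\<lambda>j. pairing (\<phi> j) s)" for s
  have F: "(\<lambda>j. pairing (\<phi> j) s) \<longlonglongrightarrow> F s" if "s \<in> simple_C_per \<Omega>" for s
    using conv[OF that] by (simp add: F_def convergent_LIMSEQ_iff)
  have F_bound: "\<bar>F s\<bar> \<le> C * norm2 s" if "s \<in> simple_C_per \<Omega>" for s
    by (rule pairing_limit_bound[OF phi that F[OF that]])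
  have F_comb: "F (\<lambda>x y. s x y + c * t x y) = F s + c * F t"
    if "s \<in> simple_C_per \<Omega>" "t \<in> simple_C_per \<Omega>" for s t c
  proof (rule LIMSEQ_unique[OF F[OF simple_C_per_comb[OF that]]])
    show "(\<lambda>j. pairing (\<phi> j) (\<lambda>x y. s x y + c * t x y)) \<longlonglongrightarrow> F s + c * F t"
      unfolding pairing_comb[OF that] using F that by (intro tendsto_intros) auto
  qed
  have sq: "sqrt (inner2 s s) = norm2 s" for s by (simp add: inner2_self norm2_nonneg)
  have "\<exists>V. V \<in> simple_C_per \<Omega> \<and> (\<forall>w\<in>simple_C_per \<Omega>. \<bar>inner2 V w - F w\<bar> \<le> (1 / 2) ^ n * norm2 w)" for n :: nat
  proof (rule approximate_Riesz[where S = "simple_C_per \<Omega>" and b = inner2 and F = F and K = C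
        and e = "(1 / 2) ^ n" and comb = "\<lambda>s c t x y. s x y + c * t x y"])
    show "simple_C_per \<Omega> \<noteq> {}" using simple_C_per_zero by blast
    show "inner2 s t = inner2 t s" for s t by (rule inner2_commute)
    show "0 \<le> inner2 s s" for s by (simp add: inner2_self)
    show "\<bar>F s\<bar> \<le> C * sqrt (inner2 s s)" if "s \<in> simple_C_per \<Omega>" for s
      using F_bound[OF that] by (simp add: sq)
  qed (auto intro: simple_C_per_comb F_comb inner2_comb simp: sq)
  then obtain V where V: "\<And>n. V n \<in> simple_C_per \<Omega>"
    and VF: "\<And>n w. w \<in> simple_C_per \<Omega> \<Longrightarrow> \<bar>inner2 (V n) w - F w\<bar> \<le> (1 / 2) ^ n * norm2 w"
    by metis
  have cancel: "norm2 w \<le> c" if "(norm2 w)\<^sup>2 \<le> c * norm2 w" "0 \<le> c" for w c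
    using that norm2_nonneg[of w] by (cases "norm2 w = 0") (auto simp: power2_eq_square)
  \<comment> \<open>Both functions nearly represent \<open>F\<close>; when their difference is
    tested against itself, the values of \<open>F\<close> cancel and only the two errors
    remain.\<close>
  have V_diff: "norm2 (\<lambda>x y. V n x y - V m x y) \<le> (1 / 2) ^ n + (1 / 2) ^ m" for n m
  proof (rule cancel)
    let ?w = "\<lambda>x y. V n x y - V m x y"
    have w: "?w \<in> simple_C_per \<Omega>" by (rule simple_C_per_diff[OF V V])
    have "(norm2 ?w)\<^sup>2 = inner2 (V n) ?w - inner2 (V m) ?w"
      using inner2_comb[OF V V w, of n "-1" m] by (simp add: inner2_self)
    also have "\<dots> \<le> (1 / 2) ^ n * norm2 ?w + (1 / 2) ^ m * norm2 ?w"
      using VF[OF w, of n] VF[OF w, of m] by linarith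
    finally show "(norm2 ?w)\<^sup>2 \<le> ((1 / 2) ^ n + (1 / 2) ^ m) * norm2 ?w" by (simp add: algebra_simps)
  qed simp
  \<comment> \<open>Testing \<open>V n\<close> against itself; Fatou later needs this uniform bound
    to make the norm of \<open>u\<close> square integrable.\<close>
  have V_bound: "norm2 (V n) \<le> C + 1" for n
  proof (rule cancel)
    have "(norm2 (V n))\<^sup>2 \<le> C * norm2 (V n) + (1 / 2) ^ n * norm2 (V n)"
      using VF[OF V, of n n] F_bound[OF V, of n] by (simp add: inner2_self abs_le_iff)
    also have "\<dots> \<le> C * norm2 (V n) + 1 * norm2 (V n)"
      by (intro add_left_mono mult_right_mono norm2_nonneg) (simp add: power_le_one)
    finally show "(norm2 (V n))\<^sup>2 \<le> (C + 1) * norm2 (V n)" by (simp add: algebra_simps)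
  qed (use C_nonneg in simp)
  define P where "P x \<longleftrightarrow> summable (\<lambda>n. cell_norm (\<lambda>y. V (Suc n) x y - V n x y))" for x
  have "summable (\<lambda>n. norm2 (\<lambda>x y. V (Suc n) x y - V n x y))"
  proof (rule summable_comparison_test')
    show "summable (\<lambda>n. 2 * (1 / 2 :: real) ^ n)" by (intro summable_mult summable_geometric) simp
    show "norm (norm2 (\<lambda>x y. V (Suc n) x y - V n x y)) \<le> 2 * (1 / 2) ^ n" if "n \<ge> 0" for n
    proof -
      have "(1 / 2 :: real) ^ Suc n \<le> (1 / 2) ^ n" by (intro power_decreasing) auto
      then show ?thesis using V_diff[of "Suc n" n] norm2_nonneg by (simp only: real_norm_def abs_of_nonneg)
    qed
  qed
  then have "AE x in M. summable (\<lambda>n. \<bar>cell_norm (\<lambda>y. V (Suc n) x y - V n x y)\<bar>)"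
    unfolding norm2_def
    by (intro M.L2_summable_AE simple_cell_norm_L2[OF simple_C_per_diff[OF V V]])
  then have AE_P: "AE x in M. P x" by (simp add: P_def)
  \<comment> \<open>The value 0 off \<open>P\<close> keeps \<open>u x\<close> in
    \<open>cell_L2\<close> for every \<open>x\<close> in \<open>\<Omega>\<close>, as
    \<open>bochner_L2\<close> demands, and not merely for almost every one.\<close>
  define u where "u x = (if P x then (\<lambda>y. lim (\<lambda>n. V n x y)) else (\<lambda>y. 0))" for x
  have VL: "V n x \<in> cell_L2" if "x \<in> \<Omega>" for n x by (rule simple_cell_L2[OF V that])
  have u: "u x \<in> cell_L2" if x: "x \<in> \<Omega>" for x
    using Y.L2_complete(1)[of "\<lambda>n. V n x", OF VL[OF x]] by (simp add: u_def P_def)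
  have u_lim: "AE x in M. x \<in> \<Omega> \<and> (\<lambda>n. cell_norm (\<lambda>y. V n x y - u x y)) \<longlonglongrightarrow> 0"
    using AE_P AE_space
  proof eventually_elim
    case (elim x)
    then show ?case
      using Y.L2_complete(2)[of "\<lambda>n. V n x", OF VL] by (simp add: u_def P_def)
  qed
  have u_norm: "(\<lambda>x. cell_norm (u x)) \<in> L2_space M"
  proof -
    have ae: "AE x in M. (\<lambda>n. cell_norm (V n x)) \<longlonglongrightarrow> cell_norm (u x)"
      using u_lim
    proof eventually_elim
      case (elim x)
      then show ?case
        using L2_norm_diff_abs[OF VL u, of x x]
        by (intro LIM_zero_cancel[OF Lim_null_comparison[OF _ conjunct2[OF elim]]]) auto
    qed
    have "(\<lambda>x. cell_norm (u x)) \<in> borel_measurable M"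
      by (rule measurable_lebesgue_on_AE_limit[OF Oms _ ae]) (rule L2_spaceD[OF simple_cell_norm_L2[OF V]])
    from L2_Fatou(1)[OF simple_cell_norm_L2[OF V] this ae, of "C + 1"] V_bound
    show ?thesis by (simp add: norm2_def)
  qed
  have uL: "u \<in> L2_L2 \<Omega>"
    unfolding L2_L2_def bochner_L2_def strongly_measurable_def
    using u V VL u_lim L2_spaceD(2)[OF u_norm]
    by (auto intro!: exI[of _ V] simp: simple_C_per_def)
  \<comment> \<open>For \<open>m \<ge> n\<close> the sum of the two errors is at most
    \<open>2 * (1 / 2) ^ n\<close>; Fatou lets \<open>m\<close> tend to infinity.\<close>
  have E: "(\<lambda>x. cell_norm (\<lambda>y. V n x y - u x y)) \<in> L2_space M"
    "L2_norm M (\<lambda>x. cell_norm (\<lambda>y. V n x y - u x y)) \<le> 2 * (1 / 2) ^ n" for n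
  proof -
    let ?g = "\<lambda>m x. cell_norm (\<lambda>y. V n x y - V m x y)"
    have gL: "?g m \<in> L2_space M" for m by (rule simple_cell_norm_L2[OF simple_C_per_diff[OF V V]])
    have ae: "AE x in M. (\<lambda>m. ?g m x) \<longlonglongrightarrow> cell_norm (\<lambda>y. V n x y - u x y)"
      using u_lim
    proof eventually_elim
      case (elim x)
      then have x: "x \<in> \<Omega>" by simp
      have "\<bar>?g m x - cell_norm (\<lambda>y. V n x y - u x y)\<bar> \<le> cell_norm (\<lambda>y. V m x y - u x y)" for m
        using L2_norm_diff_abs[OF L2_space_diff[OF VL[OF x] VL[OF x]] L2_space_diff[OF VL[OF x] u[OF x]], of n m n]
        by (simp add: L2_norm_minus_commute[of _ "u x"])
      then show ?case
        by (intro LIM_zero_cancel[OF Lim_null_comparison[OF _ conjunct2[OF elim]]]) auto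
    qed
    have meas: "(\<lambda>x. cell_norm (\<lambda>y. V n x y - u x y)) \<in> borel_measurable M"
      by (rule measurable_lebesgue_on_AE_limit[OF Oms _ ae]) (rule L2_spaceD[OF gL])
    have bd: "\<forall>\<^sub>F m in sequentially. L2_norm M (?g m) \<le> 2 * (1 / 2) ^ n"
      unfolding eventually_sequentially
    proof (intro exI allI impI)
      fix m assume "n \<le> m"
      then have "(1 / 2 :: real) ^ m \<le> (1 / 2) ^ n" by (intro power_decreasing) auto
      then show "L2_norm M (?g m) \<le> 2 * (1 / 2) ^ n"
        using V_diff[of n m] unfolding norm2_def by linarith
    qed
    show "(\<lambda>x. cell_norm (\<lambda>y. V n x y - u x y)) \<in> L2_space M"
      "L2_norm M (\<lambda>x. cell_norm (\<lambda>y. V n x y - u x y)) \<le> 2 * (1 / 2) ^ n"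
      using L2_Fatou[OF gL meas ae bd] by auto
  qed
  define G where "G w = (LINT x|M. cell_mean (\<lambda>y. u x y * w x y))" for w
  have w_int: "integrable M (\<lambda>x. cell_mean (\<lambda>y. u x y * w x y))" if w: "w \<in> simple_C_per \<Omega>" for w
  proof (rule Bochner_Integration.integrable_bound[OF L2_mult_integrable[OF u_norm simple_cell_norm_L2[OF w]]])
    show "(\<lambda>x. cell_mean (\<lambda>y. u x y * w x y)) \<in> borel_measurable M"
    proof (rule measurable_lebesgue_on_AE_limit[OF Oms])
      show "(\<lambda>x. cell_mean (\<lambda>y. V n x y * w x y)) \<in> borel_measurable M" for n
        using simple_inner_integrable[OF V w] by (rule borel_measurable_integrable)
      show "AE x in M. (\<lambda>n. cell_mean (\<lambda>y. V n x y * w x y)) \<longlonglongrightarrow> cell_mean (\<lambda>y. u x y * w x y)"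
        using u_lim
      proof eventually_elim
        case (elim x)
        then have x: "x \<in> \<Omega>" and lim: "(\<lambda>n. cell_norm (\<lambda>y. V n x y - u x y) * cell_norm (w x)) \<longlonglongrightarrow> 0"
          by (auto intro: tendsto_mult_left_zero)
        have "\<forall>\<^sub>F n in sequentially.
            norm (cell_mean (\<lambda>y. V n x y * w x y) - cell_mean (\<lambda>y. u x y * w x y))
              \<le> cell_norm (\<lambda>y. V n x y - u x y) * cell_norm (w x)"
          using cell_mean_mult_le[OF VL[OF x] u[OF x] simple_cell_L2[OF w x]] by simp
        from LIM_zero_cancel[OF Lim_null_comparison[OF this lim]] show ?case .
      qed
    qed
    show "AE x in M. norm (cell_mean (\<lambda>y. u x y * w x y)) \<le> norm (cell_norm (u x) * cell_norm (w x))"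
      using AE_space
      by eventually_elim (use L2_Cauchy_Schwarz[OF u simple_cell_L2[OF w]] in auto)
  qed
  have GF: "G w = F w" if w: "w \<in> simple_C_per \<Omega>" for w
  proof -
    \<comment> \<open>Two of the three parts come from replacing \<open>u\<close> by
      \<open>V n\<close>, the third from \<open>V n\<close> representing \<open>F\<close> only
      nearly. The left side is independent of \<open>n\<close>.\<close>
    have "\<bar>G w - F w\<bar> \<le> (3 * norm2 w) * (1 / 2) ^ n" for n
    proof -
      have "inner2 (V n) w - G w = (LINT x|M. cell_mean (\<lambda>y. V n x y * w x y) - cell_mean (\<lambda>y. u x y * w x y))"
        unfolding inner2_def G_def using simple_inner_integrable[OF V w] w_int[OF w] by simp
      also have "\<bar>\<dots>\<bar> \<le> (LINT x|M. cell_norm (\<lambda>y. V n x y - u x y) * cell_norm (w x))"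
      proof -
        have "\<bar>LINT x|M. cell_mean (\<lambda>y. V n x y * w x y) - cell_mean (\<lambda>y. u x y * w x y)\<bar> \<le>
            (LINT x|M. \<bar>cell_mean (\<lambda>y. V n x y * w x y) - cell_mean (\<lambda>y. u x y * w x y)\<bar>)"
          by (rule integral_abs_bound)
        also have "\<dots> \<le> (LINT x|M. cell_norm (\<lambda>y. V n x y - u x y) * cell_norm (w x))"
          using simple_inner_integrable[OF V w] w_int[OF w] L2_mult_integrable[OF E(1) simple_cell_norm_L2[OF w]]
            cell_mean_mult_le[OF VL u simple_cell_L2[OF w]]
          by (intro integral_mono) auto
        finally show ?thesis .
      qed
      also have "\<dots> \<le> L2_norm M (\<lambda>x. cell_norm (\<lambda>y. V n x y - u x y)) * norm2 w"
        unfolding norm2_def using L2_Cauchy_Schwarz[OF E(1) simple_cell_norm_L2[OF w], of n] by linarith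
      also have "\<dots> \<le> 2 * (1 / 2) ^ n * norm2 w"
        by (intro mult_right_mono E(2) norm2_nonneg)
      finally show ?thesis using VF[OF w, of n] by (simp add: algebra_simps abs_le_iff)
    qed
    then have "\<bar>G w - F w\<bar> \<le> 0" by (rule le_of_all_pow_half)
    then show ?thesis by simp
  qed
  show thesis
  proof (rule that[OF uL])
    fix \<psi> assume psi: "\<psi> \<in> L2_C_per \<Omega>"
    note psiC = L2_C_perD(1)[OF psi] and psiN = L2_C_perD(2)[OF psi]
    obtain s :: "nat \<Rightarrow> _" where s: "\<And>i. s i \<in> simple_C_per \<Omega>"
      and s_lim: "AE x in M. (\<lambda>i. sup_norm (\<lambda>y. s i x y - \<psi> x y)) \<longlonglongrightarrow> 0"
      using L2_C_perD(3)[OF psi] by blast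
    \<comment> \<open>Joint measurability of \<open>\<psi>\<close> is not part of its definition.
      For almost every \<open>x\<close> the approximations converge uniformly in the second
      variable, hence also along the oscillation.\<close>
    have osc_psi: "osc j \<psi> \<in> L2_space M" for j
    proof (rule osc_L2I(1)[OF _ psiN])
      show "osc j \<psi> \<in> borel_measurable M"
      proof (rule measurable_lebesgue_on_AE_limit[OF Oms pairing_simple(2)[OF s]])
        show "AE x in M. (\<lambda>i. osc j (s i) x) \<longlonglongrightarrow> osc j \<psi> x"
          using s_lim AE_space
        proof eventually_elim
          case (elim x)
          then have x: "x \<in> \<Omega>" by simp
          have "\<bar>osc j (s i) x - osc j \<psi> x\<bar> \<le> sup_norm (\<lambda>y. s i x y - \<psi> x y)" for i
            using C_per_abs_le_sup_norm[OF C_per_diff[OF simple_C_perD(2)[OF s x] psiC[OF x]]]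
              sup_norm_nonneg[OF C_per_diff[OF simple_C_perD(2)[OF s x] psiC[OF x]]]
            by (auto simp: osc_def indicator_def)
          then show ?case by (intro LIM_zero_cancel[OF Lim_null_comparison[OF _ elim(1)]]) auto
        qed
      qed
      show "\<bar>\<psi> x y\<bar> \<le> sup_norm (\<psi> x)" if "x \<in> \<Omega>" for x y
        by (rule C_per_abs_le_sup_norm[OF psiC[OF that]])
    qed
    have mean_diff: "\<bar>cell_mean (\<lambda>y. u x y * f y) - cell_mean (\<lambda>y. u x y * g y)\<bar> \<le>
        cell_norm (u x) * sup_norm (\<lambda>y. f y - g y)" if x: "x \<in> \<Omega>" and f: "f \<in> C_per" and g: "g \<in> C_per" for x f g
    proof -
      have "\<bar>cell_mean (\<lambda>y. u x y * f y) - cell_mean (\<lambda>y. u x y * g y)\<bar> \<le>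
          cell_norm (\<lambda>y. f y - g y) * cell_norm (u x)"
        using cell_mean_mult_le[OF C_per_L2_space[OF f] C_per_L2_space[OF g] u[OF x]] by (simp add: mult.commute)
      also have "\<dots> \<le> sup_norm (\<lambda>y. f y - g y) * cell_norm (u x)"
        by (intro mult_right_mono L2_norm_le_sup_norm C_per_diff f g) simp
      finally show ?thesis by (simp add: mult.commute)
    qed
    have psi_int: "integrable M (\<lambda>x. cell_mean (\<lambda>y. u x y * \<psi> x y))"
    proof (rule Bochner_Integration.integrable_bound[OF L2_mult_integrable[OF u_norm psiN]])
      show "(\<lambda>x. cell_mean (\<lambda>y. u x y * \<psi> x y)) \<in> borel_measurable M"
      proof (rule measurable_lebesgue_on_AE_limit[OF Oms borel_measurable_integrable[OF w_int[OF s]]])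
        show "AE x in M. (\<lambda>i. cell_mean (\<lambda>y. u x y * s i x y)) \<longlonglongrightarrow> cell_mean (\<lambda>y. u x y * \<psi> x y)"
          using s_lim AE_space
        proof eventually_elim
          case (elim x)
          then have x: "x \<in> \<Omega>" by simp
          have lim: "(\<lambda>i. cell_norm (u x) * sup_norm (\<lambda>y. s i x y - \<psi> x y)) \<longlonglongrightarrow> 0"
            by (rule tendsto_mult_right_zero[OF elim(1)])
          have "\<forall>\<^sub>F i in sequentially.
              norm (cell_mean (\<lambda>y. u x y * s i x y) - cell_mean (\<lambda>y. u x y * \<psi> x y))
                \<le> cell_norm (u x) * sup_norm (\<lambda>y. s i x y - \<psi> x y)"
            using mean_diff[OF x simple_C_perD(2)[OF s x] psiC[OF x]] by simp
          from LIM_zero_cancel[OF Lim_null_comparison[OF this lim]] show ?case .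
        qed
      qed
      show "AE x in M. norm (cell_mean (\<lambda>y. u x y * \<psi> x y)) \<le> norm (cell_norm (u x) * sup_norm (\<psi> x))"
        using AE_space
      proof eventually_elim
        case (elim x)
        then show ?case
          using mean_diff[of x "\<psi> x" "\<lambda>_. 0"] psiC[of x] sup_norm_nonneg[OF psiC, of x] by simp
      qed
    qed
    show "(\<lambda>j. pairing (\<phi> j) \<psi>) \<longlonglongrightarrow> (LINT x|M. cell_mean (\<lambda>y. u x y * \<psi> x y))"
      unfolding G_def[symmetric]
    proof (rule LIMSEQ_I)
      fix e :: real assume e: "e > 0"
      \<comment> \<open>\<open>C\<close> is the cost of passing from \<open>\<psi>\<close> to
        \<open>w\<close> in the pairings, \<open>norm2 u\<close> the cost in the limit; the added 1
        keeps the divisor positive.\<close>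
      let ?K = "C + norm2 u + 1"
      have K: "?K > 0" using C_nonneg norm2_nonneg[of u] by simp
      define d where "d = e / (2 * ?K)"
      have d: "d > 0" using e K by (simp add: d_def)
      have half: "X * (e / (2 * X)) = e / 2" if "X > 0" for X using that by simp
      have Kd: "?K * d = e / 2" unfolding d_def by (rule half[OF K])
      obtain w where w: "w \<in> simple_C_per \<Omega>"
        and h: "(\<lambda>x. sup_norm (\<lambda>y. \<psi> x y - w x y)) \<in> L2_space M"
        and hd: "L2_norm M (\<lambda>x. sup_norm (\<lambda>y. \<psi> x y - w x y)) \<le> d"
        using L2_C_per_approx[OF Om psi d] by blast
      have pw: "\<bar>pairing j \<psi> - pairing j w\<bar> \<le> C * d" for j
      proof -
        have "\<bar>pairing j \<psi> - pairing j w\<bar> \<le> C * L2_norm M (\<lambda>x. sup_norm (\<lambda>y. \<psi> x y - w x y))"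
          by (rule pairing_diff_le[OF osc_psi osc_simple_L2[OF w] h])
            (use C_per_abs_le_sup_norm[OF C_per_diff[OF psiC simple_C_perD(2)[OF w]]] in blast)
        also have "\<dots> \<le> C * d" by (rule mult_left_mono[OF hd C_nonneg])
        finally show ?thesis .
      qed
      have "G \<psi> - G w = (LINT x|M. cell_mean (\<lambda>y. u x y * \<psi> x y) - cell_mean (\<lambda>y. u x y * w x y))"
        unfolding G_def using psi_int w_int[OF w] by simp
      also have "\<bar>\<dots>\<bar> \<le> (LINT x|M. cell_norm (u x) * sup_norm (\<lambda>y. \<psi> x y - w x y))"
      proof -
        have "\<bar>LINT x|M. cell_mean (\<lambda>y. u x y * \<psi> x y) - cell_mean (\<lambda>y. u x y * w x y)\<bar> \<le>
            (LINT x|M. \<bar>cell_mean (\<lambda>y. u x y * \<psi> x y) - cell_mean (\<lambda>y. u x y * w x y)\<bar>)"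
          by (rule integral_abs_bound)
        also have "\<dots> \<le> (LINT x|M. cell_norm (u x) * sup_norm (\<lambda>y. \<psi> x y - w x y))"
          using psi_int w_int[OF w] L2_mult_integrable[OF u_norm h] mean_diff psiC simple_C_perD(2)[OF w]
          by (intro integral_mono) auto
        finally show ?thesis .
      qed
      also have "\<dots> \<le> norm2 u * d"
        using L2_Cauchy_Schwarz[OF u_norm h] mult_left_mono[OF hd norm2_nonneg[of u]]
        unfolding norm2_def by linarith
      finally have Gw: "\<bar>G \<psi> - G w\<bar> \<le> norm2 u * d" .
      have "C * d + norm2 u * d + d = e / 2" using Kd by (simp add: algebra_simps)
      moreover obtain J where J: "\<And>j. j \<ge> J \<Longrightarrow> norm (pairing (\<phi> j) w - F w) < e / 2"
        using LIMSEQ_D[OF F[OF w], of "e / 2"] e by auto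
      ultimately have "norm (pairing (\<phi> j) \<psi> - G \<psi>) < e" if "j \<ge> J" for j
        using J[OF that] pw[of "\<phi> j"] Gw GF[OF w] d unfolding real_norm_def by linarith
      then show "\<exists>J. \<forall>j\<ge>J. norm (pairing (\<phi> j) \<psi> - G \<psi>) < e" by blast
    qed
  qed
qed

end

section \<open>Return to the cells \<open>Y\<^sub>x\<close> and conclusion\<close>

text \<open>The map \<open>D x\<close> multiplies integral and volume by the same constant, which
  cancels. As \<open>f\<close> is measurable on the unit cell only, it is extended by 0 before the
  change of variables.\<close>

lemma cell_average:
  fixes D :: "real ^ 'd \<Rightarrow> real ^ 'd ^ 'd" and f :: "real ^ 'd \<Rightarrow> real"
  assumes A: "invertible (D x)" and f: "f \<in> borel_measurable (lebesgue_on unit_cell)"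
  shows "(1 / measure lebesgue (cell D x)) * (LINT y|lebesgue_on (cell D x). f (matrix_inv (D x) *v y)) =
    cell_mean f"
proof -
  obtain c where c: "c > 0" "\<And>S. S \<in> lmeasurable \<Longrightarrow> affine_map (D x) 0 ` S \<in> lmeasurable"
    "\<And>S. S \<in> lmeasurable \<Longrightarrow> measure lebesgue (affine_map (D x) 0 ` S) = c * measure lebesgue S"
    "affine_inv (D x) 0 \<in> measurable lebesgue lebesgue"
    "\<And>g :: real ^ 'd \<Rightarrow> real. g \<in> borel_measurable lebesgue \<Longrightarrow>
       (LINT y|lebesgue. g (affine_inv (D x) 0 y)) = c * (LINT y|lebesgue. g y)"
    using affine_inv_integral[OF A] by blast
  have cell: "cell D x = affine_map (D x) 0 ` unit_cell"
    by (simp add: cell_def affine_map_def)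
  have inv: "matrix_inv (D x) *v y = affine_inv (D x) 0 y" for y by (simp add: affine_inv_def)
  have mem: "y \<in> cell D x \<longleftrightarrow> affine_inv (D x) 0 y \<in> unit_cell" for y
  proof
    assume "y \<in> cell D x"
    then show "affine_inv (D x) 0 y \<in> unit_cell"
      unfolding cell by (auto simp: affine_inv_affine_map(1)[OF A])
  next
    assume "affine_inv (D x) 0 y \<in> unit_cell"
    then have "affine_map (D x) 0 (affine_inv (D x) 0 y) \<in> cell D x" unfolding cell by blast
    then show "y \<in> cell D x" by (simp only: affine_inv_affine_map(2)[OF A])
  qed
  have cl: "cell D x \<in> sets lebesgue"
    unfolding cell by (rule fmeasurableD[OF c(2)[OF unit_cell_lmeasurable]])
  have m: "(\<lambda>y. indicator unit_cell y *\<^sub>R f y) \<in> borel_measurable lebesgue"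
    using f fmeasurableD[OF unit_cell_lmeasurable] by (subst (asm) borel_measurable_restrict_space_iff) auto
  have "(LINT y|lebesgue_on (cell D x). f (affine_inv (D x) 0 y)) =
      (LINT y|lebesgue. indicator (cell D x) y *\<^sub>R f (affine_inv (D x) 0 y))"
    by (rule integral_restrict_space) (use cl in simp)
  also have "\<dots> = (LINT y|lebesgue. (\<lambda>y. indicator unit_cell y *\<^sub>R f y) (affine_inv (D x) 0 y))"
    by (intro Bochner_Integration.integral_cong) (auto simp: mem indicator_def)
  also have "\<dots> = c * (LINT y|lebesgue. indicator unit_cell y *\<^sub>R f y)"
    by (rule c(5)[OF m])
  also have "(LINT y|lebesgue. indicator unit_cell y *\<^sub>R f y) = cell_mean f"
    by (rule integral_restrict_space[symmetric]) (use fmeasurableD[OF unit_cell_lmeasurable] in simp)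
  finally show ?thesis
    using c(1) c(3)[OF unit_cell_lmeasurable] measure_unit_cell[where 'd = 'd] by (simp add: cell inv)
qed

text \<open>\<open>D x *v w\<close> is jointly continuous on a compact product. The box of all
  \<open>w\<close> contains the differences of points of the unit cell, so \<open>M\<close> bounds
  the diameters of the cells.\<close>

lemma bounded_matrix_image:
  fixes D :: "real ^ 'd \<Rightarrow> real ^ 'd ^ 'd"
  assumes D: "continuous_on UNIV D" and S: "bounded S"
  obtains M where "\<And>x w. x \<in> S \<Longrightarrow> (\<And>i. \<bar>w $ i\<bar> \<le> 1) \<Longrightarrow> norm (D x *v w) \<le> M"
proof -
  let ?W = "cbox (- 1) 1 :: (real ^ 'd) set"
  let ?f = "\<lambda>z. D (fst z) *v snd z"
  have D': "continuous_on K (\<lambda>z :: (real ^ 'd) \<times> (real ^ 'd). D (fst z))" for K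
    by (rule continuous_on_compose2[OF D]) (auto intro: continuous_intros)
  have "continuous_on (closure S \<times> ?W) ?f"
    unfolding matrix_vector_mult_def
    by (intro continuous_on_vec_lambda continuous_on_sum continuous_on_mult continuous_on_component
        D' continuous_on_snd continuous_on_id)
  moreover have "compact (closure S \<times> ?W)"
    using S by (intro compact_Times) auto
  ultimately have "bounded (?f ` (closure S \<times> ?W))"
    by (intro compact_imp_bounded compact_continuous_image)
  then obtain M where M: "\<And>z. z \<in> closure S \<times> ?W \<Longrightarrow> norm (?f z) \<le> M"
    unfolding bounded_iff by blast
  show thesis
  proof (rule that)
    fix x and w :: "real ^ 'd" assume x: "x \<in> S" and w: "\<And>i. \<bar>w $ i\<bar> \<le> 1"
    have "- 1 \<le> w $ i" "w $ i \<le> 1" for i using w[of i] by auto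
    then have "(x, w) \<in> closure S \<times> ?W" using x closure_subset by (auto simp: mem_box_cart)
    from M[OF this] show "norm (D x *v w) \<le> M" by simp
  qed
qed

theorem theorem2:
  fixes \<Omega> :: "(real ^ 'd) set"
    and D :: "real ^ 'd \<Rightarrow> real ^ 'd ^ 'd"
    and D1 D2 r :: real
    and \<epsilon> :: "nat \<Rightarrow> real"
    and N :: "nat \<Rightarrow> nat"
    and Q :: "nat \<Rightarrow> nat \<Rightarrow> (real ^ 'd) set"
    and p q :: "nat \<Rightarrow> nat \<Rightarrow> real ^ 'd"
    and us :: "nat \<Rightarrow> real ^ 'd \<Rightarrow> real"
  assumes domain: "bounded_lipschitz_domain \<Omega>"
    and D_invertible: "\<And>x. invertible (D x)"
    and D_lipschitz: "\<exists>L. L-lipschitz_on UNIV D"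
    and D_inv_lipschitz: "\<exists>L. L-lipschitz_on UNIV (\<lambda>x. matrix_inv (D x))"
    and D1_pos: "0 < D1"
    and D_det: "\<And>x. x \<in> closure \<Omega> \<Longrightarrow> D1 \<le> \<bar>det (D x)\<bar> \<and> \<bar>det (D x)\<bar> \<le> D2"
    and r: "0 < r" "r < 1"
    and eps_pos: "\<And>j. 0 < \<epsilon> j"
    and eps_lim: "\<epsilon> \<longlonglongrightarrow> 0"
    and covering: "\<And>j. cube_covering \<Omega> (\<epsilon> j powr r) (N j) (Q j)"
    and points: "\<And>j. admissible_points \<Omega> D (\<epsilon> j) (N j) (Q j) (p j) (q j)"
    and us_L2: "\<And>j. us j \<in> L2_space (lebesgue_on \<Omega>)"
    and us_bounded: "\<exists>C. \<forall>j. L2_norm (lebesgue_on \<Omega>) (us j) \<le> C"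
  shows "\<exists>\<phi> :: nat \<Rightarrow> nat. strict_mono \<phi> \<and>
           (\<exists>u \<in> L2_L2_cell D \<Omega>.
              lts_converges \<Omega> D (\<epsilon> \<circ> \<phi>) (N \<circ> \<phi>) (Q \<circ> \<phi>) (p \<circ> \<phi>) (q \<circ> \<phi>) (us \<circ> \<phi>) u)"
proof -
  have Om: "open \<Omega>" "bounded \<Omega>" using domain by (auto simp: bounded_lipschitz_domain_def)
  have "continuous_on UNIV D" using D_lipschitz lipschitz_on_continuous_on by blast
  then obtain M where M: "\<And>x w. x \<in> \<Omega> \<Longrightarrow> (\<And>i. \<bar>w $ i\<bar> \<le> 1) \<Longrightarrow> norm (D x *v w) \<le> M"
    using bounded_matrix_image Om(2) by metis
  obtain C where C: "\<And>j. L2_norm (lebesgue_on \<Omega>) (us j) \<le> C" using us_bounded by blast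
  have powr_lim: "(\<lambda>j. \<epsilon> j powr a) \<longlonglongrightarrow> 0" if "a > 0" for a
    using eps_lim that eps_pos by (intro tendsto_zero_powrI[OF _ tendsto_const]) (auto intro!: always_eventually less_imp_le)
  interpret lp_setting \<Omega> D \<epsilon> "\<lambda>j. \<epsilon> j powr r" N Q p q M
  proof
    show "(\<lambda>j. \<epsilon> j / \<epsilon> j powr r) \<longlonglongrightarrow> 0"
    proof -
      \<comment> \<open>The exponent \<open>1 - r\<close> is positive, so the cells become small
        relative to the cubes.\<close>
      have "\<epsilon> j / \<epsilon> j powr r = \<epsilon> j powr (1 - r)" for j
        using eps_pos[of j] by (simp add: powr_diff)
      then show ?thesis using powr_lim[of "1 - r"] r by simp
    qed
    show "0 < \<epsilon> j powr r" for j using eps_pos[of j] by simp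
    show "p j n \<in> \<Omega>" if "n \<in> {1..N j}" for j n
      using points[of j] that unfolding admissible_points_def by blast
    fix j
    show "disjoint_family_on (Q j) {1..N j}" using covering[of j] by (simp add: cube_covering_def)
    fix n assume "n \<in> {1..N j}"
    then show "open_cube (\<epsilon> j powr r) (Q j n)" "Q j n \<inter> \<Omega> \<noteq> {}"
      using covering[of j] unfolding cube_covering_def by blast+
  qed (use Om D_invertible M eps_pos eps_lim powr_lim r in auto)
  interpret oscillation \<Omega> cubes phase us C
    by standard (use lmeasurable_Om cubes_sets_borel phase_borel_measurable oscillation_upper_bound
        us_L2 C in auto)
  obtain \<phi> :: "nat \<Rightarrow> nat" where phi: "strict_mono \<phi>"
    "\<And>s. s \<in> simple_C_per \<Omega> \<Longrightarrow> convergent (\<lambda>j. pairing (\<phi> j) s)"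
    using convergent_subsequence by blast
  obtain u where u: "u \<in> L2_L2 \<Omega>"
    and lim: "\<And>\<psi>. \<psi> \<in> L2_C_per \<Omega> \<Longrightarrow>
      (\<lambda>j. pairing (\<phi> j) \<psi>) \<longlonglongrightarrow> (LINT x|lebesgue_on \<Omega>. cell_mean (\<lambda>y. u x y * \<psi> x y))"
    using two_scale_limit[OF phi] by blast
  have u': "to_cell D u \<in> L2_L2_cell D \<Omega>" using u by (simp add: L2_L2_cell_def)
  have pairing: "pairing j \<psi> =
      (LINT x|lebesgue_on \<Omega>. us j x * lp_approx D (\<epsilon> j) (N j) (Q j) (p j) (q j) \<psi> x)" for j \<psi>
    by (simp add: pairing_def osc_def lp_approx_eq)
  \<comment> \<open>Dividing by the volume of the cell makes both sides averages, which turns the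
    limit found on the unit cell into the one of the definition.\<close>
  have avg: "(1 / measure lebesgue (cell D x)) *
      (LINT y|lebesgue_on (cell D x). to_cell D u x y * to_cell D \<psi> x y) = cell_mean (\<lambda>y. u x y * \<psi> x y)"
    if "\<psi> \<in> L2_C_per \<Omega>" "x \<in> \<Omega>" for \<psi> x
  proof -
    have "u x \<in> L2_space (lebesgue_on unit_cell)" "\<psi> x \<in> L2_space (lebesgue_on unit_cell)"
      using u that C_per_L2_space[OF L2_C_perD(1)] by (auto simp: L2_L2_def bochner_L2_def)
    then have "(\<lambda>y. u x y * \<psi> x y) \<in> borel_measurable (lebesgue_on unit_cell)"
      by (intro borel_measurable_times L2_spaceD(1))
    from cell_average[OF D_invertible this] show ?thesis by (simp add: to_cell_def)
  qed
  have "lts_converges \<Omega> D (\<epsilon> \<circ> \<phi>) (N \<circ> \<phi>) (Q \<circ> \<phi>) (p \<circ> \<phi>) (q \<circ> \<phi>) (us \<circ> \<phi>) (to_cell D u)"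
    unfolding lts_converges_def
  proof (intro conjI allI impI)
    fix \<psi> \<psi>' :: "real ^ 'd \<Rightarrow> real ^ 'd \<Rightarrow> real" assume "\<psi>' \<in> L2_C_per \<Omega> \<and> \<psi> = to_cell D \<psi>'"
    then have psi: "\<psi>' \<in> L2_C_per \<Omega>" "\<psi> = to_cell D \<psi>'" by auto
    have "(LINT x|lebesgue_on \<Omega>. 1 / measure lebesgue (cell D x) *
          (LINT y|lebesgue_on (cell D x). to_cell D u x y * \<psi> x y)) =
        (LINT x|lebesgue_on \<Omega>. cell_mean (\<lambda>y. u x y * \<psi>' x y))"
      unfolding psi(2) by (intro Bochner_Integration.integral_cong refl avg psi) simp
    with lim[OF psi(1)]
    show "(\<lambda>j. LINT x|lebesgue_on \<Omega>. (us \<circ> \<phi>) j x *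
          lp_approx D ((\<epsilon> \<circ> \<phi>) j) ((N \<circ> \<phi>) j) ((Q \<circ> \<phi>) j) ((p \<circ> \<phi>) j) ((q \<circ> \<phi>) j) \<psi>' x)
        \<longlonglongrightarrow> (LINT x|lebesgue_on \<Omega>. 1 / measure lebesgue (cell D x) *
          (LINT y|lebesgue_on (cell D x). to_cell D u x y * \<psi> x y))"
      by (simp add: pairing)
  qed (use us_L2 u' in auto)
  with phi(1) u' show ?thesis by blast
qed

end
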